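(* There is an undetermined game of length $\omega$ whose move set is the set of all sequences of zeros and ones of length $\omega_1$ and whose payoff set is ordinal definable.
   Context: We work in ZFC. Games: a game is given by an ordinal $\theta$ (its length), a nonempty set $S$ (the move set; one says the game is "on $S$"), and a payoff set $A$ of sequences of moves. It is a perfect information game of two players who move in turns, and at limit ordinals the first player moves (so the first player makes the moves with index $\lambda+2n$ and the second player those with index $\lambda+2n+1$, for $\lambda$ zero or a limit ordinal and $n<\omega$). Each move consists of picking an element of $S$. A position is the sequence of moves made so far at a point before the game ends. The game ends once the sequence of moves has length $\theta$; this sequence is the play. The first player wins if the play belongs to $A$; otherwise the second player wins. A strategy for a player is a mapping that assigns a valid move to every position at which it is that player's turn. A strategy is winning if the player wins whenever he follows it, regardless of the choices of the other player. A game is determined if one of the players has a winning strategy, and undetermined otherwise. A set is ordinal definable if there is an ordinal $\lambda$ such that the set is definable in $V_\lambda$ by a first-order formula with ordinal parameters. *)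

theory Defs
  imports Main
begin

text \<open>
  ``Working in ZFC'' is rendered as working inside an arbitrary model of first-order ZFC: a type
  with a binary relation satisfying the axioms, Separation and Replacement being schemes indexed
  by first-order formulas of the language of set theory. A ZFC theorem is a statement true in all
  such models. The model need not be well-founded, so ordinals, functions, strategies, etc. below
  are always elements of the model and never objects of HOL.
\<close>

section \<open>First-order formulas of the language of set theory\<close>

datatype fm =
    Mem nat nat
  | Eq nat nat
  | Neg fm
  | Conj fm fm
  | Forall nat fm

primrec sat :: "'v set \<Rightarrow> ('v \<Rightarrow> 'v \<Rightarrow> bool) \<Rightarrow> (nat \<Rightarrow> 'v) \<Rightarrow> fm \<Rightarrow> bool" where
  "sat D E e (Mem i j) \<longleftrightarrow> E (e i) (e j)"
| "sat D E e (Eq i j) \<longleftrightarrow> e i = e j"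
| "sat D E e (Neg \<phi>) \<longleftrightarrow> \<not> sat D E e \<phi>"
| "sat D E e (Conj \<phi> \<psi>) \<longleftrightarrow> sat D E e \<phi> \<and> sat D E e \<psi>"
| "sat D E e (Forall i \<phi>) \<longleftrightarrow> (\<forall>a\<in>D. sat D E (e(i := a)) \<phi>)"

primrec free_vars :: "fm \<Rightarrow> nat set" where
  "free_vars (Mem i j) = {i, j}"
| "free_vars (Eq i j) = {i, j}"
| "free_vars (Neg \<phi>) = free_vars \<phi>"
| "free_vars (Conj \<phi> \<psi>) = free_vars \<phi> \<union> free_vars \<psi>"
| "free_vars (Forall i \<phi>) = free_vars \<phi> - {i}"

datatype player = First | Second

section \<open>Set-theoretic notions\<close>

locale membership =
  fixes mem :: "'v \<Rightarrow> 'v \<Rightarrow> bool"  (infix "\<in>\<^sub>M" 50)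
begin

text \<open>The set of all elements of the model with property \<open>P\<close>; meaningful only if it exists in the
  model, which under ZFC is the case for every use below.\<close>

definition the_set :: "('v \<Rightarrow> bool) \<Rightarrow> 'v" where
  "the_set P = (THE x. \<forall>y. y \<in>\<^sub>M x \<longleftrightarrow> P y)"

definition subset_M :: "'v \<Rightarrow> 'v \<Rightarrow> bool"  (infix "\<subseteq>\<^sub>M" 50) where
  "x \<subseteq>\<^sub>M y \<longleftrightarrow> (\<forall>z. z \<in>\<^sub>M x \<longrightarrow> z \<in>\<^sub>M y)"

definition zero :: 'v where
  "zero = the_set (\<lambda>_. False)"

definition succ :: "'v \<Rightarrow> 'v" where
  "succ x = the_set (\<lambda>y. y \<in>\<^sub>M x \<or> y = x)"

definition one :: 'v where
  "one = succ zero"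

definition upair :: "'v \<Rightarrow> 'v \<Rightarrow> 'v" where
  "upair x y = the_set (\<lambda>z. z = x \<or> z = y)"

definition opair :: "'v \<Rightarrow> 'v \<Rightarrow> 'v" where
  "opair x y = upair (upair x x) (upair x y)"

definition is_function :: "'v \<Rightarrow> 'v \<Rightarrow> 'v \<Rightarrow> bool" where
  "is_function f X Y \<longleftrightarrow>
     (\<forall>p. p \<in>\<^sub>M f \<longrightarrow> (\<exists>x y. x \<in>\<^sub>M X \<and> y \<in>\<^sub>M Y \<and> p = opair x y)) \<and>
     (\<forall>x. x \<in>\<^sub>M X \<longrightarrow> (\<exists>!y. opair x y \<in>\<^sub>M f))"

definition app :: "'v \<Rightarrow> 'v \<Rightarrow> 'v" where
  "app f x = (THE y. opair x y \<in>\<^sub>M f)"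

definition restrict :: "'v \<Rightarrow> 'v \<Rightarrow> 'v" where
  "restrict f X = the_set (\<lambda>p. \<exists>x y. x \<in>\<^sub>M X \<and> p = opair x y \<and> p \<in>\<^sub>M f)"

definition function_set :: "'v \<Rightarrow> 'v \<Rightarrow> 'v" where
  "function_set X Y = the_set (\<lambda>f. is_function f X Y)"

definition transitive :: "'v \<Rightarrow> bool" where
  "transitive x \<longleftrightarrow> (\<forall>y. y \<in>\<^sub>M x \<longrightarrow> y \<subseteq>\<^sub>M x)"

text \<open>By Foundation, a transitive set of transitive sets is well-ordered by membership.\<close>

definition ordinal :: "'v \<Rightarrow> bool" where
  "ordinal \<alpha> \<longleftrightarrow> transitive \<alpha> \<and> (\<forall>\<beta>. \<beta> \<in>\<^sub>M \<alpha> \<longrightarrow> transitive \<beta>)"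

definition limit_ordinal :: "'v \<Rightarrow> bool" where
  "limit_ordinal \<alpha> \<longleftrightarrow> ordinal \<alpha> \<and> \<alpha> \<noteq> zero \<and> (\<forall>\<beta>. \<beta> \<in>\<^sub>M \<alpha> \<longrightarrow> succ \<beta> \<in>\<^sub>M \<alpha>)"

definition omega :: 'v where
  "omega = (THE \<alpha>. limit_ordinal \<alpha> \<and> (\<forall>\<beta>. \<beta> \<in>\<^sub>M \<alpha> \<longrightarrow> \<not> limit_ordinal \<beta>))"

definition countable_set :: "'v \<Rightarrow> bool" where
  "countable_set X \<longleftrightarrow>
     (\<exists>f. is_function f X omega \<and>
          (\<forall>x y. x \<in>\<^sub>M X \<longrightarrow> y \<in>\<^sub>M X \<longrightarrow> app f x = app f y \<longrightarrow> x = y))"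

definition omega1 :: 'v where
  "omega1 = (THE \<alpha>. ordinal \<alpha> \<and> \<not> countable_set \<alpha> \<and> (\<forall>\<beta>. \<beta> \<in>\<^sub>M \<alpha> \<longrightarrow> countable_set \<beta>))"

definition binary_sequences :: "'v \<Rightarrow> 'v" where
  "binary_sequences \<alpha> = function_set \<alpha> (upair zero one)"

text \<open>The von Neumann hierarchy, by the recursion that \<open>V_stage \<alpha>\<close> is the union of the power sets
  of \<open>V_stage \<beta>\<close> for \<open>\<beta> < \<alpha>\<close>. The function \<open>f\<close> is the sequence of the stages up to \<open>\<kappa>\<close>.\<close>

definition V_stage :: "'v \<Rightarrow> 'v" where
  "V_stage \<kappa> =
     (THE v. \<exists>f Y. is_function f (succ \<kappa>) Y \<and>
        (\<forall>\<alpha>. \<alpha> \<in>\<^sub>M succ \<kappa> \<longrightarrow>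
           (\<forall>x. x \<in>\<^sub>M app f \<alpha> \<longleftrightarrow> (\<exists>\<beta>. \<beta> \<in>\<^sub>M \<alpha> \<and> x \<subseteq>\<^sub>M app f \<beta>))) \<and>
        v = app f \<kappa>)"

text \<open>Variable \<open>0\<close> stands for the candidate element; the remaining free variables of the formula
  (finitely many) are assigned ordinals of \<open>V_stage \<kappa>\<close>. Formulas are those of HOL. In a model whose
  set of natural numbers is nonstandard there are further, coded, formulas, but these define
  nothing new: the code of a formula is itself an ordinal and may serve as a parameter.\<close>

definition ordinal_definable :: "'v \<Rightarrow> bool" where
  "ordinal_definable A \<longleftrightarrow>
     (\<exists>\<kappa> \<phi> e. ordinal \<kappa> \<and>
        (\<forall>i \<in> free_vars \<phi> - {0}. ordinal (e i) \<and> e i \<in>\<^sub>M V_stage \<kappa>) \<and>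
        (\<forall>x. x \<in>\<^sub>M A \<longleftrightarrow>
           x \<in>\<^sub>M V_stage \<kappa> \<and> sat {y. y \<in>\<^sub>M V_stage \<kappa>} (\<in>\<^sub>M) (e(0 := x)) \<phi>))"

section \<open>Games\<close>

definition game :: "'v \<Rightarrow> 'v \<Rightarrow> 'v \<Rightarrow> bool" where
  "game \<theta> S A \<longleftrightarrow> ordinal \<theta> \<and> (\<exists>s. s \<in>\<^sub>M S) \<and> (\<forall>x. x \<in>\<^sub>M A \<longrightarrow> is_function x \<theta> S)"

text \<open>The function \<open>c\<close> labels the indices up to \<open>\<alpha>\<close> by the player to move, \<open>zero\<close> for the first and
  \<open>one\<close> for the second: the label is \<open>zero\<close> at \<open>0\<close> and at limits and alternates at successors, so
  that it is \<open>zero\<close> exactly at the indices \<open>\<lambda> + 2n\<close> with \<open>\<lambda>\<close> zero or a limit.\<close>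

definition first_moves_at :: "'v \<Rightarrow> bool" where
  "first_moves_at \<alpha> \<longleftrightarrow>
     (\<exists>c. is_function c (succ \<alpha>) (upair zero one) \<and>
        (\<forall>\<beta>. \<beta> \<in>\<^sub>M succ \<alpha> \<longrightarrow>
           (app c \<beta> = zero \<longleftrightarrow> (\<forall>\<gamma>. \<beta> = succ \<gamma> \<longrightarrow> app c \<gamma> = one))) \<and>
        app c \<alpha> = zero)"

fun moves_at :: "player \<Rightarrow> 'v \<Rightarrow> bool" where
  "moves_at First \<alpha> \<longleftrightarrow> first_moves_at \<alpha>"
| "moves_at Second \<alpha> \<longleftrightarrow> \<not> first_moves_at \<alpha>"

definition positions :: "player \<Rightarrow> 'v \<Rightarrow> 'v \<Rightarrow> 'v" where
  "positions P \<theta> S = the_set (\<lambda>p. \<exists>\<alpha>. \<alpha> \<in>\<^sub>M \<theta> \<and> moves_at P \<alpha> \<and> is_function p \<alpha> S)"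

definition strategy :: "player \<Rightarrow> 'v \<Rightarrow> 'v \<Rightarrow> 'v \<Rightarrow> bool" where
  "strategy P \<theta> S \<sigma> \<longleftrightarrow> is_function \<sigma> (positions P \<theta> S) S"

definition follows :: "player \<Rightarrow> 'v \<Rightarrow> 'v \<Rightarrow> 'v \<Rightarrow> bool" where
  "follows P \<theta> \<sigma> x \<longleftrightarrow>
     (\<forall>\<alpha>. \<alpha> \<in>\<^sub>M \<theta> \<longrightarrow> moves_at P \<alpha> \<longrightarrow> app x \<alpha> = app \<sigma> (restrict x \<alpha>))"

fun wins :: "player \<Rightarrow> 'v \<Rightarrow> 'v \<Rightarrow> bool" where
  "wins First A x \<longleftrightarrow> x \<in>\<^sub>M A"
| "wins Second A x \<longleftrightarrow> \<not> x \<in>\<^sub>M A"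

definition winning_strategy :: "player \<Rightarrow> 'v \<Rightarrow> 'v \<Rightarrow> 'v \<Rightarrow> 'v \<Rightarrow> bool" where
  "winning_strategy P \<theta> S A \<sigma> \<longleftrightarrow>
     strategy P \<theta> S \<sigma> \<and> (\<forall>x. is_function x \<theta> S \<longrightarrow> follows P \<theta> \<sigma> x \<longrightarrow> wins P A x)"

definition determined :: "'v \<Rightarrow> 'v \<Rightarrow> 'v \<Rightarrow> bool" where
  "determined \<theta> S A \<longleftrightarrow> (\<exists>P \<sigma>. winning_strategy P \<theta> S A \<sigma>)"

end

section \<open>Models of ZFC\<close>

locale zfc_model = membership mem
  for mem :: "'v \<Rightarrow> 'v \<Rightarrow> bool"  (infix "\<in>\<^sub>M" 50) +
  assumes extensionality: "\<forall>x y. (\<forall>z. z \<in>\<^sub>M x \<longleftrightarrow> z \<in>\<^sub>M y) \<longrightarrow> x = y"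
    and foundation: "\<forall>x. (\<exists>y. y \<in>\<^sub>M x) \<longrightarrow> (\<exists>y. y \<in>\<^sub>M x \<and> \<not> (\<exists>z. z \<in>\<^sub>M y \<and> z \<in>\<^sub>M x))"
    and pairing: "\<forall>x y. \<exists>z. \<forall>w. w \<in>\<^sub>M z \<longleftrightarrow> w = x \<or> w = y"
    and union: "\<forall>x. \<exists>u. \<forall>w. w \<in>\<^sub>M u \<longleftrightarrow> (\<exists>y. w \<in>\<^sub>M y \<and> y \<in>\<^sub>M x)"
    and power_set: "\<forall>x. \<exists>p. \<forall>w. w \<in>\<^sub>M p \<longleftrightarrow> w \<subseteq>\<^sub>M x"
    and infinity: "\<exists>x. (\<exists>y. y \<in>\<^sub>M x \<and> (\<forall>z. \<not> z \<in>\<^sub>M y)) \<and>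
      (\<forall>y. y \<in>\<^sub>M x \<longrightarrow> (\<exists>s. s \<in>\<^sub>M x \<and> (\<forall>z. z \<in>\<^sub>M s \<longleftrightarrow> z \<in>\<^sub>M y \<or> z = y)))"
    and separation: "\<forall>\<phi> e x. \<exists>y. \<forall>z. z \<in>\<^sub>M y \<longleftrightarrow> z \<in>\<^sub>M x \<and> sat UNIV (\<in>\<^sub>M) (e(0 := z)) \<phi>"
    and replacement: "\<forall>\<phi> e x.
      (\<forall>u v w. sat UNIV (\<in>\<^sub>M) (e(0 := u, 1 := v)) \<phi> \<longrightarrow>
               sat UNIV (\<in>\<^sub>M) (e(0 := u, 1 := w)) \<phi> \<longrightarrow> v = w) \<longrightarrow>
      (\<exists>y. \<forall>v. v \<in>\<^sub>M y \<longleftrightarrow> (\<exists>u. u \<in>\<^sub>M x \<and> sat UNIV (\<in>\<^sub>M) (e(0 := u, 1 := v)) \<phi>))"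
    and choice: "\<forall>x. (\<forall>y. y \<in>\<^sub>M x \<longrightarrow> (\<exists>z. z \<in>\<^sub>M y)) \<longrightarrow>
      (\<forall>y z. y \<in>\<^sub>M x \<longrightarrow> z \<in>\<^sub>M x \<longrightarrow> y \<noteq> z \<longrightarrow> \<not> (\<exists>w. w \<in>\<^sub>M y \<and> w \<in>\<^sub>M z)) \<longrightarrow>
      (\<exists>c. \<forall>y. y \<in>\<^sub>M x \<longrightarrow> (\<exists>!z. z \<in>\<^sub>M y \<and> z \<in>\<^sub>M c))"

end

theory Submission
  imports Defs
begin

text \<open>The first player opens with a set \<open>X \<subseteq> \<omega>\<^sub>1\<close>, and loses at once unless \<open>X\<close> and its
  complement are stationary. From then on every move codes a countable ordinal, and the first player
  wins if the supremum of the ordinals played lies in \<open>X\<close>. For a strategy of either player the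
  ordinals closed under it contain a club, and the opponent can force the supremum to be any member of
  that club by playing ordinals cofinal in it. The club meets both \<open>X\<close> and its complement, so no
  strategy is winning; a suitable \<open>X\<close> is provided by Ulam's matrix. The payoff set is defined in a
  stage of the von Neumann hierarchy slightly above \<open>\<omega>\<^sub>1\<close> with parameters \<open>0\<close>, \<open>1\<close>, \<open>\<omega>\<close>
  and \<open>\<omega>\<^sub>1\<close>.\<close>

section \<open>Definability with parameters\<close>

text \<open>Choice yields a bistationary set but no definition of one, so the payoff cannot refer to
  a fixed set; making the set the opening move removes the parameter. This is why moves are
  sequences of length \<open>omega1\<close>: one move set serves to name subsets of
  \<open>omega1\<close> and to code countable ordinals. A strategy acts on positions, not on
  ordinals, and there are uncountably many positions. The way out is to let the opponent play only
  codes of single ordinals: once these are at most \<alpha>, only countably many positions arise,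
  and the replies to them have a bound \<open>f \<alpha>\<close> below \<open>omega1\<close>. The
  formal obstacle is that the model may be ill-founded: induction, recursion and set formation are
  available only for predicates given by a formula with parameters from the model. Hence the
  predicates used there come with a proof of \<open>definable\<close>. The same notion, with
  quantifiers relativised to a stage and parameters restricted to ordinals, gives ordinal
  definability at the end.\<close>

primrec rename :: "(nat \<Rightarrow> nat) \<Rightarrow> fm \<Rightarrow> fm" where
  "rename r (Mem i j) = Mem (r i) (r j)"
| "rename r (Eq i j) = Eq (r i) (r j)"
| "rename r (Neg \<phi>) = Neg (rename r \<phi>)"
| "rename r (Conj \<phi> \<psi>) = Conj (rename r \<phi>) (rename r \<psi>)"
| "rename r (Forall i \<phi>) = Forall (r i) (rename r \<phi>)"

text \<open>\<open>rename\<close> moves bound variables too, so a free variable could be captured if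
  \<open>r\<close> were not injective; injectivity makes updating commute with renaming.\<close>

lemma sat_rename:
  assumes "inj r"
  shows "sat D E e (rename r \<phi>) \<longleftrightarrow> sat D E (e \<circ> r) \<phi>"
proof (induction \<phi> arbitrary: e)
  case (Forall i \<phi>)
  have "e(r i := a) \<circ> r = (e \<circ> r)(i := a)" for a
    using assms by (auto simp: fun_eq_iff inj_eq)
  then show ?case unfolding rename.simps sat.simps Forall.IH by simp
qed auto

text \<open>Parameters are kept apart from variables because in the end they have to be ordinals of
  a stage, while the variables range over the whole stage.\<close>

definition interleave :: "(nat \<Rightarrow> 'v) \<Rightarrow> (nat \<Rightarrow> 'v) \<Rightarrow> nat \<Rightarrow> 'v" where
  "interleave e p i = (if even i then e (i div 2) else p (i div 2))"

lemma range_interleave: "range p \<subseteq> Q \<Longrightarrow> range q \<subseteq> Q \<Longrightarrow> range (interleave p q) \<subseteq> Q"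
  by (auto simp: interleave_def)

context membership
begin

text \<open>Streams \<open>e\<close> are de Bruijn environments: a quantifier binds \<open>e 0\<close> and shifts the remaining variables.
  The formula refers to them by even indices and to the parameters \<open>p\<close> by odd ones.\<close>

definition definable :: "'v set \<Rightarrow> 'v set \<Rightarrow> ((nat \<Rightarrow> 'v) \<Rightarrow> bool) \<Rightarrow> bool" where
  "definable D Q P \<longleftrightarrow> (\<exists>\<phi> p. range p \<subseteq> Q \<and>
     (\<forall>e. range e \<subseteq> D \<longrightarrow> (P e \<longleftrightarrow> sat D (\<in>\<^sub>M) (interleave e p) \<phi>)))"

lemma definableI:
  assumes "range p \<subseteq> Q" "\<And>e. range e \<subseteq> D \<Longrightarrow> P e \<longleftrightarrow> sat D (\<in>\<^sub>M) (interleave e p) \<phi>"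
  shows "definable D Q P"
  using assms unfolding definable_def by blast

lemma definable_neg: "definable D Q P \<Longrightarrow> definable D Q (\<lambda>e. \<not> P e)"
  unfolding definable_def by (metis sat.simps(3))

text \<open>The two formulas have separate parameter streams, which are merged: parameter
  \<open>k\<close> of the first becomes number \<open>2 * k\<close> and that of the second number
  \<open>2 * k + 1\<close>. So index \<open>2 * k + 1\<close> moves to \<open>4 * k + 1\<close>
  under \<open>r\<close> and to \<open>4 * k + 3\<close> under \<open>s\<close>.\<close>

lemma definable_conj:
  assumes "definable D Q P" "definable D Q R"
  shows "definable D Q (\<lambda>e. P e \<and> R e)"
proof -
  obtain \<phi> p where p: "range p \<subseteq> Q" "\<And>e. range e \<subseteq> D \<Longrightarrow> P e \<longleftrightarrow> sat D (\<in>\<^sub>M) (interleave e p) \<phi>"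
    using assms(1) unfolding definable_def by blast
  obtain \<psi> q where q: "range q \<subseteq> Q" "\<And>e. range e \<subseteq> D \<Longrightarrow> R e \<longleftrightarrow> sat D (\<in>\<^sub>M) (interleave e q) \<psi>"
    using assms(2) unfolding definable_def by blast
  define r where "r i = (if even i then i else 2 * i - 1)" for i :: nat
  define s where "s i = (if even i then i else 2 * i + 1)" for i :: nat
  have "inj r"
    by (rule inj_on_inverseI[where g = "\<lambda>j. if even j then j else (j + 1) div 2"]) (auto simp: r_def)
  moreover have "inj s"
    by (rule inj_on_inverseI[where g = "\<lambda>j. if even j then j else (j - 1) div 2"]) (auto simp: s_def)
  moreover have "interleave e (interleave p q) \<circ> r = interleave e p" for e
  proof
    fix i :: nat
    consider k where "i = 2 * k" | k where "i = 2 * k + 1"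
      by (metis evenE oddE)
    then show "(interleave e (interleave p q) \<circ> r) i = interleave e p i"
    proof cases
      case 2
      then have "r i = 2 * (2 * k) + 1" by (simp add: r_def)
      moreover have "(2 * (2 * k) + 1) div 2 = 2 * k" by simp
      ultimately show ?thesis using 2 by (simp add: interleave_def)
    qed (simp add: interleave_def r_def)
  qed
  moreover have "interleave e (interleave p q) \<circ> s = interleave e q" for e
  proof
    fix i :: nat
    consider k where "i = 2 * k" | k where "i = 2 * k + 1"
      by (metis evenE oddE)
    then show "(interleave e (interleave p q) \<circ> s) i = interleave e q i"
    proof cases
      case 2
      then have "s i = 2 * (2 * k + 1) + 1" by (simp add: s_def)
      moreover have "(2 * (2 * k + 1) + 1) div 2 = 2 * k + 1" by simp
      ultimately show ?thesis using 2 by (simp add: interleave_def)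
    qed (simp add: interleave_def s_def)
  qed
  ultimately show ?thesis
    by (intro definableI[where p = "interleave p q" and \<phi> = "Conj (rename r \<phi>) (rename s \<psi>)"]
        range_interleave p(1) q(1)) (simp add: sat_rename p(2) q(2))
qed

text \<open>The bound variable needs an index of its own in the combined stream. Moving every
  parameter up by one slot frees index \<open>1\<close>; index \<open>0\<close> is sent there and
  the other variables shift down. The freed slot is filled with the dummy \<open>p 0\<close>, which
  the quantifier overrides.\<close>

lemma definable_ex:
  assumes "definable D Q (\<lambda>e. P (e 0) (\<lambda>i. e (Suc i)))"
  shows "definable D Q (\<lambda>e. \<exists>x\<in>D. P x e)"
proof -
  obtain \<phi> p where p: "range p \<subseteq> Q"
      "\<And>e. range e \<subseteq> D \<Longrightarrow> P (e 0) (\<lambda>i. e (Suc i)) \<longleftrightarrow> sat D (\<in>\<^sub>M) (interleave e p) \<phi>"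
    using assms unfolding definable_def by blast
  define r where "r i = (if i = 0 then 1 else if even i then i - 2 else i + 2)" for i :: nat
  define q where "q = case_nat (p 0) p"
  have q: "range q \<subseteq> Q" using p(1) by (auto simp: q_def split: nat.splits)
  have r: "inj r"
    by (rule inj_on_inverseI[where g = "\<lambda>j. if j = 1 then 0 else if even j then j + 2 else j - 2"])
       (auto simp: r_def elim!: evenE oddE, presburger?)
  have env: "(interleave e q)(1 := x) \<circ> r = interleave (case_nat x e) p" for e x
  proof
    fix i :: nat
    consider "i = 0" | k where "i = 2 * Suc k" | k where "i = 2 * k + 1"
      by (metis evenE oddE not0_implies_Suc mult_0_right)
    then show "((interleave e q)(1 := x) \<circ> r) i = interleave (case_nat x e) p i"
      by cases (auto simp: interleave_def r_def q_def)
  qed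
  have "(\<exists>x\<in>D. P x e) \<longleftrightarrow> sat D (\<in>\<^sub>M) (interleave e q) (Neg (Forall 1 (Neg (rename r \<phi>))))"
    if e: "range e \<subseteq> D" for e
  proof -
    have "P x e \<longleftrightarrow> sat D (\<in>\<^sub>M) (interleave (case_nat x e) p) \<phi>" if "x \<in> D" for x
    proof -
      have "range (case_nat x e) \<subseteq> D" using e that by (auto split: nat.splits simp: image_subset_iff)
      from p(2)[OF this] show ?thesis by simp
    qed
    then show ?thesis by (simp add: sat_rename[OF r] env[simplified])
  qed
  then show ?thesis by (rule definableI[OF q])
qed

lemma definable_rename:
  assumes "definable D Q P" "inj f"
  shows "definable D Q (\<lambda>e. P (\<lambda>i. e (f i)))"
proof -
  obtain \<phi> p where p: "range p \<subseteq> Q" "\<And>e. range e \<subseteq> D \<Longrightarrow> P e \<longleftrightarrow> sat D (\<in>\<^sub>M) (interleave e p) \<phi>"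
    using assms(1) unfolding definable_def by blast
  define r where "r i = (if even i then 2 * f (i div 2) else i)" for i :: nat
  have "inj r"
    by (rule inj_on_inverseI[where g = "\<lambda>j. if even j then 2 * inv f (j div 2) else j"])
       (auto simp: r_def assms(2))
  moreover have "interleave e p \<circ> r = interleave (\<lambda>i. e (f i)) p" for e
    by (auto simp: interleave_def r_def fun_eq_iff)
  moreover have "range (\<lambda>i. e (f i)) \<subseteq> D" if "range e \<subseteq> D" for e
    using that by auto
  ultimately show ?thesis
    by (intro definableI[where p = p and \<phi> = "rename r \<phi>"] p(1)) (simp add: sat_rename p(2))
qed

text \<open>Variables from \<open>k\<close> on become parameters. Every index \<open>i\<close> that
  is not kept goes to \<open>2 * i + 1\<close>, which is parameter slot \<open>i\<close>, and
  \<open>interleave a p\<close> has in that slot just what the old stream had at index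
  \<open>i\<close>.\<close>

lemma definable_fix:
  assumes "definable D Q P" "range a \<subseteq> Q" "Q \<subseteq> D"
  shows "definable D Q (\<lambda>e. P (\<lambda>i. if i < k then e i else a i))"
proof -
  obtain \<phi> p where p: "range p \<subseteq> Q" "\<And>e. range e \<subseteq> D \<Longrightarrow> P e \<longleftrightarrow> sat D (\<in>\<^sub>M) (interleave e p) \<phi>"
    using assms unfolding definable_def by blast
  define r where "r i = (if even i \<and> i div 2 < k then i else 2 * i + 1)" for i :: nat
  have r: "inj r"
    by (rule inj_on_inverseI[where g = "\<lambda>j. if even j then j else (j - 1) div 2"]) (auto simp: r_def)
  have env: "interleave e (interleave a p) \<circ> r = interleave (\<lambda>i. if i < k then e i else a i) p" for e
    by (auto simp: interleave_def r_def fun_eq_iff)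
  have "P (\<lambda>i. if i < k then e i else a i) \<longleftrightarrow>
      sat D (\<in>\<^sub>M) (interleave (\<lambda>i. if i < k then e i else a i) p) \<phi>" if "range e \<subseteq> D" for e
    by (rule p(2)) (use that assms(2,3) in \<open>auto simp: image_subset_iff\<close>)
  then show ?thesis
    by (intro definableI[where p = "interleave a p" and \<phi> = "rename r \<phi>"] range_interleave assms p(1))
       (simp add: sat_rename[OF r] env)
qed

text \<open>Over an arbitrary domain only variables and parameters can serve as terms, since an
  operation such as pairing may lead out of it. Compound terms are treated over the whole model, as
  \<open>def_term\<close>.\<close>

definition atomic_term :: "'v set \<Rightarrow> ((nat \<Rightarrow> 'v) \<Rightarrow> 'v) \<Rightarrow> bool" where
  "atomic_term Q t \<longleftrightarrow> (\<exists>i. t = (\<lambda>e. e i)) \<or> (\<exists>c\<in>Q. t = (\<lambda>e. c))"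

lemma atomic_term_var: "atomic_term Q (\<lambda>e. e i)"
  and atomic_term_const: "c \<in> Q \<Longrightarrow> atomic_term Q (\<lambda>e. c)"
  unfolding atomic_term_def by (auto simp: fun_eq_iff)

text \<open>The slot \<open>k\<close> reserved for a constant is left open so that the two sides of
  an atomic formula can use different slots.\<close>

lemma atomic_term_index:
  assumes "atomic_term Q t" "p k \<in> Q"
  shows "\<exists>i c. c \<in> Q \<and> (\<forall>e. t e = interleave e (p(k := c)) i) \<and> (even i \<or> i = 2 * k + 1)"
  using assms(1) unfolding atomic_term_def
proof (elim disjE exE bexE)
  fix i assume "t = (\<lambda>e. e i)"
  then show ?thesis
    using assms(2) by (intro exI[of _ "2 * i"] exI[of _ "p k"]) (simp add: interleave_def)
next
  fix c assume "c \<in> Q" "t = (\<lambda>e. c)"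
  then show ?thesis
    by (intro exI[of _ "2 * k + 1"] exI[of _ c]) (simp add: interleave_def)
qed

lemma
  assumes "atomic_term Q s" "atomic_term Q t" "Q \<noteq> {}"
  shows definable_mem: "definable D Q (\<lambda>e. s e \<in>\<^sub>M t e)"
    and definable_eq: "definable D Q (\<lambda>e. s e = t e)"
proof -
  obtain q where q: "q \<in> Q" using assms(3) by blast
  obtain i c where c: "c \<in> Q" "\<And>e. s e = interleave e ((\<lambda>_. q)(0 := c)) i" "even i \<or> i = 2 * 0 + 1"
    using atomic_term_index[OF assms(1), of "\<lambda>_. q" 0] q by blast
  obtain j d where d: "d \<in> Q" "\<And>e. t e = interleave e ((\<lambda>_. q)(1 := d)) j" "even j \<or> j = 2 * 1 + 1"
    using atomic_term_index[OF assms(2), of "\<lambda>_. q" 1] q by blast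
  let ?p = "(\<lambda>_. q)(0 := c, 1 := d)"
  have p: "range ?p \<subseteq> Q" using q c(1) d(1) by auto
  have "s e = interleave e ?p i" "t e = interleave e ?p j" for e
    using c(2)[of e] d(2)[of e] c(3) d(3) by (auto simp: interleave_def)
  then show "definable D Q (\<lambda>e. s e \<in>\<^sub>M t e)" "definable D Q (\<lambda>e. s e = t e)"
    by (auto intro: definableI[OF p, where \<phi> = "Mem i j"] definableI[OF p, where \<phi> = "Eq i j"])
qed

lemma definable_disj:
  "definable D Q P \<Longrightarrow> definable D Q R \<Longrightarrow> definable D Q (\<lambda>e. P e \<or> R e)"
  using definable_neg[OF definable_conj[OF definable_neg definable_neg], of D Q P R] by simp

lemma definable_imp:
  "definable D Q P \<Longrightarrow> definable D Q R \<Longrightarrow> definable D Q (\<lambda>e. P e \<longrightarrow> R e)"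
  using definable_neg[OF definable_conj[OF _ definable_neg], of D Q P R] by simp

lemma definable_iff:
  assumes "definable D Q P" "definable D Q R"
  shows "definable D Q (\<lambda>e. P e \<longleftrightarrow> R e)"
  unfolding iff_conv_conj_imp by (intro definable_conj definable_imp assms)

lemma definable_all:
  assumes "definable D Q (\<lambda>e. P (e 0) (\<lambda>i. e (Suc i)))"
  shows "definable D Q (\<lambda>e. \<forall>x\<in>D. P x e)"
  using definable_neg[OF definable_ex[where P = "\<lambda>x e. \<not> P x e", OF definable_neg[OF assms]]]
  by simp

end

section \<open>Definable classes and basic set operations\<close>

text \<open>With these rules \<open>intro definability\<close> follows the syntax of a HOL predicate
  and proves that it is first-order. Functions and relations obtained inside a proof are added to
  the collection locally.\<close>

named_theorems definability

context membership
begin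

abbreviation def_pred :: "((nat \<Rightarrow> 'v) \<Rightarrow> bool) \<Rightarrow> bool" where
  "def_pred \<equiv> definable UNIV UNIV"

definition def_term :: "((nat \<Rightarrow> 'v) \<Rightarrow> 'v) \<Rightarrow> bool" where
  "def_term t \<longleftrightarrow> def_pred (\<lambda>e. e 0 = t (\<lambda>i. e (Suc i)))"

lemma def_pred_ex [definability]:
  "def_pred (\<lambda>e. P (e 0) (\<lambda>i. e (Suc i))) \<Longrightarrow> def_pred (\<lambda>e. \<exists>x. P x e)"
  using definable_ex[where D = UNIV and Q = UNIV and P = P] by simp

lemma def_pred_all [definability]:
  "def_pred (\<lambda>e. P (e 0) (\<lambda>i. e (Suc i))) \<Longrightarrow> def_pred (\<lambda>e. \<forall>x. P x e)"
  using definable_all[where D = UNIV and Q = UNIV and P = P] by simp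

lemmas [definability] = definable_neg definable_conj definable_disj definable_imp definable_iff

lemma def_pred_const [definability]: "def_pred (\<lambda>e. b)"
proof -
  have "def_pred (\<lambda>e. e 0 = e 0)"
    by (intro definable_eq atomic_term_var) simp
  from this definable_neg[OF this] show ?thesis by (cases b) simp_all
qed

text \<open>Set existence below a binder is a claim about one fixed environment \<open>a\<close>;
  this turns the outer variables into parameters for that purpose.\<close>

lemma def_pred_fix: "def_pred (\<lambda>e. P (e 0) (\<lambda>i. e (Suc i))) \<Longrightarrow> def_pred (\<lambda>e. P (e 0) a)"
  using definable_fix[of UNIV UNIV "\<lambda>e. P (e 0) (\<lambda>i. e (Suc i))" "case_nat undefined a" 1] by simp

lemma def_pred_fix2:
  "def_pred (\<lambda>e. P (e 0) (e (Suc 0)) (\<lambda>i. e (Suc (Suc i)))) \<Longrightarrow> def_pred (\<lambda>e. P (e 0) (e (Suc 0)) a)"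
  using definable_fix[of UNIV UNIV "\<lambda>e. P (e 0) (e (Suc 0)) (\<lambda>i. e (Suc (Suc i)))" "\<lambda>i. a (i - 2)" 2] by simp

lemma def_pred_swap:
  assumes "def_pred (\<lambda>e. P (e 0) (e (Suc 0)) (\<lambda>i. e (Suc (Suc i))))"
  shows "def_pred (\<lambda>e. P (e (Suc 0)) (e 0) (\<lambda>i. e (Suc (Suc i))))"
  using definable_rename[OF assms, of "\<lambda>i. if i = 0 then 1 else if i = 1 then 0 else i"]
  by (simp add: inj_def)

lemma def_pred_lift:
  assumes "def_pred (\<lambda>e. P (e 0) (\<lambda>i. e (Suc i)))"
  shows "def_pred (\<lambda>e. P (e 0) (\<lambda>i. e (Suc (Suc i))))"
  using definable_rename[OF assms, of "\<lambda>i. if i = 0 then 0 else Suc i"] by (simp add: inj_def)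

lemma def_term_lift:
  assumes "def_term (\<lambda>e. F (e 0) (\<lambda>i. e (Suc i)))"
  shows "def_term (\<lambda>e. F (e 0) (\<lambda>i. e (Suc (Suc i))))"
  using definable_rename[OF assms[unfolded def_term_def], of "\<lambda>i. if i < 2 then i else Suc i"]
  by (simp add: def_term_def inj_def)

lemma def_term_fix: "def_term (\<lambda>e. F (e 0) (\<lambda>i. e (Suc i))) \<Longrightarrow> def_term (\<lambda>e. F (e 0) a)"
  unfolding def_term_def by (rule def_pred_fix2)

lemma def_term_shift: "def_term t \<Longrightarrow> def_term (\<lambda>e. t (\<lambda>i. e (Suc i)))"
  unfolding def_term_def by (rule def_pred_lift)

lemma def_term_var [definability]: "def_term (\<lambda>e. e i)"
  and def_term_const [definability]: "def_term (\<lambda>e. c)"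
  unfolding def_term_def by (intro definable_eq atomic_term_var atomic_term_const UNIV_I; simp)+

text \<open>Formulas have no function symbols, so a term is substituted by quantifying over a value
  that satisfies its graph.\<close>

lemma def_pred_subst:
  assumes "def_term s" "def_pred (\<lambda>e. P (e 0) (\<lambda>i. e (Suc i)))"
  shows "def_pred (\<lambda>e. P (s e) e)"
proof -
  have "def_pred (\<lambda>e. \<exists>x. x = s e \<and> P x e)"
    by (intro definability assms assms(1)[unfolded def_term_def])
  then show ?thesis by simp
qed

lemma def_pred_subst2:
  assumes "def_term s" "def_term t" "def_pred (\<lambda>e. R (e 0) (e (Suc 0)))"
  shows "def_pred (\<lambda>e. R (s e) (t e))"
proof (rule def_pred_subst[OF assms(1), where P = "\<lambda>x e. R x (t e)"])
  show "def_pred (\<lambda>e. R (e 0) (t (\<lambda>i. e (Suc i))))"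
    by (rule def_pred_subst[OF def_term_shift[OF assms(2)], where P = "\<lambda>y e. R (e 0) y"])
       (rule def_pred_swap[OF assms(3)])
qed

lemma def_pred_mem [definability]: "def_term s \<Longrightarrow> def_term t \<Longrightarrow> def_pred (\<lambda>e. s e \<in>\<^sub>M t e)"
  by (rule def_pred_subst2[where R = "(\<in>\<^sub>M)"]) (auto intro: definable_mem atomic_term_var)

lemma def_pred_eq [definability]: "def_term s \<Longrightarrow> def_term t \<Longrightarrow> def_pred (\<lambda>e. s e = t e)"
  by (rule def_pred_subst2[where R = "(=)"]) (auto intro: definable_eq atomic_term_var)

lemma def_pred_subst1: "def_pred (\<lambda>e. R (e 0)) \<Longrightarrow> def_term s \<Longrightarrow> def_pred (\<lambda>e. R (s e))"
  by (rule def_pred_subst[where P = "\<lambda>x e. R x"])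

lemma def_pred_subst3:
  assumes "def_pred (\<lambda>e. R (e 0) (e (Suc 0)) (e (Suc (Suc 0))))" "def_term s" "def_term t" "def_term u"
  shows "def_pred (\<lambda>e. R (s e) (t e) (u e))"
proof -
  note shift = def_term_shift
  have "def_pred (\<lambda>e. R (e (Suc (Suc 0))) (e (Suc 0)) (e 0))"
    using definable_rename[OF assms(1), of "\<lambda>i. if i = 0 then 2 else if i = 2 then 0 else i"]
    by (simp add: inj_def numeral_2_eq_2)
  then have "def_pred (\<lambda>e. \<exists>x. x = s e \<and> (\<exists>y. y = t e \<and> (\<exists>z. z = u e \<and> R x y z)))"
    by (intro definability assms(2)[THEN shift] assms(3)[THEN shift, THEN shift]
        assms(4)[THEN shift, THEN shift, THEN shift])
  then show ?thesis by simp
qed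

lemma def_term_graph:
  assumes "\<And>e x. x = t e \<longleftrightarrow> P x e" "def_pred (\<lambda>e. P (e 0) (\<lambda>i. e (Suc i)))"
  shows "def_term t"
  unfolding def_term_def assms(1) by (rule assms(2))

lemma def_term_subst1:
  assumes "def_term (\<lambda>e. F (e 0))" "def_term s"
  shows "def_term (\<lambda>e. F (s e))"
  unfolding def_term_def
  by (rule def_pred_subst2[where R = "\<lambda>x y. x = F y"])
     (rule def_term_var def_term_shift assms(2) assms(1)[unfolded def_term_def])+

lemma def_term_subst2:
  assumes "def_term (\<lambda>e. F (e 0) (e (Suc 0)))" "def_term s" "def_term t"
  shows "def_term (\<lambda>e. F (s e) (t e))"
  unfolding def_term_def
  by (rule def_pred_subst3[where R = "\<lambda>x y z. x = F y z"])
     (rule def_term_var def_term_shift assms(2,3) assms(1)[unfolded def_term_def])+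

lemma def_term_if [definability]:
  assumes "def_pred P" "def_term s" "def_term t"
  shows "def_term (\<lambda>e. if P e then s e else t e)"
proof (rule def_term_graph)
  show "x = (if P e then s e else t e) \<longleftrightarrow> (P e \<longrightarrow> x = s e) \<and> (\<not> P e \<longrightarrow> x = t e)" for e x
    by simp
  show "def_pred (\<lambda>e. (P (\<lambda>i. e (Suc i)) \<longrightarrow> e 0 = s (\<lambda>i. e (Suc i))) \<and>
      (\<not> P (\<lambda>i. e (Suc i)) \<longrightarrow> e 0 = t (\<lambda>i. e (Suc i))))"
    by (intro definability def_term_shift assms definable_rename[where f = Suc]) simp_all
qed

section \<open>Set operations of the model as definable terms\<close>

definition is_set :: "('v \<Rightarrow> bool) \<Rightarrow> bool" where
  "is_set P \<longleftrightarrow> (\<exists>x. \<forall>y. y \<in>\<^sub>M x \<longleftrightarrow> P y)"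

definition Union_M :: "'v \<Rightarrow> 'v" where
  "Union_M x = the_set (\<lambda>y. \<exists>z. z \<in>\<^sub>M x \<and> y \<in>\<^sub>M z)"

definition Pow_M :: "'v \<Rightarrow> 'v" where
  "Pow_M x = the_set (\<lambda>y. y \<subseteq>\<^sub>M x)"

text \<open>As the union of the values at \<open>x\<close>, this agrees with \<open>app\<close> on
  the domain of a function and is \<open>zero\<close> elsewhere. The description in
  \<open>app\<close> has no determined value outside the domain and so no definable graph
  there.\<close>

definition apply_M :: "'v \<Rightarrow> 'v \<Rightarrow> 'v" where
  "apply_M f x = the_set (\<lambda>z. \<exists>y. opair x y \<in>\<^sub>M f \<and> z \<in>\<^sub>M y)"

definition Lam :: "'v \<Rightarrow> ('v \<Rightarrow> 'v) \<Rightarrow> 'v" where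
  "Lam X F = the_set (\<lambda>p. \<exists>x. x \<in>\<^sub>M X \<and> p = opair x (F x))"

definition image_M :: "('v \<Rightarrow> 'v) \<Rightarrow> 'v \<Rightarrow> 'v" where
  "image_M F X = the_set (\<lambda>y. \<exists>x. x \<in>\<^sub>M X \<and> y = F x)"

lemma def_pred_subset [definability]:
  assumes "def_term s" "def_term t"
  shows "def_pred (\<lambda>e. s e \<subseteq>\<^sub>M t e)"
  unfolding subset_M_def by (intro definability assms def_term_shift)

lemma subset_refl [simp]: "x \<subseteq>\<^sub>M x"
  and subset_trans: "x \<subseteq>\<^sub>M y \<Longrightarrow> y \<subseteq>\<^sub>M z \<Longrightarrow> x \<subseteq>\<^sub>M z"
  and subsetD: "x \<subseteq>\<^sub>M y \<Longrightarrow> z \<in>\<^sub>M x \<Longrightarrow> z \<in>\<^sub>M y"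
  by (auto simp: subset_M_def)

end

context zfc_model
begin

lemma set_ext: "(\<And>z. z \<in>\<^sub>M x \<longleftrightarrow> z \<in>\<^sub>M y) \<Longrightarrow> x = y"
  using extensionality by blast

lemma subset_antisym: "x \<subseteq>\<^sub>M y \<Longrightarrow> y \<subseteq>\<^sub>M x \<Longrightarrow> x = y"
  by (rule set_ext) (auto simp: subset_M_def)

lemma the_set_eq:
  assumes "\<And>y. y \<in>\<^sub>M x \<longleftrightarrow> P y"
  shows "the_set P = x"
  unfolding the_set_def by (rule the_equality) (use assms set_ext in auto)

lemma mem_the_set: "is_set P \<Longrightarrow> y \<in>\<^sub>M the_set P \<longleftrightarrow> P y"
  unfolding is_set_def using the_set_eq by metis

text \<open>By Extensionality the graph is "\<open>x\<close> has exactly these elements", provided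
  that the set exists in every environment.\<close>

lemma def_term_the_set:
  assumes "\<And>e. is_set (\<lambda>y. P y e)" "def_pred (\<lambda>e. P (e 0) (\<lambda>i. e (Suc i)))"
  shows "def_term (\<lambda>e. the_set (\<lambda>y. P y e))"
proof (rule def_term_graph)
  show "x = the_set (\<lambda>y. P y e) \<longleftrightarrow> (\<forall>y. y \<in>\<^sub>M x \<longleftrightarrow> P y e)" for x e
    using mem_the_set[OF assms(1)] the_set_eq by metis
  show "def_pred (\<lambda>e. \<forall>y. y \<in>\<^sub>M e 0 \<longleftrightarrow> P y (\<lambda>i. e (Suc i)))"
    by (intro definability def_pred_lift[OF assms(2)])
qed

lemma is_set_sep:
  assumes "def_pred (\<lambda>e. P (e 0))"
  shows "is_set (\<lambda>y. y \<in>\<^sub>M A \<and> P y)"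
proof -
  obtain \<phi> p where p: "\<And>e. P (e 0) \<longleftrightarrow> sat UNIV (\<in>\<^sub>M) (interleave e p) \<phi>"
    using assms unfolding definable_def by auto
  obtain x where "\<And>z. z \<in>\<^sub>M x \<longleftrightarrow> z \<in>\<^sub>M A \<and> sat UNIV (\<in>\<^sub>M) ((interleave (\<lambda>_. A) p)(0 := z)) \<phi>"
    using separation by blast
  moreover have "(interleave (\<lambda>_. A) p)(0 := z) = interleave ((\<lambda>_. A)(0 := z)) p" for z
    by (auto simp: interleave_def fun_eq_iff)
  moreover have "P z \<longleftrightarrow> sat UNIV (\<in>\<^sub>M) (interleave ((\<lambda>_. A)(0 := z)) p) \<phi>" for z
    using p[of "(\<lambda>_. A)(0 := z)"] by simp
  ultimately show ?thesis unfolding is_set_def by auto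
qed

lemma is_set_subset:
  assumes "def_pred (\<lambda>e. P (e 0))" "\<And>y. P y \<Longrightarrow> y \<in>\<^sub>M A"
  shows "is_set P"
proof -
  have "P = (\<lambda>y. y \<in>\<^sub>M A \<and> P y)" using assms(2) by blast
  with is_set_sep[OF assms(1), of A] show ?thesis by simp
qed

lemma is_set_replace:
  assumes "def_pred (\<lambda>e. R (e 0) (e (Suc 0)))" "\<And>x y z. R x y \<Longrightarrow> R x z \<Longrightarrow> y = z"
  shows "is_set (\<lambda>y. \<exists>x. x \<in>\<^sub>M A \<and> R x y)"
proof -
  obtain \<phi> p where p: "\<And>e. R (e 0) (e (Suc 0)) \<longleftrightarrow> sat UNIV (\<in>\<^sub>M) (interleave e p) \<phi>"
    using assms unfolding definable_def by auto
  \<comment> \<open>The second argument has index \<open>2\<close> in the interleaved stream,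
    whereas Replacement expects it at index \<open>1\<close>.\<close>
  define r where "r i = (if i = 1 then 2 else if i = 2 then 1 else i)" for i :: nat
  have r: "inj r" by (auto simp: r_def inj_def)
  define d where "d = interleave (\<lambda>_. A) p \<circ> r"
  have "d(0 := u, 1 := v) \<circ> r = interleave ((\<lambda>_. A)(0 := u, Suc 0 := v)) p" for u v
    by (auto simp: d_def interleave_def r_def fun_eq_iff)
  then have R: "sat UNIV (\<in>\<^sub>M) (d(0 := u, 1 := v)) (rename r \<phi>) \<longleftrightarrow> R u v" for u v
    using p[of "(\<lambda>_. A)(0 := u, Suc 0 := v)"] by (simp add: sat_rename[OF r])
  show ?thesis
    using replacement[rule_format, of d "rename r \<phi>" A] assms(2) unfolding R is_set_def by blast
qed

lemma is_set_image:
  assumes "def_term (\<lambda>e. F (e 0))"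
  shows "is_set (\<lambda>y. \<exists>x. x \<in>\<^sub>M A \<and> y = F x)"
  by (rule is_set_replace[where R = "\<lambda>x y. y = F x"])
     (auto intro: def_pred_swap[where P = "\<lambda>x y e. x = F y"] assms[unfolded def_term_def])

lemma mem_image: "def_term (\<lambda>e. F (e 0)) \<Longrightarrow> y \<in>\<^sub>M image_M F X \<longleftrightarrow> (\<exists>x. x \<in>\<^sub>M X \<and> y = F x)"
  unfolding image_M_def by (rule mem_the_set[OF is_set_image])

lemma is_set_upair: "is_set (\<lambda>z. z = x \<or> z = y)"
  using pairing by (simp add: is_set_def)

lemma is_set_Union: "is_set (\<lambda>y. \<exists>z. z \<in>\<^sub>M x \<and> y \<in>\<^sub>M z)"
  using union by (simp add: is_set_def conj_commute)

lemma is_set_Pow: "is_set (\<lambda>y. y \<subseteq>\<^sub>M x)"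
  using power_set by (simp add: is_set_def)

lemma mem_upair [simp]: "z \<in>\<^sub>M upair x y \<longleftrightarrow> z = x \<or> z = y"
  unfolding upair_def by (rule mem_the_set[OF is_set_upair])

lemma mem_Union: "y \<in>\<^sub>M Union_M x \<longleftrightarrow> (\<exists>z. z \<in>\<^sub>M x \<and> y \<in>\<^sub>M z)"
  unfolding Union_M_def by (rule mem_the_set[OF is_set_Union])

lemma mem_Pow [simp]: "y \<in>\<^sub>M Pow_M x \<longleftrightarrow> y \<subseteq>\<^sub>M x"
  unfolding Pow_M_def by (rule mem_the_set[OF is_set_Pow])

lemma mem_zero [simp]: "\<not> y \<in>\<^sub>M zero"
proof -
  have "is_set (\<lambda>y. y \<in>\<^sub>M undefined \<and> False)"
    by (rule is_set_sep) (rule def_pred_const)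
  then show ?thesis unfolding zero_def using mem_the_set by simp
qed

lemma is_set_succ: "is_set (\<lambda>y. y \<in>\<^sub>M x \<or> y = x)"
  unfolding is_set_def
  by (rule exI[of _ "Union_M (upair x (upair x x))"]) (auto simp: mem_Union)

lemma mem_succ [simp]: "y \<in>\<^sub>M succ x \<longleftrightarrow> y \<in>\<^sub>M x \<or> y = x"
  unfolding succ_def by (rule mem_the_set[OF is_set_succ])

lemma def_term_succ [definability]: "def_term s \<Longrightarrow> def_term (\<lambda>e. succ (s e))"
proof (rule def_term_subst1[of succ])
  show "def_term (\<lambda>e. succ (e 0))"
    unfolding succ_def by (intro def_term_the_set is_set_succ definability)
qed

lemma def_term_Union [definability]: "def_term s \<Longrightarrow> def_term (\<lambda>e. Union_M (s e))"
proof (rule def_term_subst1[of Union_M])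
  show "def_term (\<lambda>e. Union_M (e 0))"
    unfolding Union_M_def by (intro def_term_the_set is_set_Union definability)
qed

lemma def_term_Pow [definability]: "def_term s \<Longrightarrow> def_term (\<lambda>e. Pow_M (s e))"
proof (rule def_term_subst1[of Pow_M])
  show "def_term (\<lambda>e. Pow_M (e 0))"
    unfolding Pow_M_def by (intro def_term_the_set is_set_Pow definability)
qed

lemma def_term_upair [definability]:
  "def_term s \<Longrightarrow> def_term t \<Longrightarrow> def_term (\<lambda>e. upair (s e) (t e))"
proof (rule def_term_subst2[of upair])
  show "def_term (\<lambda>e. upair (e 0) (e (Suc 0)))"
    unfolding upair_def by (intro def_term_the_set is_set_upair definability)
qed

lemma def_term_opair [definability]:
  "def_term s \<Longrightarrow> def_term t \<Longrightarrow> def_term (\<lambda>e. opair (s e) (t e))"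
  unfolding opair_def by (intro definability)

lemma upair_eq_iff: "upair a b = upair c d \<longleftrightarrow> a = c \<and> b = d \<or> a = d \<and> b = c"
proof
  assume "upair a b = upair c d"
  then have "z = a \<or> z = b \<longleftrightarrow> z = c \<or> z = d" for z by (metis mem_upair)
  then show "a = c \<and> b = d \<or> a = d \<and> b = c" by metis
next
  assume "a = c \<and> b = d \<or> a = d \<and> b = c"
  then show "upair a b = upair c d" by (intro set_ext) auto
qed

lemma opair_inject [simp]: "opair a b = opair c d \<longleftrightarrow> a = c \<and> b = d"
  unfolding opair_def upair_eq_iff by auto

text \<open>A pair is two levels above its components: \<open>y\<close> lies in
  \<open>upair x y\<close>, which lies in \<open>opair x y\<close>, which lies in \<open>f\<close>.
  Three unions therefore reach the elements of \<open>y\<close>.\<close>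

lemma is_set_apply: "is_set (\<lambda>z. \<exists>y. opair x y \<in>\<^sub>M f \<and> z \<in>\<^sub>M y)"
proof (rule is_set_subset)
  fix z assume "\<exists>y. opair x y \<in>\<^sub>M f \<and> z \<in>\<^sub>M y"
  then obtain y where "opair x y \<in>\<^sub>M f" "z \<in>\<^sub>M y" by blast
  moreover have "upair x y \<in>\<^sub>M opair x y" by (simp add: opair_def)
  ultimately show "z \<in>\<^sub>M Union_M (Union_M (Union_M f))" unfolding mem_Union by (metis mem_upair)
qed (intro definability)

lemma mem_apply: "z \<in>\<^sub>M apply_M f x \<longleftrightarrow> (\<exists>y. opair x y \<in>\<^sub>M f \<and> z \<in>\<^sub>M y)"
  unfolding apply_M_def by (rule mem_the_set[OF is_set_apply])

lemma def_term_apply [definability]: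
  "def_term s \<Longrightarrow> def_term t \<Longrightarrow> def_term (\<lambda>e. apply_M (s e) (t e))"
proof (rule def_term_subst2[of apply_M])
  show "def_term (\<lambda>e. apply_M (e 0) (e (Suc 0)))"
    unfolding apply_M_def by (intro def_term_the_set is_set_apply definability)
qed

lemma mem_Lam: "def_term (\<lambda>e. F (e 0)) \<Longrightarrow> p \<in>\<^sub>M Lam X F \<longleftrightarrow> (\<exists>x. x \<in>\<^sub>M X \<and> p = opair x (F x))"
  unfolding Lam_def by (rule mem_the_set[OF is_set_image]) (intro definability)

lemma def_term_Lam [definability]:
  assumes "def_term s" "def_term (\<lambda>e. F (e 0) (\<lambda>i. e (Suc i)))"
  shows "def_term (\<lambda>e. Lam (s e) (\<lambda>x. F x e))"
  unfolding Lam_def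
proof (rule def_term_the_set)
  show "is_set (\<lambda>p. \<exists>x. x \<in>\<^sub>M s e \<and> p = opair x (F x e))" for e
    by (intro is_set_image definability def_term_fix assms(2))
  show "def_pred (\<lambda>e. \<exists>x. x \<in>\<^sub>M s (\<lambda>i. e (Suc i)) \<and> e 0 = opair x (F x (\<lambda>i. e (Suc i))))"
    by (intro definability def_term_shift assms(1) def_term_lift[OF assms(2)])
qed

lemma def_term_image [definability]:
  assumes "def_term s" "def_term (\<lambda>e. F (e 0) (\<lambda>i. e (Suc i)))"
  shows "def_term (\<lambda>e. image_M (\<lambda>x. F x e) (s e))"
  unfolding image_M_def
proof (rule def_term_the_set)
  show "is_set (\<lambda>p. \<exists>x. x \<in>\<^sub>M s e \<and> p = F x e)" for e
    by (intro is_set_image definability def_term_fix assms(2))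
  show "def_pred (\<lambda>e. \<exists>x. x \<in>\<^sub>M s (\<lambda>i. e (Suc i)) \<and> e 0 = F x (\<lambda>i. e (Suc i)))"
    by (intro definability def_term_shift assms(1) def_term_lift[OF assms(2)])
qed

lemma Lam_cong: "(\<And>x. x \<in>\<^sub>M X \<Longrightarrow> F x = G x) \<Longrightarrow> Lam X F = Lam X G"
  unfolding Lam_def by (metis (no_types, lifting))

lemma apply_Lam:
  assumes "def_term (\<lambda>e. F (e 0))" "x \<in>\<^sub>M X"
  shows "apply_M (Lam X F) x = F x"
  by (rule set_ext) (use assms(2) in \<open>auto simp: mem_apply mem_Lam[OF assms(1)]\<close>)

lemma def_term_apply_const: "def_term (\<lambda>e. apply_M f (e 0))"
  by (intro definability)

lemma is_functionD:
  assumes "is_function f X Y"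
  shows "p \<in>\<^sub>M f \<Longrightarrow> \<exists>x y. x \<in>\<^sub>M X \<and> y \<in>\<^sub>M Y \<and> p = opair x y"
    and "x \<in>\<^sub>M X \<Longrightarrow> \<exists>!y. opair x y \<in>\<^sub>M f"
  using assms unfolding is_function_def by simp_all

lemma is_function_opair:
  assumes "is_function f X Y" "opair x y \<in>\<^sub>M f"
  shows "x \<in>\<^sub>M X" "y \<in>\<^sub>M Y"
  using is_functionD(1)[OF assms] by auto

lemma is_function_apply_eq:
  assumes "is_function f X Y" "opair x y \<in>\<^sub>M f"
  shows "apply_M f x = y"
proof (rule set_ext)
  fix z
  have "y' = y" if "opair x y' \<in>\<^sub>M f" for y'
    using is_functionD(2)[OF assms(1) is_function_opair(1)[OF assms]] assms(2) that by metis
  with assms(2) show "z \<in>\<^sub>M apply_M f x \<longleftrightarrow> z \<in>\<^sub>M y" unfolding mem_apply by metis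
qed

lemma is_function_mem:
  assumes "is_function f X Y" "x \<in>\<^sub>M X"
  shows "opair x (apply_M f x) \<in>\<^sub>M f"
proof -
  obtain y where "opair x y \<in>\<^sub>M f" using is_functionD(2)[OF assms] by (elim ex1E)
  with is_function_apply_eq[OF assms(1)] show ?thesis by metis
qed

lemma is_function_type: "is_function f X Y \<Longrightarrow> x \<in>\<^sub>M X \<Longrightarrow> apply_M f x \<in>\<^sub>M Y"
  using is_function_mem is_function_opair(2) by blast

lemma app_eq: "is_function f X Y \<Longrightarrow> x \<in>\<^sub>M X \<Longrightarrow> app f x = apply_M f x"
  unfolding app_def by (rule the_equality) (simp_all add: is_function_mem is_function_apply_eq)

text \<open>The right side is built from definable terms without unique existence, which makes it
  the form from which definability of \<open>is_function\<close> is read off.\<close>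

lemma is_function_iff:
  "is_function f X Y \<longleftrightarrow> f = Lam X (apply_M f) \<and> (\<forall>x. x \<in>\<^sub>M X \<longrightarrow> apply_M f x \<in>\<^sub>M Y)"
proof
  assume f: "is_function f X Y"
  have "f = Lam X (apply_M f)"
  proof (rule set_ext)
    fix p
    show "p \<in>\<^sub>M f \<longleftrightarrow> p \<in>\<^sub>M Lam X (apply_M f)"
      unfolding mem_Lam[OF def_term_apply_const]
      using is_functionD(1)[OF f] is_function_mem[OF f] is_function_apply_eq[OF f] by metis
  qed
  with is_function_type[OF f] show "f = Lam X (apply_M f) \<and> (\<forall>x. x \<in>\<^sub>M X \<longrightarrow> apply_M f x \<in>\<^sub>M Y)"
    by blast
next
  assume *: "f = Lam X (apply_M f) \<and> (\<forall>x. x \<in>\<^sub>M X \<longrightarrow> apply_M f x \<in>\<^sub>M Y)"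
  then have "p \<in>\<^sub>M f \<longleftrightarrow> (\<exists>x. x \<in>\<^sub>M X \<and> p = opair x (apply_M f x))" for p
    using mem_Lam[OF def_term_apply_const, of p X f] by simp
  with * show "is_function f X Y" unfolding is_function_def by (simp, blast)
qed

lemma Lam_function:
  assumes "def_term (\<lambda>e. F (e 0))" "\<And>x. x \<in>\<^sub>M X \<Longrightarrow> F x \<in>\<^sub>M Y"
  shows "is_function (Lam X F) X Y"
proof -
  have "Lam X F = Lam X (apply_M (Lam X F))"
    by (rule Lam_cong) (simp add: apply_Lam[OF assms(1)])
  moreover have "apply_M (Lam X F) x \<in>\<^sub>M Y" if "x \<in>\<^sub>M X" for x
    using assms(2)[OF that] apply_Lam[OF assms(1) that] by simp
  ultimately show ?thesis unfolding is_function_iff by blast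
qed

lemma restrict_eq:
  assumes "is_function f X Y" "Z \<subseteq>\<^sub>M X"
  shows "restrict f Z = Lam Z (apply_M f)"
proof -
  have "(\<exists>x y. x \<in>\<^sub>M Z \<and> p = opair x y \<and> p \<in>\<^sub>M f) \<longleftrightarrow> (\<exists>x. x \<in>\<^sub>M Z \<and> p = opair x (apply_M f x))" for p
    using is_function_mem[OF assms(1)] is_function_apply_eq[OF assms(1)] subsetD[OF assms(2)] by metis
  then show ?thesis unfolding restrict_def Lam_def by simp
qed

lemma def_pred_function [definability]:
  "def_term s \<Longrightarrow> def_term t \<Longrightarrow> def_term u \<Longrightarrow> def_pred (\<lambda>e. is_function (s e) (t e) (u e))"
  by (rule def_pred_subst3[of is_function]) (unfold is_function_iff, intro definability)

lemma opair_mem_product: "x \<in>\<^sub>M X \<Longrightarrow> y \<in>\<^sub>M Y \<Longrightarrow> opair x y \<in>\<^sub>M Pow_M (Pow_M (Union_M (upair X Y)))"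
  by (auto simp: opair_def subset_M_def mem_Union)

lemma is_set_function: "is_set (\<lambda>f. is_function f X Y)"
proof (rule is_set_subset)
  fix f assume "is_function f X Y"
  then have "p \<in>\<^sub>M Pow_M (Pow_M (Union_M (upair X Y)))" if "p \<in>\<^sub>M f" for p
    using is_functionD(1)[OF _ that] opair_mem_product by metis
  then show "f \<in>\<^sub>M Pow_M (Pow_M (Pow_M (Union_M (upair X Y))))"
    by (simp add: subset_M_def)
qed (intro definability)

lemma mem_function_set: "f \<in>\<^sub>M function_set X Y \<longleftrightarrow> is_function f X Y"
  unfolding function_set_def by (rule mem_the_set[OF is_set_function])

end

section \<open>Ordinals and recursion\<close>

context membership
begin

lemma def_pred_transitive [definability]:
  assumes "def_term t"
  shows "def_pred (\<lambda>e. transitive (t e))"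
  unfolding transitive_def by (intro definability assms def_term_shift)

lemma def_pred_ordinal [definability]:
  assumes "def_term t"
  shows "def_pred (\<lambda>e. ordinal (t e))"
  unfolding ordinal_def by (intro definability assms def_term_shift)

text \<open>As an intersection, this is \<open>zero\<close> if no ordinal has property \<open>P\<close>.\<close>

definition Least_M :: "('v \<Rightarrow> bool) \<Rightarrow> 'v" where
  "Least_M P = the_set (\<lambda>y. (\<exists>\<alpha>. ordinal \<alpha> \<and> P \<alpha>) \<and> (\<forall>\<alpha>. ordinal \<alpha> \<and> P \<alpha> \<longrightarrow> y \<in>\<^sub>M \<alpha>))"

end

context zfc_model
begin

lemma foundation_set: "y \<in>\<^sub>M x \<Longrightarrow> \<exists>y. y \<in>\<^sub>M x \<and> (\<forall>z. z \<in>\<^sub>M y \<longrightarrow> \<not> z \<in>\<^sub>M x)"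
  using foundation by meson

lemma mem_asym: "x \<in>\<^sub>M y \<Longrightarrow> \<not> y \<in>\<^sub>M x"
  using foundation_set[of x "upair x y"] by (metis mem_upair)

lemma mem_irrefl [simp]: "\<not> x \<in>\<^sub>M x"
  using mem_asym by blast

lemma ordinal_mem: "ordinal \<alpha> \<Longrightarrow> \<beta> \<in>\<^sub>M \<alpha> \<Longrightarrow> ordinal \<beta>"
  unfolding ordinal_def transitive_def subset_M_def by blast

lemma ordinal_trans: "ordinal \<gamma> \<Longrightarrow> \<alpha> \<in>\<^sub>M \<beta> \<Longrightarrow> \<beta> \<in>\<^sub>M \<gamma> \<Longrightarrow> \<alpha> \<in>\<^sub>M \<gamma>"
  unfolding ordinal_def transitive_def subset_M_def by blast

lemma ordinalI: "(\<And>\<beta> \<gamma>. \<beta> \<in>\<^sub>M \<alpha> \<Longrightarrow> \<gamma> \<in>\<^sub>M \<beta> \<Longrightarrow> \<gamma> \<in>\<^sub>M \<alpha>) \<Longrightarrow> (\<And>\<beta>. \<beta> \<in>\<^sub>M \<alpha> \<Longrightarrow> ordinal \<beta>) \<Longrightarrow> ordinal \<alpha>"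
  unfolding ordinal_def transitive_def subset_M_def by blast

lemma ordinal_zero: "ordinal zero"
  by (rule ordinalI) simp_all

lemma ordinal_succ: "ordinal \<alpha> \<Longrightarrow> ordinal (succ \<alpha>)"
  by (rule ordinalI) (auto dest: ordinal_mem ordinal_trans)

lemma ordinal_Union: "(\<And>\<alpha>. \<alpha> \<in>\<^sub>M X \<Longrightarrow> ordinal \<alpha>) \<Longrightarrow> ordinal (Union_M X)"
  by (rule ordinalI) (unfold mem_Union, (metis ordinal_trans ordinal_mem)+)

text \<open>Foundation speaks of elements of the model only, so the counterexamples up to \<alpha>
  must first be collected into a set by Separation.\<close>

lemma ordinal_least:
  assumes "def_pred (\<lambda>e. P (e 0))" "ordinal \<alpha>" "P \<alpha>"
  shows "\<exists>\<beta>. ordinal \<beta> \<and> P \<beta> \<and> (\<forall>\<gamma>. \<gamma> \<in>\<^sub>M \<beta> \<longrightarrow> \<not> P \<gamma>)"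
proof -
  obtain B where B: "\<And>\<beta>. \<beta> \<in>\<^sub>M B \<longleftrightarrow> \<beta> \<in>\<^sub>M succ \<alpha> \<and> P \<beta>"
    using is_set_sep[OF assms(1), of "succ \<alpha>"] unfolding is_set_def by meson
  have "\<alpha> \<in>\<^sub>M B" using B assms(3) by simp
  then obtain \<beta> where \<beta>: "\<beta> \<in>\<^sub>M B" "\<And>\<gamma>. \<gamma> \<in>\<^sub>M \<beta> \<Longrightarrow> \<not> \<gamma> \<in>\<^sub>M B"
    using foundation_set by meson
  have "\<gamma> \<in>\<^sub>M succ \<alpha>" if "\<gamma> \<in>\<^sub>M \<beta>" for \<gamma>
    using \<beta>(1) B that ordinal_trans[OF ordinal_succ[OF assms(2)]] by blast
  then show ?thesis
    using \<beta> B ordinal_mem[OF ordinal_succ[OF assms(2)]] by blast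
qed

lemma ordinal_induct [consumes 2, case_names step]:
  assumes "ordinal \<alpha>" "def_pred (\<lambda>e. P (e 0))"
    and "\<And>\<alpha>. ordinal \<alpha> \<Longrightarrow> (\<And>\<beta>. \<beta> \<in>\<^sub>M \<alpha> \<Longrightarrow> P \<beta>) \<Longrightarrow> P \<alpha>"
  shows "P \<alpha>"
  using ordinal_least[of "\<lambda>x. \<not> P x" \<alpha>, OF definable_neg[OF assms(2)] assms(1)] assms(3) by blast

text \<open>Double induction: if \<alpha> and \<beta> were incomparable, the two induction
  hypotheses would put every element of each into the other, and Extensionality would make them
  equal.\<close>

lemma ordinal_linear:
  assumes "ordinal \<alpha>" "ordinal \<beta>"
  shows "\<alpha> \<in>\<^sub>M \<beta> \<or> \<alpha> = \<beta> \<or> \<beta> \<in>\<^sub>M \<alpha>"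
proof -
  have def1: "def_pred (\<lambda>e. \<forall>\<beta>. ordinal \<beta> \<longrightarrow> e 0 \<in>\<^sub>M \<beta> \<or> e 0 = \<beta> \<or> \<beta> \<in>\<^sub>M e 0)"
    by (intro definability)
  have "\<forall>\<beta>. ordinal \<beta> \<longrightarrow> \<alpha> \<in>\<^sub>M \<beta> \<or> \<alpha> = \<beta> \<or> \<beta> \<in>\<^sub>M \<alpha>"
    using assms(1) def1
  proof (induction rule: ordinal_induct)
    case (step \<alpha>)
    have def2: "def_pred (\<lambda>e. \<alpha> \<in>\<^sub>M e 0 \<or> \<alpha> = e 0 \<or> e 0 \<in>\<^sub>M \<alpha>)"
      by (intro definability)
    show ?case
    proof (intro allI impI)
      fix \<beta> assume "ordinal \<beta>"
      then show "\<alpha> \<in>\<^sub>M \<beta> \<or> \<alpha> = \<beta> \<or> \<beta> \<in>\<^sub>M \<alpha>" using def2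
      proof (induction rule: ordinal_induct)
        case inner: (step \<beta>)
        show ?case
        proof (rule ccontr)
          assume *: "\<not> ?case"
          have "\<gamma> \<in>\<^sub>M \<alpha>" if "\<gamma> \<in>\<^sub>M \<beta>" for \<gamma>
            using inner.IH[OF that] * that ordinal_trans[OF inner.hyps] by blast
          moreover have "\<gamma> \<in>\<^sub>M \<beta>" if "\<gamma> \<in>\<^sub>M \<alpha>" for \<gamma>
            using step.IH[OF that] inner.hyps * that ordinal_trans[OF step.hyps] by blast
          ultimately have "\<alpha> = \<beta>" using set_ext by blast
          with * show False by blast
        qed
      qed
    qed
  qed
  with assms(2) show ?thesis by blast
qed

lemma ordinal_subset_iff: "ordinal \<alpha> \<Longrightarrow> ordinal \<beta> \<Longrightarrow> \<alpha> \<subseteq>\<^sub>M \<beta> \<longleftrightarrow> \<alpha> \<in>\<^sub>M \<beta> \<or> \<alpha> = \<beta>"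
  using ordinal_linear[of \<alpha> \<beta>] ordinal_trans[of \<beta> _ \<alpha>] mem_irrefl unfolding subset_M_def by metis

lemma ordinal_not_mem_iff: "ordinal \<alpha> \<Longrightarrow> ordinal \<beta> \<Longrightarrow> \<not> \<alpha> \<in>\<^sub>M \<beta> \<longleftrightarrow> \<beta> \<subseteq>\<^sub>M \<alpha>"
  using ordinal_linear[of \<alpha> \<beta>] ordinal_subset_iff[of \<beta> \<alpha>] mem_asym mem_irrefl by metis

lemma succ_not_zero [simp]: "succ \<alpha> \<noteq> zero" "zero \<noteq> succ \<alpha>"
  using mem_succ[of \<alpha> \<alpha>] mem_zero[of \<alpha>] by metis+

lemma succ_inject [simp]: "succ \<alpha> = succ \<beta> \<longleftrightarrow> \<alpha> = \<beta>"
  using mem_succ mem_asym by metis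

lemma Union_succ: "ordinal \<alpha> \<Longrightarrow> Union_M (succ \<alpha>) = \<alpha>"
  by (rule set_ext) (auto simp: mem_Union intro: ordinal_trans)

lemma is_set_Least:
  assumes "def_pred (\<lambda>e. P (e 0))"
  shows "is_set (\<lambda>y. (\<exists>\<alpha>. ordinal \<alpha> \<and> P \<alpha>) \<and> (\<forall>\<alpha>. ordinal \<alpha> \<and> P \<alpha> \<longrightarrow> y \<in>\<^sub>M \<alpha>))"
proof (cases "\<exists>\<alpha>. ordinal \<alpha> \<and> P \<alpha>")
  case True
  then obtain \<alpha> where \<alpha>: "ordinal \<alpha>" "P \<alpha>" by blast
  show ?thesis
  proof (rule is_set_subset)
    show "def_pred (\<lambda>e. (\<exists>\<alpha>. ordinal \<alpha> \<and> P \<alpha>) \<and> (\<forall>\<alpha>. ordinal \<alpha> \<and> P \<alpha> \<longrightarrow> e 0 \<in>\<^sub>M \<alpha>))"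
      by (intro definability assms)
  qed (use \<alpha> in blast)
next
  case False
  then show ?thesis unfolding is_set_def by (intro exI[of _ zero]) simp
qed

lemma def_term_Least [definability]:
  assumes "def_pred (\<lambda>e. P (e 0) (\<lambda>i. e (Suc i)))"
  shows "def_term (\<lambda>e. Least_M (\<lambda>x. P x e))"
  unfolding Least_M_def
  by (intro def_term_the_set is_set_Least def_pred_fix[OF assms] definability def_pred_lift[OF assms])

lemma
  assumes "def_pred (\<lambda>e. P (e 0))" "ordinal \<alpha>" "P \<alpha>"
  shows ordinal_Least: "ordinal (Least_M P)"
    and Least_property: "P (Least_M P)"
    and Least_subset: "Least_M P \<subseteq>\<^sub>M \<alpha>"
proof -
  obtain \<beta> where \<beta>: "ordinal \<beta>" "P \<beta>" "\<And>\<gamma>. \<gamma> \<in>\<^sub>M \<beta> \<Longrightarrow> \<not> P \<gamma>"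
    using ordinal_least[OF assms] by blast
  have least: "y \<in>\<^sub>M Least_M P \<longleftrightarrow> (\<forall>\<alpha>. ordinal \<alpha> \<and> P \<alpha> \<longrightarrow> y \<in>\<^sub>M \<alpha>)" for y
    unfolding Least_M_def mem_the_set[OF is_set_Least[OF assms(1)]] using assms(2,3) by blast
  have "Least_M P = \<beta>"
  proof (rule set_ext)
    show "y \<in>\<^sub>M Least_M P \<longleftrightarrow> y \<in>\<^sub>M \<beta>" for y
      unfolding least using \<beta> ordinal_linear ordinal_trans by metis
  qed
  then show "ordinal (Least_M P)" "P (Least_M P)" using \<beta> by auto
  show "Least_M P \<subseteq>\<^sub>M \<alpha>" using least assms(2,3) unfolding subset_M_def by blast
qed

text \<open>Approximations of length \<alpha> are unique by induction, and "being one" is definable,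
  so the unique approximation \<open>H \<alpha>\<close> is a definable term and
  \<open>F \<alpha>\<close> is \<open>G\<close> applied to it. Definability of \<open>F\<close>
  belongs to the conclusion because \<open>F\<close> is a class function that later inductions and
  images have to mention.\<close>

lemma transfinite_recursion:
  assumes G: "def_term (\<lambda>e. G (e 0) (e (Suc 0)))"
  shows "\<exists>F. def_term (\<lambda>e. F (e 0)) \<and> (\<forall>\<alpha>. ordinal \<alpha> \<longrightarrow> F \<alpha> = G \<alpha> (Lam \<alpha> F))"
proof -
  note G_term [definability] = def_term_subst2[of G, OF G]
  define approx where "approx f \<alpha> \<longleftrightarrow> f = Lam \<alpha> (\<lambda>\<beta>. G \<beta> (Lam \<beta> (apply_M f)))" for f \<alpha>
  have def_approx: "def_pred (\<lambda>e. approx (e 0) (e (Suc 0)))"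
    unfolding approx_def by (intro definability)
  note [definability] = def_pred_subst2[of _ _ approx, OF _ _ def_approx]
  have val: "apply_M f \<beta> = G \<beta> (Lam \<beta> (apply_M f))" if "approx f \<alpha>" "\<beta> \<in>\<^sub>M \<alpha>" for f \<alpha> \<beta>
  proof -
    have "def_term (\<lambda>e. G (e 0) (Lam (e 0) (apply_M f)))"
      by (intro definability)
    from apply_Lam[OF this that(2)] that(1) show ?thesis unfolding approx_def by metis
  qed
  have unique: "f = g" if fg: "ordinal \<alpha>" "approx f \<alpha>" "approx g \<alpha>" for f g \<alpha>
  proof -
    have eq: "\<beta> \<in>\<^sub>M \<alpha> \<longrightarrow> apply_M f \<beta> = apply_M g \<beta>" if "ordinal \<beta>" for \<beta>
    proof -
      have "def_pred (\<lambda>e. e 0 \<in>\<^sub>M \<alpha> \<longrightarrow> apply_M f (e 0) = apply_M g (e 0))"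
        by (intro definability)
      with \<open>ordinal \<beta>\<close> show ?thesis
      proof (induction rule: ordinal_induct)
        case (step \<beta>)
        show ?case
        proof
          assume \<beta>: "\<beta> \<in>\<^sub>M \<alpha>"
          have "Lam \<beta> (apply_M f) = Lam \<beta> (apply_M g)"
            using step.IH ordinal_trans[OF \<open>ordinal \<alpha>\<close> _ \<beta>] by (intro Lam_cong) blast
          then show "apply_M f \<beta> = apply_M g \<beta>"
            using val[OF fg(2) \<beta>] val[OF fg(3) \<beta>] by simp
        qed
      qed
    qed
    have "Lam \<beta> (apply_M f) = Lam \<beta> (apply_M g)" if "\<beta> \<in>\<^sub>M \<alpha>" for \<beta>
      by (rule Lam_cong) (use that eq \<open>ordinal \<alpha>\<close> ordinal_trans ordinal_mem in metis)
    then have "Lam \<alpha> (\<lambda>\<beta>. G \<beta> (Lam \<beta> (apply_M f))) = Lam \<alpha> (\<lambda>\<beta>. G \<beta> (Lam \<beta> (apply_M g)))"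
      by (intro Lam_cong) simp
    then show ?thesis using fg(2,3) unfolding approx_def by simp
  qed
  have initial: "approx (Lam \<beta> (apply_M f)) \<beta>" if "ordinal \<alpha>" "approx f \<alpha>" "\<beta> \<in>\<^sub>M \<alpha>" for f \<alpha> \<beta>
    unfolding approx_def
  proof (rule Lam_cong)
    fix \<gamma> assume \<gamma>: "\<gamma> \<in>\<^sub>M \<beta>"
    have "Lam \<gamma> (apply_M (Lam \<beta> (apply_M f))) = Lam \<gamma> (apply_M f)"
      by (rule Lam_cong)
         (use apply_Lam[OF def_term_apply_const] \<gamma> ordinal_trans ordinal_mem[OF that(1,3)] in metis)
    then show "apply_M f \<gamma> = G \<gamma> (Lam \<gamma> (apply_M (Lam \<beta> (apply_M f))))"
      using val[OF that(2) ordinal_trans[OF that(1) \<gamma> that(3)]] by simp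
  qed
  \<comment> \<open>Written as the union of all approximations of length \<alpha>, this is a set
    before existence is known; it is \<open>zero\<close> as long as there is none.\<close>
  define H where "H \<alpha> = the_set (\<lambda>z. \<exists>f. (ordinal \<alpha> \<and> approx f \<alpha>) \<and> z \<in>\<^sub>M f)" for \<alpha>
  have set: "is_set (\<lambda>z. \<exists>f. (ordinal \<alpha> \<and> approx f \<alpha>) \<and> z \<in>\<^sub>M f)" for \<alpha>
  proof (cases "\<exists>f. ordinal \<alpha> \<and> approx f \<alpha>")
    case True
    then obtain f where "ordinal \<alpha>" "approx f \<alpha>" by blast
    then show ?thesis unfolding is_set_def using unique by (intro exI[of _ f]) blast
  next
    case False
    then show ?thesis unfolding is_set_def by (intro exI[of _ zero]) auto
  qed
  have "def_term (\<lambda>e. H (e 0))"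
    unfolding H_def by (intro def_term_the_set set definability)
  note H [definability] = def_term_subst1[of H, OF this]
  have H_eq: "H \<alpha> = f" if "ordinal \<alpha>" "approx f \<alpha>" for \<alpha> f
    unfolding H_def by (rule the_set_eq) (use that unique in blast)
  define F where "F \<alpha> = G \<alpha> (H \<alpha>)" for \<alpha>
  have F: "def_term (\<lambda>e. F (e 0))"
    unfolding F_def by (intro definability)
  \<comment> \<open>The second conjunct is carried along so that, at \<alpha>, the approximations of
    smaller lengths can be rewritten as restrictions of \<open>F\<close>.\<close>
  have exists: "approx (H \<alpha>) \<alpha> \<and> H \<alpha> = Lam \<alpha> F" if "ordinal \<alpha>" for \<alpha>
  proof -
    have "def_pred (\<lambda>e. approx (H (e 0)) (e 0) \<and> H (e 0) = Lam (e 0) F)"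
      unfolding F_def by (intro definability)
    with that show ?thesis
    proof (induction rule: ordinal_induct)
      case (step \<alpha>)
      have "approx (Lam \<alpha> F) \<alpha>"
        unfolding approx_def
      proof (rule Lam_cong)
        fix \<beta> assume \<beta>: "\<beta> \<in>\<^sub>M \<alpha>"
        have "Lam \<beta> F = Lam \<beta> (apply_M (Lam \<alpha> F))"
          by (rule Lam_cong) (use apply_Lam[OF F] \<beta> step.hyps ordinal_trans in metis)
        with step.IH[OF \<beta>] F_def[of \<beta>] show "F \<beta> = G \<beta> (Lam \<beta> (apply_M (Lam \<alpha> F)))"
          by metis
      qed
      with H_eq[OF step.hyps this] show ?case by simp
    qed
  qed
  have "F \<alpha> = G \<alpha> (Lam \<alpha> F)" if "ordinal \<alpha>" for \<alpha>
    using exists[OF that] by (simp add: F_def[of \<alpha>])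
  with F show ?thesis by blast
qed

section \<open>The natural numbers of the model\<close>

text \<open>The ordinals in an inductive set may have gaps; their union has none and is still closed
  under successor.\<close>

lemma omega_exists: "\<exists>\<alpha>. limit_ordinal \<alpha>"
proof -
  obtain I where I: "zero \<in>\<^sub>M I" "\<And>y. y \<in>\<^sub>M I \<Longrightarrow> succ y \<in>\<^sub>M I"
  proof -
    obtain I where I: "\<exists>y. y \<in>\<^sub>M I \<and> (\<forall>z. \<not> z \<in>\<^sub>M y)"
      "\<And>y. y \<in>\<^sub>M I \<Longrightarrow> \<exists>s. s \<in>\<^sub>M I \<and> (\<forall>z. z \<in>\<^sub>M s \<longleftrightarrow> z \<in>\<^sub>M y \<or> z = y)"
      using infinity by meson
    have "zero \<in>\<^sub>M I" using I(1) set_ext[of _ zero] mem_zero by metis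
    moreover have "succ y \<in>\<^sub>M I" if "y \<in>\<^sub>M I" for y
      using I(2)[OF that] set_ext[of _ "succ y"] mem_succ by metis
    ultimately show ?thesis using that by blast
  qed
  obtain J where J: "\<And>\<alpha>. \<alpha> \<in>\<^sub>M J \<longleftrightarrow> \<alpha> \<in>\<^sub>M I \<and> ordinal \<alpha>"
    using is_set_sep[of ordinal I, OF def_pred_ordinal[OF def_term_var]] unfolding is_set_def by meson
  have "ordinal (Union_M J)" using J ordinal_Union by blast
  moreover have "succ \<beta> \<in>\<^sub>M Union_M J" if \<beta>: "\<beta> \<in>\<^sub>M Union_M J" for \<beta>
  proof -
    obtain \<alpha> where \<alpha>: "\<alpha> \<in>\<^sub>M J" "\<beta> \<in>\<^sub>M \<alpha>" using \<beta> by (auto simp: mem_Union)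
    then have o: "ordinal \<alpha>" "ordinal \<beta>" using J ordinal_mem by blast+
    have "succ \<beta> \<subseteq>\<^sub>M \<alpha>" using \<alpha>(2) ordinal_trans[OF o(1)] by (auto simp: subset_M_def)
    then have "succ \<beta> \<in>\<^sub>M succ \<alpha>" using ordinal_subset_iff[OF ordinal_succ[OF o(2)] o(1)] by simp
    moreover have "succ \<alpha> \<in>\<^sub>M J" using \<alpha>(1) J I(2) ordinal_succ by blast
    ultimately show ?thesis by (auto simp: mem_Union)
  qed
  moreover have "zero \<in>\<^sub>M Union_M J"
  proof -
    have "succ zero \<in>\<^sub>M J" using J I ordinal_zero ordinal_succ by blast
    then show ?thesis unfolding mem_Union using mem_succ by blast
  qed
  ultimately show ?thesis unfolding limit_ordinal_def using mem_zero by metis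
qed

lemma def_pred_limit_ordinal [definability]:
  assumes "def_term t"
  shows "def_pred (\<lambda>e. limit_ordinal (t e))"
  unfolding limit_ordinal_def by (intro definability assms def_term_shift)

lemma omega_least: "limit_ordinal omega \<and> (\<forall>\<beta>. \<beta> \<in>\<^sub>M omega \<longrightarrow> \<not> limit_ordinal \<beta>)"
proof -
  have "def_pred (\<lambda>e. limit_ordinal (e 0))" by (intro definability)
  from ordinal_least[OF this] obtain \<alpha> where \<alpha>:
    "limit_ordinal \<alpha>" "\<forall>\<beta>. \<beta> \<in>\<^sub>M \<alpha> \<longrightarrow> \<not> limit_ordinal \<beta>"
    using omega_exists unfolding limit_ordinal_def by blast
  have "omega = \<alpha>"
    unfolding omega_def
  proof (rule the_equality)
    fix \<alpha>' assume "limit_ordinal \<alpha>' \<and> (\<forall>\<beta>. \<beta> \<in>\<^sub>M \<alpha>' \<longrightarrow> \<not> limit_ordinal \<beta>)"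
    with \<alpha> ordinal_linear[of \<alpha> \<alpha>'] show "\<alpha>' = \<alpha>" unfolding limit_ordinal_def by blast
  qed (use \<alpha> in blast)
  with \<alpha> show ?thesis by blast
qed

lemma ordinal_omega: "ordinal omega"
  and succ_mem_omega: "n \<in>\<^sub>M omega \<Longrightarrow> succ n \<in>\<^sub>M omega"
  using omega_least unfolding limit_ordinal_def by blast+

lemma omega_cases:
  assumes "n \<in>\<^sub>M omega"
  obtains "n = zero" | m where "m \<in>\<^sub>M omega" "n = succ m"
proof (cases "n = zero")
  case False
  have n: "ordinal n" using assms ordinal_omega ordinal_mem by blast
  moreover have "\<not> limit_ordinal n" using omega_least assms by blast
  ultimately obtain m where m: "m \<in>\<^sub>M n" "\<not> succ m \<in>\<^sub>M n"
    using False unfolding limit_ordinal_def by blast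
  have "n \<subseteq>\<^sub>M succ m"
    using m ordinal_not_mem_iff[of "succ m" n] n ordinal_mem ordinal_succ by blast
  moreover have "succ m \<subseteq>\<^sub>M n"
    using m(1) ordinal_trans[OF n] by (auto simp: subset_M_def)
  ultimately have "n = succ m" using subset_antisym by blast
  with that(2) m(1) assms ordinal_trans[OF ordinal_omega] show ?thesis by blast
qed (use that in blast)

lemma zero_mem_omega: "zero \<in>\<^sub>M omega"
  using omega_least ordinal_linear[OF ordinal_zero ordinal_omega] unfolding limit_ordinal_def
  using mem_zero by metis

lemma omega_ordinal: "n \<in>\<^sub>M omega \<Longrightarrow> ordinal n"
  using ordinal_omega ordinal_mem by blast

lemma omega_trans: "n \<in>\<^sub>M omega \<Longrightarrow> k \<in>\<^sub>M n \<Longrightarrow> k \<in>\<^sub>M omega"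
  using ordinal_omega ordinal_trans by blast

lemma omega_induct [consumes 2, case_names zero succ]:
  assumes "n \<in>\<^sub>M omega" "def_pred (\<lambda>e. P (e 0))"
    and "P zero" "\<And>n. n \<in>\<^sub>M omega \<Longrightarrow> P n \<Longrightarrow> P (succ n)"
  shows "P n"
proof -
  have "def_pred (\<lambda>e. e 0 \<in>\<^sub>M omega \<longrightarrow> P (e 0))" by (intro definability assms(2))
  with omega_ordinal[OF assms(1)] have "n \<in>\<^sub>M omega \<longrightarrow> P n"
  proof (induction rule: ordinal_induct)
    case (step n)
    show ?case
    proof
      assume "n \<in>\<^sub>M omega"
      then show "P n" by (cases rule: omega_cases) (use assms(3,4) step.IH in auto)
    qed
  qed
  with assms(1) show ?thesis by blast
qed

lemma omega_recursion:
  assumes G: "def_term (\<lambda>e. G (e 0) (e (Suc 0)))"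
  shows "\<exists>F. def_term (\<lambda>e. F (e 0)) \<and> F zero = a \<and> (\<forall>n. n \<in>\<^sub>M omega \<longrightarrow> F (succ n) = G n (F n))"
proof -
  note [definability] = def_term_subst2[of G, OF G]
  \<comment> \<open>\<open>Union_M\<close> recovers the predecessor of a successor ordinal, so a
    recursion over one step becomes one over all earlier values.\<close>
  define H where "H \<alpha> p = (if \<alpha> = zero then a else G (Union_M \<alpha>) (apply_M p (Union_M \<alpha>)))" for \<alpha> p
  have "def_term (\<lambda>e. H (e 0) (e (Suc 0)))" unfolding H_def by (intro definability)
  from transfinite_recursion[OF this] obtain F where F: "def_term (\<lambda>e. F (e 0))"
    "\<And>\<alpha>. ordinal \<alpha> \<Longrightarrow> F \<alpha> = H \<alpha> (Lam \<alpha> F)" by blast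
  have "F zero = a" using F(2)[OF ordinal_zero] by (simp add: H_def)
  moreover have "F (succ n) = G n (F n)" if "n \<in>\<^sub>M omega" for n
    using F(2)[OF ordinal_succ[OF omega_ordinal[OF that]]] Union_succ[OF omega_ordinal[OF that]]
    by (simp add: H_def apply_Lam[OF F(1)])
  ultimately show ?thesis using F(1) by blast
qed

end

section \<open>Countable sets and stationary subsets of \<open>omega1\<close>\<close>

context membership
begin

definition injective :: "'v \<Rightarrow> 'v \<Rightarrow> bool" where
  "injective f X \<longleftrightarrow> (\<forall>x y. x \<in>\<^sub>M X \<longrightarrow> y \<in>\<^sub>M X \<longrightarrow> apply_M f x = apply_M f y \<longrightarrow> x = y)"

text \<open>The first conjunct excludes \<delta> = \<open>zero\<close>, which is not a strict upper
  bound of anything. A successor \<delta> may be closed; this does no harm, as the game looks for a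
  least strict upper bound rather than a limit.\<close>

definition closed_under :: "'v \<Rightarrow> 'v \<Rightarrow> bool" where
  "closed_under f \<delta> \<longleftrightarrow> zero \<in>\<^sub>M \<delta> \<and> (\<forall>\<alpha>. \<alpha> \<in>\<^sub>M \<delta> \<longrightarrow> apply_M f \<alpha> \<in>\<^sub>M \<delta>)"

text \<open>Every club contains the set of ordinals closed under some \<open>f\<close>, and these sets contain clubs, so
  this says that a set and its complement in \<open>omega1\<close> are stationary.\<close>

definition bistationary :: "('v \<Rightarrow> bool) \<Rightarrow> bool" where
  "bistationary P \<longleftrightarrow> (\<forall>f. is_function f omega1 omega1 \<longrightarrow>
     (\<exists>\<delta>. \<delta> \<in>\<^sub>M omega1 \<and> closed_under f \<delta> \<and> P \<delta>) \<and>
     (\<exists>\<delta>. \<delta> \<in>\<^sub>M omega1 \<and> closed_under f \<delta> \<and> \<not> P \<delta>))"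

end

context zfc_model
begin

lemma def_pred_injective [definability]:
  "def_term s \<Longrightarrow> def_term t \<Longrightarrow> def_pred (\<lambda>e. injective (s e) (t e))"
  by (rule def_pred_subst2[of _ _ injective]) (assumption | unfold injective_def, intro definability)+

lemma def_pred_closed_under [definability]:
  "def_term s \<Longrightarrow> def_term t \<Longrightarrow> def_pred (\<lambda>e. closed_under (s e) (t e))"
  by (rule def_pred_subst2[of _ _ closed_under]) (assumption | unfold closed_under_def, intro definability)+

lemma countable_set_iff: "countable_set X \<longleftrightarrow> (\<exists>f. is_function f X omega \<and> injective f X)"
  unfolding countable_set_def injective_def using app_eq by metis

lemma def_pred_countable [definability]:
  "def_term s \<Longrightarrow> def_pred (\<lambda>e. countable_set (s e))"
  by (rule def_pred_subst1[of countable_set]) (unfold countable_set_iff, intro definability)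

lemma countable_setI:
  assumes "def_term (\<lambda>e. F (e 0))" "\<And>x. x \<in>\<^sub>M X \<Longrightarrow> F x \<in>\<^sub>M omega"
    and "\<And>x y. x \<in>\<^sub>M X \<Longrightarrow> y \<in>\<^sub>M X \<Longrightarrow> F x = F y \<Longrightarrow> x = y"
  shows "countable_set X"
  unfolding countable_set_iff
proof (intro exI conjI)
  show "is_function (Lam X F) X omega" by (rule Lam_function[OF assms(1,2)])
  show "injective (Lam X F) X"
    unfolding injective_def using apply_Lam[OF assms(1)] assms(3) by metis
qed

lemma countable_set_subset:
  assumes "countable_set Y" "X \<subseteq>\<^sub>M Y"
  shows "countable_set X"
proof -
  obtain f where "is_function f Y omega" "injective f Y" using assms(1) countable_set_iff by blast
  then show ?thesis
    using is_function_type assms(2) unfolding injective_def subset_M_def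
    by (intro countable_setI[OF def_term_apply_const[of f]]) blast+
qed

lemma countable_omega: "countable_set omega"
  by (rule countable_setI[where F = "\<lambda>x. x"]) (auto intro: definability)

text \<open>One set containing the functions on all subsets of \<open>Z\<close>: such a common range
  is what \<open>choice_function\<close> asks for when injections on varying domains are
  chosen.\<close>

lemma function_mem_Pow:
  assumes "is_function f X Y" "X \<subseteq>\<^sub>M Z"
  shows "f \<in>\<^sub>M Pow_M (Pow_M (Pow_M (Union_M (upair Z Y))))"
proof -
  have "p \<in>\<^sub>M Pow_M (Pow_M (Union_M (upair Z Y)))" if "p \<in>\<^sub>M f" for p
    using is_functionD(1)[OF assms(1) that] opair_mem_product subsetD[OF assms(2)] by metis
  then show ?thesis by (simp add: subset_M_def)
qed

text \<open>The axiom chooses from disjoint families only. Tagging each candidate \<open>y\<close>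
  with its argument, as the pair of \<open>x\<close> and \<open>y\<close>, makes the sets
  \<open>T x\<close> disjoint, and the chosen pairs already form the function.\<close>

lemma choice_function:
  assumes R: "def_pred (\<lambda>e. R (e 0) (e (Suc 0)))"
    and ex: "\<And>x. x \<in>\<^sub>M A \<Longrightarrow> \<exists>y. y \<in>\<^sub>M B \<and> R x y"
  shows "\<exists>f. is_function f A B \<and> (\<forall>x. x \<in>\<^sub>M A \<longrightarrow> R x (apply_M f x))"
proof -
  note [definability] = def_pred_subst2[of _ _ R, OF _ _ R]
  define T where "T x = the_set (\<lambda>p. \<exists>y. y \<in>\<^sub>M B \<and> R x y \<and> p = opair x y)" for x
  have set: "is_set (\<lambda>p. \<exists>y. y \<in>\<^sub>M B \<and> R x y \<and> p = opair x y)" for x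
  proof (rule is_set_subset)
    fix p assume "\<exists>y. y \<in>\<^sub>M B \<and> R x y \<and> p = opair x y"
    then show "p \<in>\<^sub>M Pow_M (Pow_M (Union_M (upair (upair x x) B)))"
      using opair_mem_product[of x "upair x x"] by auto
  qed (intro definability)
  have T: "p \<in>\<^sub>M T x \<longleftrightarrow> (\<exists>y. y \<in>\<^sub>M B \<and> R x y \<and> p = opair x y)" for p x
    unfolding T_def by (rule mem_the_set[OF set])
  have "def_term (\<lambda>e. T (e 0))"
    unfolding T_def by (intro def_term_the_set set definability)
  note T_term [definability] = def_term_subst1[of T, OF this]
  have image: "Y \<in>\<^sub>M image_M T A \<longleftrightarrow> (\<exists>x. x \<in>\<^sub>M A \<and> Y = T x)" for Y
    by (rule mem_image) (intro definability)
  have "\<exists>c. \<forall>Y. Y \<in>\<^sub>M image_M T A \<longrightarrow> (\<exists>!z. z \<in>\<^sub>M Y \<and> z \<in>\<^sub>M c)"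
  proof (rule choice[rule_format])
    fix Y assume "Y \<in>\<^sub>M image_M T A"
    then show "\<exists>z. z \<in>\<^sub>M Y" unfolding image using ex T by metis
  next
    fix Y Z assume "Y \<in>\<^sub>M image_M T A" "Z \<in>\<^sub>M image_M T A" "Y \<noteq> Z"
    then obtain x y where "Y = T x" "Z = T y" "x \<noteq> y" unfolding image by blast
    then show "\<not> (\<exists>w. w \<in>\<^sub>M Y \<and> w \<in>\<^sub>M Z)" using T opair_inject by metis
  qed
  then obtain c where c: "\<And>x. x \<in>\<^sub>M A \<Longrightarrow> \<exists>!z. z \<in>\<^sub>M T x \<and> z \<in>\<^sub>M c"
    unfolding image by metis
  \<comment> \<open>The choice set may contain elements outside the family, which have to be
    removed.\<close>
  obtain f where f: "\<And>p. p \<in>\<^sub>M f \<longleftrightarrow> p \<in>\<^sub>M c \<and> (\<exists>x. x \<in>\<^sub>M A \<and> p \<in>\<^sub>M T x)"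
  proof -
    have "def_pred (\<lambda>e. \<exists>x. x \<in>\<^sub>M A \<and> e 0 \<in>\<^sub>M T x)" by (intro definability)
    from is_set_sep[OF this, of c] show ?thesis unfolding is_set_def by (elim exE) (rule that, erule spec)
  qed
  have mem: "opair x y \<in>\<^sub>M f \<longleftrightarrow> x \<in>\<^sub>M A \<and> opair x y \<in>\<^sub>M T x \<and> opair x y \<in>\<^sub>M c" for x y
    unfolding f T using opair_inject by metis
  have "is_function f A B"
    unfolding is_function_def
  proof (intro conjI allI impI)
    fix p assume "p \<in>\<^sub>M f"
    then show "\<exists>x y. x \<in>\<^sub>M A \<and> y \<in>\<^sub>M B \<and> p = opair x y" unfolding f T by metis
  next
    fix x assume x: "x \<in>\<^sub>M A"
    from c[OF x] obtain z where z: "z \<in>\<^sub>M T x" "z \<in>\<^sub>M c"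
      "\<And>z'. z' \<in>\<^sub>M T x \<Longrightarrow> z' \<in>\<^sub>M c \<Longrightarrow> z' = z" by metis
    obtain y where y: "z = opair x y" using z(1) T by metis
    show "\<exists>!y. opair x y \<in>\<^sub>M f"
    proof (rule ex1I[of _ y])
      show "opair x y \<in>\<^sub>M f" using x z(1,2) y mem by simp
      show "y' = y" if "opair x y' \<in>\<^sub>M f" for y'
        using that z(3)[of "opair x y'"] y mem by simp
    qed
  qed
  moreover from this have "R x (apply_M f x)" if "x \<in>\<^sub>M A" for x
    using is_function_mem[OF _ that] mem T opair_inject by metis
  ultimately show ?thesis by blast
qed

text \<open>The pairing function is \<open>2^n * (2 * m + 1)\<close>, with \<open>d\<close> the doubling function.\<close>

lemma omega_pairing:
  "\<exists>J. def_term (\<lambda>e. J (e 0) (e (Suc 0))) \<and>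
     (\<forall>n m. n \<in>\<^sub>M omega \<longrightarrow> m \<in>\<^sub>M omega \<longrightarrow> J n m \<in>\<^sub>M omega) \<and>
     (\<forall>n m n' m'. n \<in>\<^sub>M omega \<longrightarrow> m \<in>\<^sub>M omega \<longrightarrow> n' \<in>\<^sub>M omega \<longrightarrow> m' \<in>\<^sub>M omega \<longrightarrow>
        J n m = J n' m' \<longrightarrow> n = n' \<and> m = m')"
proof -
  have "def_term (\<lambda>e. succ (succ (e (Suc 0))))" by (intro definability)
  from omega_recursion[where G = "\<lambda>n x. succ (succ x)", OF this] obtain d where
    d: "def_term (\<lambda>e. d (e 0))" "d zero = zero"
      "\<And>n. n \<in>\<^sub>M omega \<Longrightarrow> d (succ n) = succ (succ (d n))" by blast
  note [definability] = def_term_subst1[of d, OF d(1)]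
  have d_omega: "d n \<in>\<^sub>M omega" if "n \<in>\<^sub>M omega" for n
  proof -
    have "def_pred (\<lambda>e. d (e 0) \<in>\<^sub>M omega)" by (intro definability)
    with that show ?thesis
      by (induction rule: omega_induct) (simp_all add: d zero_mem_omega succ_mem_omega)
  qed
  have d_inj: "\<forall>m. m \<in>\<^sub>M omega \<longrightarrow> d n = d m \<longrightarrow> n = m" if "n \<in>\<^sub>M omega" for n
  proof -
    have "def_pred (\<lambda>e. \<forall>m. m \<in>\<^sub>M omega \<longrightarrow> d (e 0) = d m \<longrightarrow> e 0 = m)" by (intro definability)
    with that show ?thesis
    proof (induction rule: omega_induct)
      case zero
      then show ?case using d by (metis omega_cases succ_not_zero(1))
    next
      case (succ n)
      then show ?case using d by (metis omega_cases succ_not_zero(1) succ_inject)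
    qed
  qed
  \<comment> \<open>Even differs from odd; this separates the exponent zero from positive exponents
    when two values of the pairing function are compared.\<close>
  have d_succ: "\<forall>m. m \<in>\<^sub>M omega \<longrightarrow> d n \<noteq> succ (d m)" if "n \<in>\<^sub>M omega" for n
  proof -
    have "def_pred (\<lambda>e. \<forall>m. m \<in>\<^sub>M omega \<longrightarrow> d (e 0) \<noteq> succ (d m))" by (intro definability)
    with that show ?thesis
    proof (induction rule: omega_induct)
      case zero
      then show ?case using d by (metis succ_not_zero(1))
    next
      case (succ n)
      show ?case
      proof (intro allI impI notI)
        fix m assume m: "m \<in>\<^sub>M omega" and eq: "d (succ n) = succ (d m)"
        then have eq: "succ (d n) = d m" using d(3) succ.hyps by simp
        from m show False
        proof (cases rule: omega_cases)
          case 1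
          then show False using eq d(2) by simp
        next
          case (2 k)
          then have "d n = succ (d k)" using eq d(3) by simp
          with succ.IH 2(1) show False by blast
        qed
      qed
    qed
  qed
  \<comment> \<open>Recursion on \<open>n\<close> yields one set for each \<open>n\<close>, so the
    whole map from \<open>m\<close> to 2^n * (2 * m + 1) is carried as the set \<open>E n\<close>
    and doubled pointwise.\<close>
  have "def_term (\<lambda>e. Lam omega (\<lambda>m. d (apply_M (e (Suc 0)) m)))" by (intro definability)
  from omega_recursion[where G = "\<lambda>n f. Lam omega (\<lambda>m. d (apply_M f m))" and
      a = "Lam omega (\<lambda>m. succ (d m))", OF this]
  obtain E where E: "def_term (\<lambda>e. E (e 0))" "E zero = Lam omega (\<lambda>m. succ (d m))"
    "\<And>n. n \<in>\<^sub>M omega \<Longrightarrow> E (succ n) = Lam omega (\<lambda>m. d (apply_M (E n) m))" by blast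
  note [definability] = def_term_subst1[of E, OF E(1)]
  define J where "J n m = apply_M (E n) m" for n m
  have J_def_term: "def_term (\<lambda>e. J (e 0) (e (Suc 0)))" unfolding J_def by (intro definability)
  note [definability] = def_term_subst2[of J, OF J_def_term]
  have "def_term (\<lambda>e. succ (d (e 0)))" by (intro definability)
  from apply_Lam[OF this] have J_zero: "J zero m = succ (d m)" if "m \<in>\<^sub>M omega" for m
    using that E(2) by (simp add: J_def)
  have J_succ: "J (succ n) m = d (J n m)" if "n \<in>\<^sub>M omega" "m \<in>\<^sub>M omega" for n m
  proof -
    have "def_term (\<lambda>e. d (apply_M (E n) (e 0)))" by (intro definability)
    from apply_Lam[OF this that(2)] show ?thesis using E(3)[OF that(1)] by (simp add: J_def)
  qed
  have J_omega: "\<forall>m. m \<in>\<^sub>M omega \<longrightarrow> J n m \<in>\<^sub>M omega" if "n \<in>\<^sub>M omega" for n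
  proof -
    have "def_pred (\<lambda>e. \<forall>m. m \<in>\<^sub>M omega \<longrightarrow> J (e 0) m \<in>\<^sub>M omega)" by (intro definability)
    with that show ?thesis
      by (induction rule: omega_induct) (simp_all add: J_zero J_succ d_omega succ_mem_omega)
  qed
  have J_inj: "\<forall>m n' m'. m \<in>\<^sub>M omega \<longrightarrow> n' \<in>\<^sub>M omega \<longrightarrow> m' \<in>\<^sub>M omega \<longrightarrow> J n m = J n' m' \<longrightarrow> n = n' \<and> m = m'"
    if "n \<in>\<^sub>M omega" for n
  proof -
    have "def_pred (\<lambda>e. \<forall>m n' m'. m \<in>\<^sub>M omega \<longrightarrow> n' \<in>\<^sub>M omega \<longrightarrow> m' \<in>\<^sub>M omega \<longrightarrow>
        J (e 0) m = J n' m' \<longrightarrow> e 0 = n' \<and> m = m')" by (intro definability)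
    with that show ?thesis
    proof (induction rule: omega_induct)
      case zero
      show ?case
      proof (intro allI impI)
        fix m n' m' assume *: "m \<in>\<^sub>M omega" "n' \<in>\<^sub>M omega" "m' \<in>\<^sub>M omega" "J zero m = J n' m'"
        from *(2) show "zero = n' \<and> m = m'"
        proof (cases rule: omega_cases)
          case 1
          with * show ?thesis using d_inj by (simp add: J_zero)
        next
          case (2 k)
          have "d (J k m') = succ (d m)"
            using *(4) J_succ[OF 2(1) *(3)] J_zero[OF *(1)] 2(2) by simp
          then show ?thesis using d_succ J_omega[rule_format, OF 2(1) *(3)] *(1) by blast
        qed
      qed
    next
      case (succ n)
      show ?case
      proof (intro allI impI)
        fix m n' m' assume *: "m \<in>\<^sub>M omega" "n' \<in>\<^sub>M omega" "m' \<in>\<^sub>M omega" "J (succ n) m = J n' m'"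
        from *(2) show "succ n = n' \<and> m = m'"
        proof (cases rule: omega_cases)
          case 1
          have "d (J n m) = succ (d m')"
            using *(4) J_succ[OF succ.hyps *(1)] J_zero[OF *(3)] 1 by simp
          then show ?thesis using d_succ J_omega[rule_format, OF succ.hyps *(1)] *(3) by blast
        next
          case (2 k)
          have "d (J n m) = d (J k m')"
            using *(4) J_succ[OF succ.hyps *(1)] J_succ[OF 2(1) *(3)] 2(2) by simp
          then have "J n m = J k m'"
            using d_inj J_omega[rule_format, OF succ.hyps *(1)] J_omega[rule_format, OF 2(1) *(3)] by blast
          with * 2 show ?thesis using succ.IH by simp
        qed
      qed
    qed
  qed
  show ?thesis using J_def_term J_omega J_inj by blast
qed

text \<open>Choose for each member of \<open>A\<close> an injection into \<open>omega\<close>, and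
  for each element of the union a member containing it. The element is then coded by the index of
  that member paired with its own index there.\<close>

lemma countable_set_Union:
  assumes "countable_set A" "\<And>X. X \<in>\<^sub>M A \<Longrightarrow> countable_set X"
  shows "countable_set (Union_M A)"
proof -
  obtain i where i: "is_function i A omega" "injective i A" using assms(1) countable_set_iff by blast
  let ?B = "Pow_M (Pow_M (Pow_M (Union_M (upair (Union_M A) omega))))"
  have "\<exists>j. is_function j A ?B \<and>
      (\<forall>X. X \<in>\<^sub>M A \<longrightarrow> is_function (apply_M j X) X omega \<and> injective (apply_M j X) X)"
  proof (rule choice_function[where R = "\<lambda>X g. is_function g X omega \<and> injective g X"])
    fix X assume X: "X \<in>\<^sub>M A"
    then obtain g where "is_function g X omega" "injective g X" using assms(2) countable_set_iff by blast
    moreover have "X \<subseteq>\<^sub>M Union_M A" using X by (auto simp: subset_M_def mem_Union)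
    ultimately show "\<exists>g. g \<in>\<^sub>M ?B \<and> is_function g X omega \<and> injective g X"
      using function_mem_Pow by blast
  qed (intro definability)
  then obtain j where j: "\<And>X. X \<in>\<^sub>M A \<Longrightarrow> is_function (apply_M j X) X omega"
    "\<And>X. X \<in>\<^sub>M A \<Longrightarrow> injective (apply_M j X) X" by blast
  have "\<exists>c. is_function c (Union_M A) A \<and> (\<forall>x. x \<in>\<^sub>M Union_M A \<longrightarrow> x \<in>\<^sub>M apply_M c x)"
    by (rule choice_function[where R = "(\<in>\<^sub>M)"]) (intro definability, auto simp: mem_Union)
  then obtain c where c: "is_function c (Union_M A) A" "\<And>x. x \<in>\<^sub>M Union_M A \<Longrightarrow> x \<in>\<^sub>M apply_M c x"
    by blast
  obtain J where J: "def_term (\<lambda>e. J (e 0) (e (Suc 0)))"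
    "\<And>n m. n \<in>\<^sub>M omega \<Longrightarrow> m \<in>\<^sub>M omega \<Longrightarrow> J n m \<in>\<^sub>M omega"
    "\<And>n m n' m'. n \<in>\<^sub>M omega \<Longrightarrow> m \<in>\<^sub>M omega \<Longrightarrow> n' \<in>\<^sub>M omega \<Longrightarrow> m' \<in>\<^sub>M omega \<Longrightarrow>
        J n m = J n' m' \<Longrightarrow> n = n' \<and> m = m'" using omega_pairing by blast
  note [definability] = def_term_subst2[of J, OF J(1)]
  have cA: "apply_M c x \<in>\<^sub>M A" if "x \<in>\<^sub>M Union_M A" for x using is_function_type[OF c(1) that] .
  have i': "apply_M i (apply_M c x) \<in>\<^sub>M omega" if "x \<in>\<^sub>M Union_M A" for x
    using is_function_type[OF i(1) cA[OF that]] .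
  have j': "apply_M (apply_M j (apply_M c x)) x \<in>\<^sub>M omega" if "x \<in>\<^sub>M Union_M A" for x
    using is_function_type[OF j(1)[OF cA[OF that]] c(2)[OF that]] .
  show ?thesis
  proof (rule countable_setI[where F = "\<lambda>x. J (apply_M i (apply_M c x)) (apply_M (apply_M j (apply_M c x)) x)"])
    fix x y assume x: "x \<in>\<^sub>M Union_M A" and y: "y \<in>\<^sub>M Union_M A"
      and eq: "J (apply_M i (apply_M c x)) (apply_M (apply_M j (apply_M c x)) x) =
        J (apply_M i (apply_M c y)) (apply_M (apply_M j (apply_M c y)) y)"
    from J(3)[OF i'[OF x] j'[OF x] i'[OF y] j'[OF y] eq]
    have *: "apply_M i (apply_M c x) = apply_M i (apply_M c y)"
      "apply_M (apply_M j (apply_M c x)) x = apply_M (apply_M j (apply_M c y)) y" by blast+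
    then have "apply_M c x = apply_M c y" using i(2) cA x y unfolding injective_def by blast
    with *(2) show "x = y" using j(2)[OF cA[OF x]] c(2)[OF x] c(2)[OF y] unfolding injective_def by simp
  qed (intro definability, simp add: J(2) i' j')
qed

lemma countable_set_image:
  assumes "def_term (\<lambda>e. F (e 0))" "countable_set A"
  shows "countable_set (image_M F A)"
proof -
  note [definability] = def_term_subst1[of F, OF assms(1)]
  note image = mem_image[OF assms(1)]
  obtain i where i: "is_function i A omega" "injective i A" using assms(2) countable_set_iff by blast
  have "\<exists>c. is_function c (image_M F A) A \<and> (\<forall>y. y \<in>\<^sub>M image_M F A \<longrightarrow> y = F (apply_M c y))"
    by (rule choice_function[where R = "\<lambda>y x. y = F x"]) (intro definability, auto simp: image)
  then obtain c where c: "is_function c (image_M F A) A"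
    "\<And>y. y \<in>\<^sub>M image_M F A \<Longrightarrow> y = F (apply_M c y)" by blast
  show ?thesis
  proof (rule countable_setI[where F = "\<lambda>y. apply_M i (apply_M c y)"])
    show "x = y" if "x \<in>\<^sub>M image_M F A" "y \<in>\<^sub>M image_M F A"
      "apply_M i (apply_M c x) = apply_M i (apply_M c y)" for x y
      using that i(2) c(2) is_function_type[OF c(1)] unfolding injective_def by metis
  qed (intro definability, simp add: is_function_type[OF i(1)] is_function_type[OF c(1)])
qed

lemma countable_set_succ:
  assumes "countable_set \<alpha>"
  shows "countable_set (succ \<alpha>)"
proof -
  obtain i where i: "is_function i \<alpha> omega" "injective i \<alpha>" using assms countable_set_iff by blast
  show ?thesis
  proof (rule countable_setI[where F = "\<lambda>x. if x = \<alpha> then zero else succ (apply_M i x)"])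
    show "def_term (\<lambda>e. if e 0 = \<alpha> then zero else succ (apply_M i (e 0)))" by (intro definability)
    show "(if x = \<alpha> then zero else succ (apply_M i x)) \<in>\<^sub>M omega" if "x \<in>\<^sub>M succ \<alpha>" for x
      using that is_function_type[OF i(1)] by (auto intro: zero_mem_omega succ_mem_omega)
    show "x = y" if "x \<in>\<^sub>M succ \<alpha>" "y \<in>\<^sub>M succ \<alpha>"
      "(if x = \<alpha> then zero else succ (apply_M i x)) = (if y = \<alpha> then zero else succ (apply_M i y))" for x y
      using that i(2) unfolding injective_def by (auto split: if_splits)
  qed
qed

text \<open>A countable ordinal is determined by the relation that any injection into \<open>omega\<close> transports
  to \<open>omega\<close>, so the countable ordinals form a set (Hartogs).\<close>

lemma transported_order_unique:
  assumes "ordinal \<alpha>" "ordinal \<alpha>'" "injective f \<alpha>" "injective g \<alpha>'"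
    and f: "\<And>p. p \<in>\<^sub>M r \<longleftrightarrow> (\<exists>\<beta> \<gamma>. \<gamma> \<in>\<^sub>M \<alpha> \<and> \<beta> \<in>\<^sub>M succ \<gamma> \<and> p = opair (apply_M f \<beta>) (apply_M f \<gamma>))"
    and g: "\<And>p. p \<in>\<^sub>M r \<longleftrightarrow> (\<exists>\<beta> \<gamma>. \<gamma> \<in>\<^sub>M \<alpha>' \<and> \<beta> \<in>\<^sub>M succ \<gamma> \<and> p = opair (apply_M g \<beta>) (apply_M g \<gamma>))"
  shows "\<alpha> = \<alpha>'"
proof -
  have injf: "\<beta> = \<gamma>" if "\<beta> \<in>\<^sub>M \<alpha>" "\<gamma> \<in>\<^sub>M \<alpha>" "apply_M f \<beta> = apply_M f \<gamma>" for \<beta> \<gamma>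
    using assms(3) that unfolding injective_def by blast
  have injg: "\<beta> = \<gamma>" if "\<beta> \<in>\<^sub>M \<alpha>'" "\<gamma> \<in>\<^sub>M \<alpha>'" "apply_M g \<beta> = apply_M g \<gamma>" for \<beta> \<gamma>
    using assms(4) that unfolding injective_def by blast
  have eq: "\<beta> \<in>\<^sub>M \<alpha> \<longrightarrow> (\<forall>\<beta>'. \<beta>' \<in>\<^sub>M \<alpha>' \<longrightarrow> apply_M f \<beta> = apply_M g \<beta>' \<longrightarrow> \<beta> = \<beta>')" if "ordinal \<beta>" for \<beta>
  proof -
    have "def_pred (\<lambda>e. e 0 \<in>\<^sub>M \<alpha> \<longrightarrow> (\<forall>\<beta>'. \<beta>' \<in>\<^sub>M \<alpha>' \<longrightarrow> apply_M f (e 0) = apply_M g \<beta>' \<longrightarrow> e 0 = \<beta>'))"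
      by (intro definability)
    with that show ?thesis
    proof (induction rule: ordinal_induct)
      case (step \<beta>)
      show ?case
      proof (intro impI allI)
        fix \<beta>' assume \<beta>: "\<beta> \<in>\<^sub>M \<alpha>" and \<beta>': "\<beta>' \<in>\<^sub>M \<alpha>'" and fg: "apply_M f \<beta> = apply_M g \<beta>'"
        show "\<beta> = \<beta>'"
        proof (rule set_ext, rule iffI)
          fix \<gamma> assume \<gamma>: "\<gamma> \<in>\<^sub>M \<beta>"
          then have \<gamma>\<alpha>: "\<gamma> \<in>\<^sub>M \<alpha>" using \<beta> ordinal_trans assms(1) by blast
          have "opair (apply_M f \<gamma>) (apply_M f \<beta>) \<in>\<^sub>M r"
            unfolding f using \<beta> \<gamma> mem_succ by blast
          then obtain \<delta> \<delta>' where d: "\<delta>' \<in>\<^sub>M \<alpha>'" "\<delta> \<in>\<^sub>M succ \<delta>'" "apply_M f \<gamma> = apply_M g \<delta>"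
            "apply_M f \<beta> = apply_M g \<delta>'" unfolding g by (metis opair_inject)
          then have d': "\<delta>' = \<beta>'" using injg \<beta>' fg by metis
          then have "\<delta> \<in>\<^sub>M \<alpha>'" using d(2) \<beta>' ordinal_trans[OF assms(2)] by auto
          then have "\<gamma> = \<delta>" using step.IH[OF \<gamma>] \<gamma>\<alpha> d(3) by blast
          moreover have "\<delta> \<noteq> \<beta>'" using \<gamma> \<gamma>\<alpha> \<beta> fg d(3) injf mem_irrefl by metis
          ultimately show "\<gamma> \<in>\<^sub>M \<beta>'" using d(2) d' by simp
        next
          fix \<delta> assume \<delta>: "\<delta> \<in>\<^sub>M \<beta>'"
          then have \<delta>\<alpha>: "\<delta> \<in>\<^sub>M \<alpha>'" using \<beta>' ordinal_trans assms(2) by blast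
          have "opair (apply_M g \<delta>) (apply_M g \<beta>') \<in>\<^sub>M r"
            unfolding g using \<beta>' \<delta> mem_succ by blast
          then obtain \<gamma> \<gamma>' where d: "\<gamma>' \<in>\<^sub>M \<alpha>" "\<gamma> \<in>\<^sub>M succ \<gamma>'" "apply_M g \<delta> = apply_M f \<gamma>"
            "apply_M g \<beta>' = apply_M f \<gamma>'" unfolding f by (metis opair_inject)
          then have d': "\<gamma>' = \<beta>" using injf \<beta> fg by metis
          moreover have "\<gamma> \<noteq> \<beta>" using \<delta> \<delta>\<alpha> \<beta>' fg d(3) injg mem_irrefl by metis
          ultimately have "\<gamma> \<in>\<^sub>M \<beta>" using d(2) by simp
          moreover from this have "\<gamma> \<in>\<^sub>M \<alpha>" using \<beta> ordinal_trans assms(1) by blast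
          ultimately show "\<delta> \<in>\<^sub>M \<beta>" using step.IH \<delta>\<alpha> d(3) by metis
        qed
      qed
    qed
  qed
  \<comment> \<open>The transported order is reflexive so that the range of the injection can be
    read off \<open>r\<close>: the strict orders on the ordinals 0 and 1 are both empty.\<close>
  have range: "\<exists>\<beta>'. \<beta>' \<in>\<^sub>M \<alpha>' \<and> apply_M f \<beta> = apply_M g \<beta>'" if "\<beta> \<in>\<^sub>M \<alpha>" for \<beta>
  proof -
    have "opair (apply_M f \<beta>) (apply_M f \<beta>) \<in>\<^sub>M r" unfolding f using that mem_succ by blast
    then show ?thesis unfolding g by (metis opair_inject)
  qed
  have range': "\<exists>\<beta>. \<beta> \<in>\<^sub>M \<alpha> \<and> apply_M f \<beta> = apply_M g \<beta>'" if "\<beta>' \<in>\<^sub>M \<alpha>'" for \<beta>'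
  proof -
    have "opair (apply_M g \<beta>') (apply_M g \<beta>') \<in>\<^sub>M r" unfolding g using that mem_succ by blast
    then show ?thesis unfolding f by (metis opair_inject)
  qed
  show ?thesis
    by (rule set_ext) (metis range range' eq ordinal_mem assms(1))
qed

text \<open>Replacement is applied to the binary relations on \<open>omega\<close>, each of which is
  the transported order of at most one ordinal.\<close>

lemma is_set_countable_ordinals: "is_set (\<lambda>\<alpha>. ordinal \<alpha> \<and> countable_set \<alpha>)"
proof -
  define R where "R r \<alpha> \<longleftrightarrow> ordinal \<alpha> \<and> (\<exists>f. is_function f \<alpha> omega \<and> injective f \<alpha> \<and>
    (\<forall>p. p \<in>\<^sub>M r \<longleftrightarrow> (\<exists>\<beta> \<gamma>. \<gamma> \<in>\<^sub>M \<alpha> \<and> \<beta> \<in>\<^sub>M succ \<gamma> \<and> p = opair (apply_M f \<beta>) (apply_M f \<gamma>))))" for r \<alpha>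
  let ?A = "Pow_M (Pow_M (Pow_M (Union_M (upair omega omega))))"
  have "is_set (\<lambda>\<alpha>. \<exists>r. r \<in>\<^sub>M ?A \<and> R r \<alpha>)"
  proof (rule is_set_replace)
    show "def_pred (\<lambda>e. R (e 0) (e (Suc 0)))" unfolding R_def by (intro definability)
    fix r \<alpha> \<alpha>' assume "R r \<alpha>" "R r \<alpha>'"
    then show "\<alpha> = \<alpha>'"
      unfolding R_def
      by (elim conjE exE) (rule transported_order_unique[of \<alpha> \<alpha>'], assumption+, (rule spec, assumption)+)
  qed
  moreover have "(\<exists>r. r \<in>\<^sub>M ?A \<and> R r \<alpha>) \<longleftrightarrow> ordinal \<alpha> \<and> countable_set \<alpha>" for \<alpha>
  proof
    show "ordinal \<alpha> \<and> countable_set \<alpha>" if "\<exists>r. r \<in>\<^sub>M ?A \<and> R r \<alpha>"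
      using that unfolding R_def countable_set_iff by blast
  next
    assume \<alpha>: "ordinal \<alpha> \<and> countable_set \<alpha>"
    then obtain f where f: "is_function f \<alpha> omega" "injective f \<alpha>" using countable_set_iff by blast
    define P where "P p \<longleftrightarrow> (\<exists>\<beta> \<gamma>. \<gamma> \<in>\<^sub>M \<alpha> \<and> \<beta> \<in>\<^sub>M succ \<gamma> \<and> p = opair (apply_M f \<beta>) (apply_M f \<gamma>))" for p
    have sub: "p \<in>\<^sub>M Pow_M (Pow_M (Union_M (upair omega omega)))" if p: "P p" for p
    proof -
      obtain \<beta> \<gamma> where "\<gamma> \<in>\<^sub>M \<alpha>" "\<beta> \<in>\<^sub>M succ \<gamma>" "p = opair (apply_M f \<beta>) (apply_M f \<gamma>)"
        using p unfolding P_def by blast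
      moreover from this have "\<beta> \<in>\<^sub>M \<alpha>" using \<alpha> ordinal_trans by auto
      ultimately show ?thesis using opair_mem_product is_function_type[OF f(1)] by metis
    qed
    have "is_set P"
      by (rule is_set_subset[OF _ sub]) (unfold P_def, intro definability)
    then obtain r where r: "\<And>p. p \<in>\<^sub>M r \<longleftrightarrow> P p" unfolding is_set_def by blast
    then have "r \<in>\<^sub>M ?A" using sub by (simp add: subset_M_def)
    moreover have "R r \<alpha>" using \<alpha> f r unfolding R_def P_def by blast
    ultimately show "\<exists>r. r \<in>\<^sub>M ?A \<and> R r \<alpha>" by blast
  qed
  ultimately show ?thesis by simp
qed

section \<open>The first uncountable ordinal and its closure points\<close>

text \<open>The set of countable ordinals is itself an ordinal, and if it were countable it would be
  its own element.\<close>

lemma ordinal_omega1: "ordinal omega1"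
  and mem_omega1_iff: "\<alpha> \<in>\<^sub>M omega1 \<longleftrightarrow> ordinal \<alpha> \<and> countable_set \<alpha>"
  and uncountable_omega1: "\<not> countable_set omega1"
proof -
  obtain W where W: "\<And>\<alpha>. \<alpha> \<in>\<^sub>M W \<longleftrightarrow> ordinal \<alpha> \<and> countable_set \<alpha>"
    using is_set_countable_ordinals unfolding is_set_def by meson
  have "ordinal W"
  proof (rule ordinalI)
    fix \<beta> \<gamma> assume "\<beta> \<in>\<^sub>M W" "\<gamma> \<in>\<^sub>M \<beta>"
    then have "ordinal \<beta>" "countable_set \<beta>" "ordinal \<gamma>" using W ordinal_mem by blast+
    moreover have "\<gamma> \<subseteq>\<^sub>M \<beta>" using \<open>\<gamma> \<in>\<^sub>M \<beta>\<close> calculation ordinal_subset_iff by blast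
    ultimately show "\<gamma> \<in>\<^sub>M W" using W countable_set_subset by blast
  qed (use W in blast)
  moreover have "\<not> countable_set W" using W calculation mem_irrefl by blast
  moreover have "omega1 = W"
    unfolding omega1_def
  proof (rule the_equality)
    fix \<alpha> assume "ordinal \<alpha> \<and> \<not> countable_set \<alpha> \<and> (\<forall>\<beta>. \<beta> \<in>\<^sub>M \<alpha> \<longrightarrow> countable_set \<beta>)"
    then show "\<alpha> = W" using W calculation ordinal_linear[of \<alpha> W] by blast
  qed (use W calculation in blast)
  ultimately show "ordinal omega1" "\<alpha> \<in>\<^sub>M omega1 \<longleftrightarrow> ordinal \<alpha> \<and> countable_set \<alpha>"
    "\<not> countable_set omega1" using W by simp_all
qed

lemma succ_mem_omega1: "\<alpha> \<in>\<^sub>M omega1 \<Longrightarrow> succ \<alpha> \<in>\<^sub>M omega1"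
  by (simp add: mem_omega1_iff ordinal_succ countable_set_succ)

lemma omega1_trans: "\<alpha> \<in>\<^sub>M omega1 \<Longrightarrow> \<beta> \<in>\<^sub>M \<alpha> \<Longrightarrow> \<beta> \<in>\<^sub>M omega1"
  using ordinal_trans ordinal_omega1 by blast

lemma omega1_subset: "\<alpha> \<in>\<^sub>M omega1 \<Longrightarrow> \<alpha> \<subseteq>\<^sub>M omega1"
  using omega1_trans unfolding subset_M_def by blast

lemma omega_mem_omega1: "omega \<in>\<^sub>M omega1"
  by (simp add: mem_omega1_iff ordinal_omega countable_omega)

lemma zero_mem_omega1: "zero \<in>\<^sub>M omega1"
  using omega_mem_omega1 zero_mem_omega omega1_trans by blast

text \<open>Regularity of \<open>omega1\<close>; it rests on choice through
  \<open>countable_set_Union\<close>.\<close>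

lemma omega1_sup:
  assumes "def_term (\<lambda>e. F (e 0))" "countable_set A" "\<And>x. x \<in>\<^sub>M A \<Longrightarrow> F x \<in>\<^sub>M omega1"
  shows "Union_M (image_M F A) \<in>\<^sub>M omega1"
  unfolding mem_omega1_iff
proof
  show "ordinal (Union_M (image_M F A))"
    by (rule ordinal_Union) (use assms(3) mem_omega1_iff in \<open>auto simp: mem_image[OF assms(1)]\<close>)
  show "countable_set (Union_M (image_M F A))"
    by (rule countable_set_Union[OF countable_set_image[OF assms(1,2)]])
       (use assms(3) mem_omega1_iff in \<open>auto simp: mem_image[OF assms(1)]\<close>)
qed

text \<open>\<open>D (succ n)\<close> exceeds all values of \<open>f\<close> on \<open>D n\<close>.
  The stages need not increase, but each element of their union lies in some stage, and its image
  under \<open>f\<close> lies in the next.\<close>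

lemma closed_under_unbounded:
  assumes f: "is_function f omega1 omega1" and \<beta>: "\<beta> \<in>\<^sub>M omega1"
  shows "\<exists>\<delta>. \<delta> \<in>\<^sub>M omega1 \<and> \<beta> \<in>\<^sub>M \<delta> \<and> closed_under f \<delta>"
proof -
  let ?G = "\<lambda>x. Union_M (image_M (\<lambda>\<alpha>. succ (apply_M f \<alpha>)) x)"
  have "def_term (\<lambda>e. ?G (e (Suc 0)))" by (intro definability)
  from omega_recursion[where G = "\<lambda>n. ?G" and a = "succ \<beta>", OF this]
  obtain D where D: "def_term (\<lambda>e. D (e 0))" "D zero = succ \<beta>"
    "\<And>n. n \<in>\<^sub>M omega \<Longrightarrow> D (succ n) = ?G (D n)" by blast
  note [definability] = def_term_subst1[of D, OF D(1)]
  have step: "def_term (\<lambda>e. succ (apply_M f (e 0)))" by (intro definability)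
  have D\<omega>: "D n \<in>\<^sub>M omega1" if "n \<in>\<^sub>M omega" for n
  proof -
    have "def_pred (\<lambda>e. D (e 0) \<in>\<^sub>M omega1)" by (intro definability)
    with that show ?thesis
    proof (induction rule: omega_induct)
      case zero
      show ?case using D(2) \<beta> succ_mem_omega1 by simp
    next
      case (succ n)
      have "?G (D n) \<in>\<^sub>M omega1"
      proof (rule omega1_sup[OF step])
        show "countable_set (D n)" using succ.IH mem_omega1_iff by blast
      qed (intro succ_mem_omega1 is_function_type[OF f] omega1_trans[OF succ.IH])
      then show ?case using D(3)[OF succ.hyps] by simp
    qed
  qed
  define \<delta> where "\<delta> = Union_M (image_M D omega)"
  have \<delta>: "\<alpha> \<in>\<^sub>M \<delta> \<longleftrightarrow> (\<exists>n. n \<in>\<^sub>M omega \<and> \<alpha> \<in>\<^sub>M D n)" for \<alpha>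
    unfolding \<delta>_def mem_Union mem_image[OF D(1)] by blast
  have \<delta>\<omega>: "\<delta> \<in>\<^sub>M omega1"
    unfolding \<delta>_def using D\<omega> by (intro omega1_sup[OF D(1) countable_omega])
  moreover have \<beta>\<delta>: "\<beta> \<in>\<^sub>M \<delta>"
    unfolding \<delta> using D(2) zero_mem_omega by (intro exI[of _ zero]) simp
  moreover have "apply_M f \<alpha> \<in>\<^sub>M \<delta>" if "\<alpha> \<in>\<^sub>M \<delta>" for \<alpha>
  proof -
    obtain n where n: "n \<in>\<^sub>M omega" "\<alpha> \<in>\<^sub>M D n" using \<open>\<alpha> \<in>\<^sub>M \<delta>\<close> \<delta> by blast
    then have "apply_M f \<alpha> \<in>\<^sub>M D (succ n)"
      unfolding D(3)[OF n(1)] mem_Union mem_image[OF step] using mem_succ by blast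
    then show ?thesis unfolding \<delta> using succ_mem_omega[OF n(1)] by blast
  qed
  moreover have "zero \<in>\<^sub>M \<delta>"
  proof -
    have "ordinal \<delta>" using \<delta>\<omega> mem_omega1_iff by blast
    then show ?thesis using ordinal_linear[OF ordinal_zero] \<beta>\<delta> mem_zero by blast
  qed
  ultimately show ?thesis unfolding closed_under_def by blast
qed

text \<open>Ulam's matrix: fix injections \<open>apply_M E \<alpha>\<close> from \<open>\<alpha>\<close> into \<open>omega\<close>. For every \<open>\<beta>\<close> some level set
  \<open>{\<delta>. \<beta> < \<delta> \<and> apply_M E \<delta> \<beta> = n}\<close> is stationary, and two values of \<open>\<beta>\<close> share the same \<open>n\<close>.\<close>

lemma bistationary_exists:
  "\<exists>X. X \<subseteq>\<^sub>M omega1 \<and> bistationary (\<lambda>\<delta>. \<delta> \<in>\<^sub>M X)"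
proof -
  let ?B = "Pow_M (Pow_M (Pow_M (Union_M (upair omega1 omega))))"
  have "\<exists>E. is_function E omega1 ?B \<and>
      (\<forall>\<alpha>. \<alpha> \<in>\<^sub>M omega1 \<longrightarrow> is_function (apply_M E \<alpha>) \<alpha> omega \<and> injective (apply_M E \<alpha>) \<alpha>)"
  proof (rule choice_function[where R = "\<lambda>\<alpha> g. is_function g \<alpha> omega \<and> injective g \<alpha>"])
    fix \<alpha> assume "\<alpha> \<in>\<^sub>M omega1"
    then show "\<exists>g. g \<in>\<^sub>M ?B \<and> is_function g \<alpha> omega \<and> injective g \<alpha>"
      using function_mem_Pow omega1_subset mem_omega1_iff countable_set_iff by metis
  qed (intro definability)
  then obtain E where E: "\<And>\<alpha>. \<alpha> \<in>\<^sub>M omega1 \<Longrightarrow> is_function (apply_M E \<alpha>) \<alpha> omega"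
    "\<And>\<alpha>. \<alpha> \<in>\<^sub>M omega1 \<Longrightarrow> injective (apply_M E \<alpha>) \<alpha>" by blast
  define U where "U \<beta> n \<delta> \<longleftrightarrow> \<beta> \<in>\<^sub>M \<delta> \<and> apply_M (apply_M E \<delta>) \<beta> = n" for \<beta> n \<delta>
  have U: "def_pred (\<lambda>e. U (e 0) (e (Suc 0)) (e (Suc (Suc 0))))"
    unfolding U_def by (intro definability)
  note [definability] = def_pred_subst3[of U, OF U]
  define S where "S \<beta> n \<longleftrightarrow> (\<forall>f. is_function f omega1 omega1 \<longrightarrow>
      (\<exists>\<delta>. \<delta> \<in>\<^sub>M omega1 \<and> closed_under f \<delta> \<and> U \<beta> n \<delta>))" for \<beta> n
  have S: "\<exists>n. n \<in>\<^sub>M omega \<and> S \<beta> n" if \<beta>: "\<beta> \<in>\<^sub>M omega1" for \<beta>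
  proof (rule ccontr)
    assume *: "\<not> (\<exists>n. n \<in>\<^sub>M omega \<and> S \<beta> n)"
    have "\<exists>F. is_function F omega (function_set omega1 omega1) \<and>
        (\<forall>n. n \<in>\<^sub>M omega \<longrightarrow> (\<forall>\<delta>. \<delta> \<in>\<^sub>M omega1 \<longrightarrow> closed_under (apply_M F n) \<delta> \<longrightarrow> \<not> U \<beta> n \<delta>))"
    proof (rule choice_function[where R = "\<lambda>n f. \<forall>\<delta>. \<delta> \<in>\<^sub>M omega1 \<longrightarrow> closed_under f \<delta> \<longrightarrow> \<not> U \<beta> n \<delta>"])
      show "\<exists>f. f \<in>\<^sub>M function_set omega1 omega1 \<and>
          (\<forall>\<delta>. \<delta> \<in>\<^sub>M omega1 \<longrightarrow> closed_under f \<delta> \<longrightarrow> \<not> U \<beta> n \<delta>)" if "n \<in>\<^sub>M omega" for n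
        using * that unfolding S_def mem_function_set by blast
    qed (intro definability)
    then obtain F where F: "\<And>n. n \<in>\<^sub>M omega \<Longrightarrow> is_function (apply_M F n) omega1 omega1"
      "\<And>n \<delta>. n \<in>\<^sub>M omega \<Longrightarrow> \<delta> \<in>\<^sub>M omega1 \<Longrightarrow> closed_under (apply_M F n) \<delta> \<Longrightarrow> \<not> U \<beta> n \<delta>"
      using is_function_type mem_function_set by metis
    \<comment> \<open>If no level were stationary, each \<open>n\<close> would have a function
      \<open>apply_M F n\<close> none of whose closure points lie in level \<open>n\<close>. An
      ordinal \<delta> closed under \<open>h\<close> is closed under all of them at once, because
      \<open>h \<alpha>\<close> exceeds each of their values at \<alpha>. Taking \<delta> above
      \<beta> puts it into the level of its own \<open>n\<close>.\<close>
    define h where "h \<alpha> = Union_M (image_M (\<lambda>n. succ (apply_M (apply_M F n) \<alpha>)) omega)" for \<alpha>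
    have h_term: "def_term (\<lambda>e. h (e 0))" unfolding h_def by (intro definability)
    have h: "x \<in>\<^sub>M h \<alpha> \<longleftrightarrow> (\<exists>n. n \<in>\<^sub>M omega \<and> x \<in>\<^sub>M succ (apply_M (apply_M F n) \<alpha>))" for x \<alpha>
    proof -
      have "def_term (\<lambda>e. succ (apply_M (apply_M F (e 0)) \<alpha>))" by (intro definability)
      then show ?thesis unfolding h_def mem_Union by (auto simp: mem_image simp del: mem_succ)
    qed
    have "h \<alpha> \<in>\<^sub>M omega1" if "\<alpha> \<in>\<^sub>M omega1" for \<alpha>
      unfolding h_def
      by (intro omega1_sup countable_omega definability succ_mem_omega1 is_function_type[OF F(1)] that)
    then have "is_function (Lam omega1 h) omega1 omega1" by (rule Lam_function[OF h_term])
    from closed_under_unbounded[OF this \<beta>] obtain \<delta> where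
      \<delta>: "\<delta> \<in>\<^sub>M omega1" "\<beta> \<in>\<^sub>M \<delta>" "closed_under (Lam omega1 h) \<delta>" by blast
    define n where "n = apply_M (apply_M E \<delta>) \<beta>"
    have n: "n \<in>\<^sub>M omega" unfolding n_def using is_function_type[OF E(1)[OF \<delta>(1)] \<delta>(2)] .
    have "apply_M (apply_M F n) \<alpha> \<in>\<^sub>M \<delta>" if \<alpha>: "\<alpha> \<in>\<^sub>M \<delta>" for \<alpha>
    proof -
      have "h \<alpha> \<in>\<^sub>M \<delta>"
        using \<delta>(3) \<alpha> apply_Lam[OF h_term omega1_trans[OF \<delta>(1) \<alpha>]] unfolding closed_under_def by metis
      moreover have "apply_M (apply_M F n) \<alpha> \<in>\<^sub>M h \<alpha>" unfolding h using n mem_succ by blast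
      ultimately show ?thesis using ordinal_trans \<delta>(1) mem_omega1_iff by blast
    qed
    then have "closed_under (apply_M F n) \<delta>" using \<delta>(3) unfolding closed_under_def by blast
    with F(2)[OF n \<delta>(1)] \<delta>(2) show False unfolding U_def n_def by blast
  qed
  have "def_pred (\<lambda>e. S (e 0) (e (Suc 0)))" unfolding S_def by (intro definability)
  from choice_function[OF this S] obtain N where
    N: "is_function N omega1 omega" "\<And>\<beta>. \<beta> \<in>\<^sub>M omega1 \<Longrightarrow> S \<beta> (apply_M N \<beta>)" by blast
  \<comment> \<open>Pigeonhole: there are uncountably many \<beta> and only countably many
    levels.\<close>
  then have "\<not> injective N omega1" using uncountable_omega1 countable_set_iff by blast
  then obtain \<beta> \<beta>' where \<beta>: "\<beta> \<in>\<^sub>M omega1" "\<beta>' \<in>\<^sub>M omega1" "apply_M N \<beta> = apply_M N \<beta>'" "\<beta> \<noteq> \<beta>'"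
    unfolding injective_def by blast
  define n where "n = apply_M N \<beta>"
  have S: "S \<beta> n" "S \<beta>' n" using N(2) \<beta> unfolding n_def by metis+
  \<comment> \<open>Since \<open>apply_M E \<delta>\<close> is injective, no \<delta> belongs to
    level \<open>n\<close> for both \<beta> and \<beta>'. The second stationary set therefore lies
    in the complement of the first.\<close>
  have disjoint: "\<not> U \<beta> n \<delta>" if "\<delta> \<in>\<^sub>M omega1" "U \<beta>' n \<delta>" for \<delta>
    using that E(2)[OF that(1)] \<beta>(4) unfolding U_def injective_def by blast
  obtain X where X: "\<And>\<delta>. \<delta> \<in>\<^sub>M X \<longleftrightarrow> \<delta> \<in>\<^sub>M omega1 \<and> U \<beta> n \<delta>"
  proof -
    have "def_pred (\<lambda>e. U \<beta> n (e 0))" by (intro definability)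
    from is_set_sep[OF this, of omega1] show ?thesis unfolding is_set_def by (elim exE) (rule that, erule spec)
  qed
  have "X \<subseteq>\<^sub>M omega1" using X by (simp add: subset_M_def)
  moreover have "bistationary (\<lambda>\<delta>. \<delta> \<in>\<^sub>M X)"
    unfolding bistationary_def X using S disjoint unfolding S_def by metis
  ultimately show ?thesis by blast
qed

end

section \<open>The game\<close>

context membership
begin

abbreviation move_set :: 'v where
  "move_set \<equiv> binary_sequences omega1"

definition code :: "'v \<Rightarrow> 'v" where
  "code \<beta> = Lam omega1 (\<lambda>\<xi>. if \<xi> = \<beta> then one else zero)"

text \<open>The constant sequence \<open>zero\<close> has value \<open>zero\<close>, so every move codes a countable ordinal.\<close>

definition code_value :: "'v \<Rightarrow> 'v" where
  "code_value y = Least_M (\<lambda>\<alpha>. \<alpha> \<in>\<^sub>M omega1 \<and> apply_M y \<alpha> = one)"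

text \<open>The least strict upper bound of the coded ordinals; the opening move, which names a subset of
  \<open>omega1\<close>, does not count.\<close>

definition limit_of :: "'v \<Rightarrow> 'v \<Rightarrow> bool" where
  "limit_of x \<delta> \<longleftrightarrow>
     (\<forall>n. n \<in>\<^sub>M omega \<longrightarrow> n \<noteq> zero \<longrightarrow> code_value (apply_M x n) \<in>\<^sub>M \<delta>) \<and>
     (\<forall>\<gamma>. \<gamma> \<in>\<^sub>M \<delta> \<longrightarrow> (\<exists>n. n \<in>\<^sub>M omega \<and> n \<noteq> zero \<and> \<gamma> \<subseteq>\<^sub>M code_value (apply_M x n)))"

text \<open>The bistationarity clause prevents the first player from opening with all of
  \<open>omega1\<close>, after which every supremum would be good for him.\<close>

definition payoff :: "'v \<Rightarrow> bool" where
  "payoff x \<longleftrightarrow> is_function x omega move_set \<and>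
     bistationary (\<lambda>\<delta>. apply_M (apply_M x zero) \<delta> = one) \<and>
     (\<exists>\<delta>. \<delta> \<in>\<^sub>M omega1 \<and> limit_of x \<delta> \<and> apply_M (apply_M x zero) \<delta> = one)"

end

context zfc_model
begin

lemma def_term_subst3:
  assumes "def_term (\<lambda>e. F (e 0) (e (Suc 0)) (e (Suc (Suc 0))))" "def_term s" "def_term t" "def_term u"
  shows "def_term (\<lambda>e. F (s e) (t e) (u e))"
proof (rule def_term_graph)
  show "x = F (s e) (t e) (u e) \<longleftrightarrow>
      (\<exists>a. a = s e \<and> (\<exists>b. b = t e \<and> (\<exists>c. c = u e \<and> x = F a b c)))" for x e by simp
  note shift = def_term_shift
  \<comment> \<open>The three nested quantifiers bind in reverse order, so indices \<open>1\<close>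
    and \<open>3\<close> are exchanged; index \<open>0\<close> holds the value of the term.\<close>
  have "inj (\<lambda>i::nat. if i \<in> {1, 2, 3} then 4 - i else i)"
    by (rule inj_on_inverseI[where g = "\<lambda>i. if i \<in> {1, 2, 3} then 4 - i else i"]) auto
  from definable_rename[OF assms(1)[unfolded def_term_def] this]
  have "def_term (\<lambda>e. F (e (Suc (Suc 0))) (e (Suc 0)) (e 0))"
    by (simp add: def_term_def numeral_3_eq_3 numeral_2_eq_2)
  then show "def_pred (\<lambda>e. \<exists>a. a = s (\<lambda>i. e (Suc i)) \<and> (\<exists>b. b = t (\<lambda>i. e (Suc i)) \<and>
      (\<exists>c. c = u (\<lambda>i. e (Suc i)) \<and> e 0 = F a b c)))"
    by (intro definability assms(2)[THEN shift, THEN shift] assms(3)[THEN shift, THEN shift, THEN shift]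
        assms(4)[THEN shift, THEN shift, THEN shift, THEN shift])
qed

lemma one_not_zero [simp]: "one \<noteq> zero" "zero \<noteq> one"
  by (simp_all add: one_def)

section \<open>Turns, positions and coded moves\<close>

text \<open>\<open>first_moves_at\<close> is phrased with \<open>app\<close>, for which there are no
  definability rules. On \<open>omega\<close> its labelling must coincide with the recursively
  defined \<open>F\<close>, so a definable predicate can stand in for it.\<close>

lemma first_moves_at_definable:
  "\<exists>Q. def_pred (\<lambda>e. Q (e 0)) \<and> Q zero \<and> (\<forall>n. n \<in>\<^sub>M omega \<longrightarrow> (Q (succ n) \<longleftrightarrow> \<not> Q n)) \<and>
     (\<forall>n. n \<in>\<^sub>M omega \<longrightarrow> (first_moves_at n \<longleftrightarrow> Q n))"
proof -
  have "def_term (\<lambda>e. if e (Suc 0) = zero then one else zero)" by (intro definability)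
  from omega_recursion[where G = "\<lambda>n x. if x = zero then one else zero" and a = zero, OF this]
  obtain F where F: "def_term (\<lambda>e. F (e 0))" "F zero = zero"
    "\<And>n. n \<in>\<^sub>M omega \<Longrightarrow> F (succ n) = (if F n = zero then one else zero)" by blast
  note [definability] = def_term_subst1[of F, OF F(1)]
  have F01: "F n = zero \<or> F n = one" if "n \<in>\<^sub>M omega" for n
    using that by (cases rule: omega_cases) (simp_all add: F(2,3))
  have "first_moves_at n \<longleftrightarrow> F n = zero" if n: "n \<in>\<^sub>M omega" for n
  proof
    assume "first_moves_at n"
    then obtain c where c: "is_function c (succ n) (upair zero one)" "app c n = zero"
      and rule: "\<And>\<beta>. \<beta> \<in>\<^sub>M succ n \<Longrightarrow> app c \<beta> = zero \<longleftrightarrow> (\<forall>\<gamma>. \<beta> = succ \<gamma> \<longrightarrow> app c \<gamma> = one)"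
      unfolding first_moves_at_def by blast
    have c01: "apply_M c \<beta> = zero \<or> apply_M c \<beta> = one" if "\<beta> \<in>\<^sub>M succ n" for \<beta>
      using is_function_type[OF c(1) that] by simp
    have "k \<in>\<^sub>M succ n \<longrightarrow> apply_M c k = F k" if "k \<in>\<^sub>M omega" for k
    proof -
      have "def_pred (\<lambda>e. e 0 \<in>\<^sub>M succ n \<longrightarrow> apply_M c (e 0) = F (e 0))" by (intro definability)
      with that show ?thesis
      proof (induction rule: omega_induct)
        case zero
        show ?case using rule[of zero] app_eq[OF c(1), of zero] F(2) by auto
      next
        case (succ k)
        show ?case
        proof
          assume k: "succ k \<in>\<^sub>M succ n"
          then have k': "k \<in>\<^sub>M succ n"
            using ordinal_trans[OF ordinal_succ[OF omega_ordinal[OF n]] _ k] by simp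
          then have "apply_M c k = F k" using succ.IH by blast
          moreover have "apply_M c (succ k) = zero \<longleftrightarrow> apply_M c k = one"
            using rule[OF k] app_eq[OF c(1) k] app_eq[OF c(1) k'] by simp
          ultimately show "apply_M c (succ k) = F (succ k)"
            using F(3)[OF succ.hyps] F01[OF succ.hyps] c01[OF k] by (auto split: if_splits)
        qed
      qed
    qed
    from this[OF n] show "F n = zero" using c(2) app_eq[OF c(1), of n] by simp
  next
    assume Fn: "F n = zero"
    have sub: "k \<in>\<^sub>M omega" if "k \<in>\<^sub>M succ n" for k using that n omega_trans succ_mem_omega by blast
    let ?c = "Lam (succ n) F"
    have c: "is_function ?c (succ n) (upair zero one)"
      by (rule Lam_function[OF F(1)]) (use F01 sub in simp)
    have app: "app ?c k = F k" if "k \<in>\<^sub>M succ n" for k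
      using app_eq[OF c that] apply_Lam[OF F(1) that] by simp
    have "app ?c \<beta> = zero \<longleftrightarrow> (\<forall>\<gamma>. \<beta> = succ \<gamma> \<longrightarrow> app ?c \<gamma> = one)" if \<beta>: "\<beta> \<in>\<^sub>M succ n" for \<beta>
      using sub[OF \<beta>]
    proof (cases rule: omega_cases)
      case 1
      then show ?thesis using app[OF \<beta>] F(2) by simp
    next
      case (2 k)
      then have "k \<in>\<^sub>M succ n"
        using ordinal_trans[OF ordinal_succ[OF omega_ordinal[OF n]], of k \<beta>] \<beta> by simp
      then have "app ?c k = F k" by (rule app)
      with 2 app[OF \<beta>] F(3) F01[OF 2(1)] show ?thesis by auto
    qed
    then show "first_moves_at n"
      unfolding first_moves_at_def using c app[of n] Fn by (intro exI[of _ ?c]) simp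
  qed
  moreover have "def_pred (\<lambda>e. F (e 0) = zero)" by (intro definability)
  ultimately show ?thesis using F(2,3) by (intro exI[of _ "\<lambda>n. F n = zero"]) simp
qed

lemma moves_at_zero: "moves_at P zero \<longleftrightarrow> P = First"
  using first_moves_at_definable zero_mem_omega by (cases P) auto

lemma moves_at_succ: "n \<in>\<^sub>M omega \<Longrightarrow> moves_at P (succ n) \<longleftrightarrow> \<not> moves_at P n"
  using first_moves_at_definable succ_mem_omega by (cases P) auto

lemma moves_at_definable:
  "\<exists>Q. def_pred (\<lambda>e. Q (e 0)) \<and> (\<forall>n. n \<in>\<^sub>M omega \<longrightarrow> (moves_at P n \<longleftrightarrow> Q n))"
proof -
  obtain Q where Q: "def_pred (\<lambda>e. Q (e 0))" "\<forall>n. n \<in>\<^sub>M omega \<longrightarrow> (first_moves_at n \<longleftrightarrow> Q n)"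
    using first_moves_at_definable by blast
  show ?thesis
  proof (cases P)
    case First
    with Q show ?thesis by (intro exI[of _ Q]) simp
  next
    case Second
    with Q definable_neg[OF Q(1)] show ?thesis by (intro exI[of _ "\<lambda>n. \<not> Q n"]) simp
  qed
qed

lemma omega_subset: "n \<in>\<^sub>M omega \<Longrightarrow> n \<subseteq>\<^sub>M omega"
  using omega_trans by (simp add: subset_M_def)

lemma mem_positions:
  "p \<in>\<^sub>M positions P omega S \<longleftrightarrow> (\<exists>n. n \<in>\<^sub>M omega \<and> moves_at P n \<and> is_function p n S)"
  unfolding positions_def
proof (rule mem_the_set)
  obtain Q where Q: "def_pred (\<lambda>e. Q (e 0))" "\<And>n. n \<in>\<^sub>M omega \<Longrightarrow> moves_at P n \<longleftrightarrow> Q n"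
    using moves_at_definable[of P] by blast
  note [definability] = def_pred_subst1[of Q, OF Q(1)]
  have "is_set (\<lambda>p. \<exists>n. n \<in>\<^sub>M omega \<and> Q n \<and> is_function p n S)"
  proof (rule is_set_subset)
    show "p \<in>\<^sub>M Pow_M (Pow_M (Pow_M (Union_M (upair omega S))))"
      if "\<exists>n. n \<in>\<^sub>M omega \<and> Q n \<and> is_function p n S" for p
      using that function_mem_Pow omega_subset by blast
  qed (intro definability)
  moreover have "(\<lambda>p. \<exists>n. n \<in>\<^sub>M omega \<and> moves_at P n \<and> is_function p n S) =
      (\<lambda>p. \<exists>n. n \<in>\<^sub>M omega \<and> Q n \<and> is_function p n S)" using Q(2) by blast
  ultimately show "is_set (\<lambda>p. \<exists>n. n \<in>\<^sub>M omega \<and> moves_at P n \<and> is_function p n S)" by simp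
qed

lemma mem_move_set: "y \<in>\<^sub>M move_set \<longleftrightarrow> is_function y omega1 (upair zero one)"
  by (simp add: binary_sequences_def mem_function_set)

lemma indicator_move_set:
  assumes "def_pred (\<lambda>e. P (e 0))"
  shows "Lam omega1 (\<lambda>\<xi>. if P \<xi> then one else zero) \<in>\<^sub>M move_set"
    and "\<delta> \<in>\<^sub>M omega1 \<Longrightarrow> apply_M (Lam omega1 (\<lambda>\<xi>. if P \<xi> then one else zero)) \<delta> = one \<longleftrightarrow> P \<delta>"
proof -
  have "def_term (\<lambda>e. if P (e 0) then one else zero)" by (intro definability assms)
  from Lam_function[OF this, of omega1 "upair zero one"] apply_Lam[OF this, of \<delta> omega1]
  show "Lam omega1 (\<lambda>\<xi>. if P \<xi> then one else zero) \<in>\<^sub>M move_set"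
    and "\<delta> \<in>\<^sub>M omega1 \<Longrightarrow> apply_M (Lam omega1 (\<lambda>\<xi>. if P \<xi> then one else zero)) \<delta> = one \<longleftrightarrow> P \<delta>"
    by (simp_all add: mem_move_set)
qed

lemma code_move_set: "code \<beta> \<in>\<^sub>M move_set"
  and apply_code: "\<alpha> \<in>\<^sub>M omega1 \<Longrightarrow> apply_M (code \<beta>) \<alpha> = one \<longleftrightarrow> \<alpha> = \<beta>"
proof -
  have "def_pred (\<lambda>e. e 0 = \<beta>)" by (intro definability)
  from indicator_move_set[OF this] show "code \<beta> \<in>\<^sub>M move_set"
    "\<alpha> \<in>\<^sub>M omega1 \<Longrightarrow> apply_M (code \<beta>) \<alpha> = one \<longleftrightarrow> \<alpha> = \<beta>" by (simp_all add: code_def)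
qed

lemma def_term_code [definability]: "def_term s \<Longrightarrow> def_term (\<lambda>e. code (s e))"
  by (rule def_term_subst1[of code]) (unfold code_def, intro definability)

lemma def_term_code_value [definability]: "def_term s \<Longrightarrow> def_term (\<lambda>e. code_value (s e))"
  by (rule def_term_subst1[of code_value]) (unfold code_value_def, intro definability)

lemma code_value_least:
  assumes "\<alpha> \<in>\<^sub>M omega1" "apply_M y \<alpha> = one"
  shows "code_value y \<in>\<^sub>M omega1" "apply_M y (code_value y) = one" "code_value y \<subseteq>\<^sub>M \<alpha>"
proof -
  have def: "def_pred (\<lambda>e. e 0 \<in>\<^sub>M omega1 \<and> apply_M y (e 0) = one)" by (intro definability)
  have \<alpha>: "ordinal \<alpha>" using assms(1) mem_omega1_iff by blast
  show "code_value y \<in>\<^sub>M omega1" "apply_M y (code_value y) = one" "code_value y \<subseteq>\<^sub>M \<alpha>"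
    using Least_property[OF def \<alpha>] Least_subset[OF def \<alpha>] assms unfolding code_value_def by blast+
qed

lemma code_value_none:
  assumes "\<And>\<alpha>. \<alpha> \<in>\<^sub>M omega1 \<Longrightarrow> apply_M y \<alpha> \<noteq> one"
  shows "code_value y = zero"
  unfolding code_value_def Least_M_def by (rule the_set_eq) (use assms in auto)

lemma code_value_mem_omega1: "code_value y \<in>\<^sub>M omega1"
  using code_value_least(1) code_value_none zero_mem_omega1 by metis

lemma code_value_code: "\<beta> \<in>\<^sub>M omega1 \<Longrightarrow> code_value (code \<beta>) = \<beta>"
  using code_value_least[of \<beta> "code \<beta>"] apply_code by blast

text \<open>If \<delta> were an element of \<delta>', some coded ordinal would be at least \<delta>,
  although all of them are below \<delta>.\<close>

lemma limit_of_unique: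
  assumes "limit_of x \<delta>" "limit_of x \<delta>'" "ordinal \<delta>" "ordinal \<delta>'"
  shows "\<delta> = \<delta>'"
proof -
  have "\<not> \<delta> \<in>\<^sub>M \<delta>'" if "limit_of x \<delta>" "limit_of x \<delta>'" for \<delta> \<delta>'
    using that subsetD mem_irrefl unfolding limit_of_def by metis
  with assms ordinal_linear show ?thesis by blast
qed

text \<open>The bound exists because only countably many finite sequences arise from the rule \<open>mv\<close> with
  parameters at most \<open>\<alpha>\<close>.\<close>

lemma generated_sequences_bounded:
  assumes mv: "def_term (\<lambda>e. mv (e 0) (e (Suc 0)) (e (Suc (Suc 0))))"
    and v: "def_term (\<lambda>e. v (e 0))" "\<And>p. v p \<in>\<^sub>M omega1"
  shows "\<exists>f. is_function f omega1 omega1 \<and>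
    (\<forall>\<alpha> n p. \<alpha> \<in>\<^sub>M omega1 \<longrightarrow> n \<in>\<^sub>M omega \<longrightarrow> p = Lam n (apply_M p) \<longrightarrow>
      (\<forall>k. k \<in>\<^sub>M n \<longrightarrow> (\<exists>\<beta>. \<beta> \<in>\<^sub>M succ \<alpha> \<and> apply_M p k = mv k (Lam k (apply_M p)) \<beta>)) \<longrightarrow>
      v p \<in>\<^sub>M apply_M f \<alpha>)"
proof -
  note [definability] = def_term_subst3[of mv, OF mv] def_term_subst1[of v, OF v(1)]
  define T where "T \<alpha> n p \<longleftrightarrow> p = Lam n (apply_M p) \<and>
    (\<forall>k. k \<in>\<^sub>M n \<longrightarrow> (\<exists>\<beta>. \<beta> \<in>\<^sub>M succ \<alpha> \<and> apply_M p k = mv k (Lam k (apply_M p)) \<beta>))" for \<alpha> n p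
  have "def_pred (\<lambda>e. T (e 0) (e (Suc 0)) (e (Suc (Suc 0))))" unfolding T_def by (intro definability)
  note [definability] = def_pred_subst3[of T, OF this]
  \<comment> \<open>A countable superset is enough for the bound, so the sequences themselves need
    not be collected into a set.\<close>
  have countable: "\<exists>C. countable_set C \<and> (\<forall>p. T \<alpha> n p \<longrightarrow> p \<in>\<^sub>M C)" if \<alpha>: "\<alpha> \<in>\<^sub>M omega1" and "n \<in>\<^sub>M omega" for \<alpha> n
  proof -
    have "def_pred (\<lambda>e. \<exists>C. countable_set C \<and> (\<forall>p. T \<alpha> (e 0) p \<longrightarrow> p \<in>\<^sub>M C))" by (intro definability)
    with that(2) show ?thesis
    proof (induction rule: omega_induct)
      case zero
      have "Lam zero (apply_M p) = zero" for p
        by (rule set_ext) (simp add: mem_Lam[OF def_term_apply_const])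
      then have "p \<in>\<^sub>M succ zero" if "T \<alpha> zero p" for p using that unfolding T_def by simp
      moreover have "countable_set (succ zero)"
        using zero_mem_omega1 succ_mem_omega1 mem_omega1_iff by blast
      ultimately show ?case by blast
    next
      case (succ n)
      then obtain C where C: "countable_set C" "\<And>p. T \<alpha> n p \<Longrightarrow> p \<in>\<^sub>M C" by blast
      \<comment> \<open>A sequence of length \<open>succ n\<close> is determined by its initial
        segment of length \<open>n\<close> and by one of the countably many parameters \<beta> at
        most \<alpha>.\<close>
      define ext where "ext q \<beta> = Lam (succ n) (\<lambda>k. if k = n then mv n q \<beta> else apply_M q k)" for q \<beta>
      have "def_term (\<lambda>e. ext (e 0) (e (Suc 0)))" unfolding ext_def by (intro definability)
      note [definability] = def_term_subst2[of ext, OF this]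
      define C' where "C' = Union_M (image_M (\<lambda>q. image_M (\<lambda>\<beta>. ext q \<beta>) (succ \<alpha>)) C)"
      have outer: "def_term (\<lambda>e. image_M (\<lambda>\<beta>. ext (e 0) \<beta>) (succ \<alpha>))" by (intro definability)
      have inner: "def_term (\<lambda>e. ext q (e 0))" for q by (intro definability)
      have C': "p \<in>\<^sub>M C' \<longleftrightarrow> (\<exists>q \<beta>. q \<in>\<^sub>M C \<and> \<beta> \<in>\<^sub>M succ \<alpha> \<and> p = ext q \<beta>)" for p
        unfolding C'_def mem_Union mem_image[OF outer] using mem_image[OF inner] by blast
      have "countable_set (succ \<alpha>)" using \<alpha> succ_mem_omega1 mem_omega1_iff by blast
      then have "countable_set C'"
        unfolding C'_def using countable_set_image[OF inner] countable_set_image[OF outer C(1)]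
        by (intro countable_set_Union) (auto simp: mem_image[OF outer])
      moreover have "p \<in>\<^sub>M C'" if p: "T \<alpha> (succ n) p" for p
      proof -
        define q where "q = Lam n (apply_M p)"
        have q: "apply_M q k = apply_M p k" if "k \<in>\<^sub>M n" for k
          unfolding q_def by (rule apply_Lam[OF def_term_apply_const that])
        have Lam_q: "Lam k (apply_M q) = Lam k (apply_M p)" if "k \<in>\<^sub>M n" for k
          by (rule Lam_cong) (use q that ordinal_trans[OF omega_ordinal[OF succ.hyps]] in blast)
        have "q = Lam n (apply_M q)"
          unfolding q_def by (rule Lam_cong) (use q q_def in simp)
        then have "T \<alpha> n q"
          using p unfolding T_def by (auto simp: q Lam_q)
        then have "q \<in>\<^sub>M C" by (rule C(2))
        moreover obtain \<beta> where \<beta>: "\<beta> \<in>\<^sub>M succ \<alpha>" "apply_M p n = mv n q \<beta>"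
          using p mem_succ unfolding T_def q_def by blast
        moreover have "p = ext q \<beta>"
        proof -
          have "p = Lam (succ n) (apply_M p)" using p unfolding T_def by blast
          also have "\<dots> = ext q \<beta>" unfolding ext_def by (rule Lam_cong) (use q \<beta> in auto)
          finally show ?thesis .
        qed
        ultimately show ?thesis using C' by blast
      qed
      ultimately show ?case by blast
    qed
  qed
  \<comment> \<open>Taking the least bound keeps \<eta> a definable term, so that the supremum over
    the lengths can be formed without another choice.\<close>
  define \<eta> where "\<eta> \<alpha> n = Least_M (\<lambda>\<eta>. \<forall>p. T \<alpha> n p \<longrightarrow> v p \<in>\<^sub>M \<eta>)" for \<alpha> n
  have "def_term (\<lambda>e. \<eta> (e 0) (e (Suc 0)))" unfolding \<eta>_def by (intro definability)
  note [definability] = def_term_subst2[of \<eta>, OF this]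
  have \<eta>: "\<eta> \<alpha> n \<in>\<^sub>M omega1 \<and> (\<forall>p. T \<alpha> n p \<longrightarrow> v p \<in>\<^sub>M \<eta> \<alpha> n)" if \<alpha>n: "\<alpha> \<in>\<^sub>M omega1" "n \<in>\<^sub>M omega" for \<alpha> n
  proof -
    obtain C where C: "countable_set C" "\<And>p. T \<alpha> n p \<Longrightarrow> p \<in>\<^sub>M C" using countable[OF \<alpha>n] by blast
    have succ_v: "def_term (\<lambda>e. succ (v (e 0)))" by (intro definability)
    define \<theta> where "\<theta> = Union_M (image_M (\<lambda>p. succ (v p)) C)"
    have \<theta>: "\<theta> \<in>\<^sub>M omega1"
      unfolding \<theta>_def by (intro omega1_sup[OF succ_v C(1)] succ_mem_omega1 v(2))
    have bound: "\<forall>p. T \<alpha> n p \<longrightarrow> v p \<in>\<^sub>M \<theta>"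
      unfolding \<theta>_def mem_Union mem_image[OF succ_v] using C(2) mem_succ by blast
    have def: "def_pred (\<lambda>e. \<forall>p. T \<alpha> n p \<longrightarrow> v p \<in>\<^sub>M e 0)" by (intro definability)
    have o: "ordinal \<theta>" using \<theta> mem_omega1_iff by blast
    have "\<eta> \<alpha> n \<in>\<^sub>M succ \<theta>"
      using Least_subset[of "\<lambda>\<eta>. \<forall>p. T \<alpha> n p \<longrightarrow> v p \<in>\<^sub>M \<eta>", OF def o bound]
        ordinal_Least[of "\<lambda>\<eta>. \<forall>p. T \<alpha> n p \<longrightarrow> v p \<in>\<^sub>M \<eta>", OF def o bound] ordinal_subset_iff[OF _ o]
      unfolding \<eta>_def by simp
    then show ?thesis
      using Least_property[of "\<lambda>\<eta>. \<forall>p. T \<alpha> n p \<longrightarrow> v p \<in>\<^sub>M \<eta>", OF def o bound]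
        succ_mem_omega1[OF \<theta>] omega1_trans unfolding \<eta>_def by blast
  qed
  define g where "g \<alpha> = Union_M (image_M (\<eta> \<alpha>) omega)" for \<alpha>
  have g_term: "def_term (\<lambda>e. g (e 0))" unfolding g_def by (intro definability)
  have \<eta>_term: "def_term (\<lambda>e. \<eta> \<alpha> (e 0))" for \<alpha> by (intro definability)
  have "g \<alpha> \<in>\<^sub>M omega1" if "\<alpha> \<in>\<^sub>M omega1" for \<alpha>
    unfolding g_def using \<eta>[OF that] by (intro omega1_sup[OF \<eta>_term countable_omega]) blast
  then have "is_function (Lam omega1 g) omega1 omega1" by (rule Lam_function[OF g_term])
  moreover have "v p \<in>\<^sub>M apply_M (Lam omega1 g) \<alpha>" if "\<alpha> \<in>\<^sub>M omega1" "n \<in>\<^sub>M omega" "T \<alpha> n p" for \<alpha> n p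
    unfolding apply_Lam[OF g_term that(1)] g_def mem_Union mem_image[OF \<eta>_term]
    using \<eta>[OF that(1,2)] that(2,3) by blast
  ultimately show ?thesis unfolding T_def by blast
qed

text \<open>An injection of \<delta> into \<open>omega\<close> enumerates \<delta>. Then
  \<open>m n\<close> is the largest ordinal with index below \<open>n\<close>, described as the
  least upper bound so that monotonicity is immediate. The ladder is only weakly increasing, which
  also covers a successor \<delta>: there it becomes constant at the largest element.\<close>

lemma countable_ordinal_ladder:
  assumes \<delta>: "\<delta> \<in>\<^sub>M omega1" "zero \<in>\<^sub>M \<delta>"
  shows "\<exists>m. def_term (\<lambda>e. m (e 0)) \<and> (\<forall>n. n \<in>\<^sub>M omega \<longrightarrow> m n \<in>\<^sub>M \<delta>) \<and>
    (\<forall>n k. n \<in>\<^sub>M omega \<longrightarrow> k \<in>\<^sub>M n \<longrightarrow> m k \<subseteq>\<^sub>M m n) \<and>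
    (\<forall>\<gamma>. \<gamma> \<in>\<^sub>M \<delta> \<longrightarrow> (\<exists>k. k \<in>\<^sub>M omega \<and> (\<forall>n. n \<in>\<^sub>M omega \<longrightarrow> k \<in>\<^sub>M n \<longrightarrow> \<gamma> \<subseteq>\<^sub>M m n)))"
proof -
  obtain i where i: "is_function i \<delta> omega" "injective i \<delta>" and o\<delta>: "ordinal \<delta>"
    using \<delta>(1) mem_omega1_iff countable_set_iff by blast
  define B where "B n \<mu> \<longleftrightarrow> (\<forall>\<alpha>. \<alpha> \<in>\<^sub>M \<delta> \<longrightarrow> apply_M i \<alpha> \<in>\<^sub>M n \<longrightarrow> \<alpha> \<subseteq>\<^sub>M \<mu>)" for n \<mu>
  have "def_pred (\<lambda>e. B (e 0) (e (Suc 0)))" unfolding B_def by (intro definability)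
  note [definability] = def_pred_subst2[of _ _ B, OF _ _ this]
  have o: "ordinal \<alpha>" if "\<alpha> \<in>\<^sub>M \<delta>" for \<alpha> using ordinal_mem[OF o\<delta> that] .
  have ex: "\<exists>\<mu>. \<mu> \<in>\<^sub>M \<delta> \<and> B n \<mu>" if "n \<in>\<^sub>M omega" for n
  proof -
    have "def_pred (\<lambda>e. \<exists>\<mu>. \<mu> \<in>\<^sub>M \<delta> \<and> B (e 0) \<mu>)" by (intro definability)
    with that show ?thesis
    proof (induction rule: omega_induct)
      case zero
      show ?case unfolding B_def using \<delta>(2) by auto
    next
      case (succ n)
      then obtain \<mu> where \<mu>: "\<mu> \<in>\<^sub>M \<delta>" "B n \<mu>" by blast
      show ?case
      \<comment> \<open>By injectivity at most one ordinal has index \<open>n\<close>, so the new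
        bound is either that ordinal or the old one.\<close>
      proof (cases "\<exists>\<alpha>. \<alpha> \<in>\<^sub>M \<delta> \<and> apply_M i \<alpha> = n \<and> \<not> \<alpha> \<subseteq>\<^sub>M \<mu>")
        case True
        then obtain \<alpha> where \<alpha>: "\<alpha> \<in>\<^sub>M \<delta>" "apply_M i \<alpha> = n" "\<not> \<alpha> \<subseteq>\<^sub>M \<mu>" by blast
        then have "\<mu> \<subseteq>\<^sub>M \<alpha>" using ordinal_subset_iff ordinal_linear o \<mu>(1) by metis
        then have "B (succ n) \<alpha>"
          using \<mu>(2) \<alpha> i(2) subset_trans unfolding B_def injective_def mem_succ by (metis subset_refl)
        with \<alpha>(1) show ?thesis by blast
      next
        case False
        with \<mu> show ?thesis unfolding B_def mem_succ by blast
      qed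
    qed
  qed
  define m where "m n = Least_M (B n)" for n
  have m_term: "def_term (\<lambda>e. m (e 0))" unfolding m_def by (intro definability)
  have def: "def_pred (\<lambda>e. B n (e 0))" for n by (intro definability)
  have m: "m n \<in>\<^sub>M \<delta>" "B n (m n)" "\<And>\<mu>. ordinal \<mu> \<Longrightarrow> B n \<mu> \<Longrightarrow> m n \<subseteq>\<^sub>M \<mu>" if n: "n \<in>\<^sub>M omega" for n
  proof -
    obtain \<mu> where \<mu>: "\<mu> \<in>\<^sub>M \<delta>" "B n \<mu>" using ex[OF n] by blast
    have om: "ordinal (m n)" unfolding m_def using ordinal_Least[OF def o[OF \<mu>(1)] \<mu>(2)] .
    have "m n \<subseteq>\<^sub>M \<mu>" unfolding m_def using Least_subset[OF def o[OF \<mu>(1)] \<mu>(2)] .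
    then show "m n \<in>\<^sub>M \<delta>" using ordinal_subset_iff[OF om o[OF \<mu>(1)]] \<mu>(1) ordinal_trans[OF o\<delta>] by blast
    show "B n (m n)" unfolding m_def using Least_property[OF def o[OF \<mu>(1)] \<mu>(2)] .
    show "m n \<subseteq>\<^sub>M \<mu>" if "ordinal \<mu>" "B n \<mu>" for \<mu>
      unfolding m_def using Least_subset[OF def that] .
  qed
  have "m k \<subseteq>\<^sub>M m n" if "n \<in>\<^sub>M omega" "k \<in>\<^sub>M n" for n k
  proof (rule m(3))
    show "k \<in>\<^sub>M omega" using omega_trans that .
    show "ordinal (m n)" using m(1)[OF that(1)] o by blast
    show "B k (m n)"
      using m(2)[OF that(1)] ordinal_trans[OF omega_ordinal[OF that(1)] _ that(2)] unfolding B_def by blast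
  qed
  moreover have "\<exists>k. k \<in>\<^sub>M omega \<and> (\<forall>n. n \<in>\<^sub>M omega \<longrightarrow> k \<in>\<^sub>M n \<longrightarrow> \<gamma> \<subseteq>\<^sub>M m n)" if "\<gamma> \<in>\<^sub>M \<delta>" for \<gamma>
    using is_function_type[OF i(1) that] m(2) that unfolding B_def by blast
  ultimately show ?thesis using m_term m(1) by blast
qed

text \<open>The opponent plays codes of ordinals that climb up to \<open>\<delta>\<close>, and closure under \<open>f\<close> keeps the replies
  below \<open>\<delta>\<close>.\<close>

lemma opponent_forces_limit:
  assumes \<sigma>: "strategy P omega move_set \<sigma>" and X: "X \<in>\<^sub>M move_set"
  shows "\<exists>f. is_function f omega1 omega1 \<and> (\<forall>\<delta>. \<delta> \<in>\<^sub>M omega1 \<longrightarrow> closed_under f \<delta> \<longrightarrow>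
    (\<exists>x. is_function x omega move_set \<and> follows P omega \<sigma> x \<and> limit_of x \<delta> \<and>
      (\<not> moves_at P zero \<longrightarrow> apply_M x zero = X)))"
proof -
  obtain Q where Q: "def_pred (\<lambda>e. Q (e 0))" "\<And>n. n \<in>\<^sub>M omega \<Longrightarrow> moves_at P n \<longleftrightarrow> Q n"
    using moves_at_definable[of P] by blast
  note [definability] = def_pred_subst1[of Q, OF Q(1)]
  \<comment> \<open>One rule describes the moves of both players. On the turns of \<open>P\<close>
    it ignores \<beta>; hence the only freedom in generating a play is the ordinal coded on each
    turn of the opponent.\<close>
  define mv where "mv n p \<beta> = (if Q n then apply_M \<sigma> p else if n = zero then X else code \<beta>)" for n p \<beta>
  have mv: "def_term (\<lambda>e. mv (e 0) (e (Suc 0)) (e (Suc (Suc 0))))"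
    unfolding mv_def by (intro definability)
  note [definability] = def_term_subst3[of mv, OF mv]
  have "def_term (\<lambda>e. code_value (apply_M \<sigma> (e 0)))" by (intro definability)
  from generated_sequences_bounded[OF mv this code_value_mem_omega1]
  obtain f where f: "is_function f omega1 omega1"
    and bound: "\<And>\<alpha> n p. \<alpha> \<in>\<^sub>M omega1 \<Longrightarrow> n \<in>\<^sub>M omega \<Longrightarrow> p = Lam n (apply_M p) \<Longrightarrow>
      (\<And>k. k \<in>\<^sub>M n \<Longrightarrow> \<exists>\<beta>. \<beta> \<in>\<^sub>M succ \<alpha> \<and> apply_M p k = mv k (Lam k (apply_M p)) \<beta>) \<Longrightarrow>
      code_value (apply_M \<sigma> p) \<in>\<^sub>M apply_M f \<alpha>" by blast
  have "\<exists>x. is_function x omega move_set \<and> follows P omega \<sigma> x \<and> limit_of x \<delta> \<and>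
      (\<not> moves_at P zero \<longrightarrow> apply_M x zero = X)"
    if \<delta>: "\<delta> \<in>\<^sub>M omega1" and closed: "closed_under f \<delta>" for \<delta>
  proof -
    have o\<delta>: "ordinal \<delta>" using \<delta> mem_omega1_iff by blast
    obtain m where m: "def_term (\<lambda>e. m (e 0))" "\<And>n. n \<in>\<^sub>M omega \<Longrightarrow> m n \<in>\<^sub>M \<delta>"
      "\<And>n k. n \<in>\<^sub>M omega \<Longrightarrow> k \<in>\<^sub>M n \<Longrightarrow> m k \<subseteq>\<^sub>M m n"
      "\<And>\<gamma>. \<gamma> \<in>\<^sub>M \<delta> \<Longrightarrow> \<exists>k. k \<in>\<^sub>M omega \<and> (\<forall>n. n \<in>\<^sub>M omega \<longrightarrow> k \<in>\<^sub>M n \<longrightarrow> \<gamma> \<subseteq>\<^sub>M m n)"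
      using countable_ordinal_ladder[OF \<delta>] closed unfolding closed_under_def by blast
    note [definability] = def_term_subst1[of m, OF m(1)]
    \<comment> \<open>At index \<open>n\<close> the opponent codes \<open>m n\<close>; the entries
      of the ladder at turns of \<open>P\<close> are skipped.\<close>
    have "def_term (\<lambda>e. mv (e 0) (e (Suc 0)) (m (e 0)))" by (intro definability)
    from transfinite_recursion[of "\<lambda>n p. mv n p (m n)", OF this] obtain F where F: "def_term (\<lambda>e. F (e 0))"
      "\<And>n. ordinal n \<Longrightarrow> F n = mv n (Lam n F) (m n)" by blast
    note [definability] = def_term_subst1[of F, OF F(1)]
    have position: "is_function (Lam n F) n move_set" if "n \<in>\<^sub>M omega" "\<And>k. k \<in>\<^sub>M n \<Longrightarrow> F k \<in>\<^sub>M move_set" for n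
      by (rule Lam_function[OF F(1) that(2)])
    have F_move: "n \<in>\<^sub>M omega \<longrightarrow> F n \<in>\<^sub>M move_set" if "ordinal n" for n
    proof -
      have "def_pred (\<lambda>e. e 0 \<in>\<^sub>M omega \<longrightarrow> F (e 0) \<in>\<^sub>M move_set)" by (intro definability)
      with that show ?thesis
      proof (induction rule: ordinal_induct)
        case (step n)
        show ?case
        proof
          assume n: "n \<in>\<^sub>M omega"
          show "F n \<in>\<^sub>M move_set"
          proof (cases "Q n")
            case True
            then have "Lam n F \<in>\<^sub>M positions P omega move_set"
              unfolding mem_positions using n Q(2) position step.IH omega_trans by blast
            then have "apply_M \<sigma> (Lam n F) \<in>\<^sub>M move_set"
              using \<sigma> is_function_type unfolding strategy_def by blast
            with True show ?thesis unfolding F(2)[OF step.hyps] mv_def by simp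
          next
            case False
            then show ?thesis unfolding F(2)[OF step.hyps] mv_def using X code_move_set by simp
          qed
        qed
      qed
    qed
    then have F_move: "F n \<in>\<^sub>M move_set" if "n \<in>\<^sub>M omega" for n using that omega_ordinal by blast
    define x where "x = Lam omega F"
    have x: "is_function x omega move_set" unfolding x_def by (rule Lam_function[OF F(1) F_move])
    have apply_x: "apply_M x n = F n" if "n \<in>\<^sub>M omega" for n
      unfolding x_def by (rule apply_Lam[OF F(1) that])
    have F_eq: "F n = mv n (Lam n F) (m n)" if "n \<in>\<^sub>M omega" for n using F(2)[OF omega_ordinal[OF that]] .
    have "follows P omega \<sigma> x"
      unfolding follows_def
    proof (intro allI impI)
      fix n assume n: "n \<in>\<^sub>M omega" and P: "moves_at P n"
      have "Lam n (apply_M x) = Lam n F"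
        by (rule Lam_cong) (use apply_x omega_trans[OF n] in blast)
      then have r: "restrict x n = Lam n F" using restrict_eq[OF x omega_subset[OF n]] by simp
      have "Lam n F \<in>\<^sub>M positions P omega move_set"
        unfolding mem_positions using n P position F_move omega_trans by blast
      then have "app \<sigma> (Lam n F) = apply_M \<sigma> (Lam n F)" using \<sigma> app_eq unfolding strategy_def by blast
      then show "app x n = app \<sigma> (restrict x n)"
        using app_eq[OF x n] apply_x[OF n] F_eq[OF n] P Q(2)[OF n] r by (simp add: mv_def)
    qed
    moreover have "limit_of x \<delta>"
      unfolding limit_of_def
    proof (intro conjI allI impI)
      fix n assume n: "n \<in>\<^sub>M omega" "n \<noteq> zero"
      show "code_value (apply_M x n) \<in>\<^sub>M \<delta>"
      proof (cases "Q n")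
        case True
        \<comment> \<open>The bound is used at \<alpha> = \<open>m n\<close>: the ladder is
          monotone, so all ordinals coded earlier by the opponent are at most \<open>m n\<close>.
          Since \<open>m n\<close> is below \<delta>, so is \<open>apply_M f (m n)\<close>.\<close>
        have "code_value (apply_M \<sigma> (Lam n F)) \<in>\<^sub>M apply_M f (m n)"
        proof (rule bound)
          show "m n \<in>\<^sub>M omega1" using m(2)[OF n(1)] omega1_trans[OF \<delta>] by blast
          have eq: "apply_M (Lam n F) k = F k" if "k \<in>\<^sub>M n" for k by (rule apply_Lam[OF F(1) that])
          then show "Lam n F = Lam n (apply_M (Lam n F))" by (intro Lam_cong) simp
          fix k assume k: "k \<in>\<^sub>M n"
          then have k\<omega>: "k \<in>\<^sub>M omega" using omega_trans[OF n(1)] by blast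
          have "Lam k (apply_M (Lam n F)) = Lam k F"
            by (rule Lam_cong) (use eq ordinal_trans[OF omega_ordinal[OF n(1)] _ k] in blast)
          then have "apply_M (Lam n F) k = mv k (Lam k (apply_M (Lam n F))) (m k)"
            using F_eq[OF k\<omega>] eq[OF k] by simp
          moreover have "m k \<in>\<^sub>M succ (m n)"
            using m(3)[OF n(1) k] ordinal_subset_iff m(2) n(1) k\<omega> ordinal_mem[OF o\<delta>] mem_succ by metis
          ultimately show "\<exists>\<beta>. \<beta> \<in>\<^sub>M succ (m n) \<and> apply_M (Lam n F) k = mv k (Lam k (apply_M (Lam n F))) \<beta>"
            by blast
        qed (rule n(1))
        moreover have "apply_M f (m n) \<in>\<^sub>M \<delta>" using closed m(2)[OF n(1)] unfolding closed_under_def by blast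
        ultimately show ?thesis
          using ordinal_trans[OF o\<delta>] apply_x[OF n(1)] F_eq[OF n(1)] True by (simp add: mv_def)
      next
        case False
        then have "apply_M x n = code (m n)" using apply_x[OF n(1)] F_eq[OF n(1)] n(2) by (simp add: mv_def)
        then show ?thesis using code_value_code m(2)[OF n(1)] omega1_trans[OF \<delta>] by simp
      qed
    next
      fix \<gamma> assume "\<gamma> \<in>\<^sub>M \<delta>"
      then obtain k where k: "k \<in>\<^sub>M omega" "\<And>n. n \<in>\<^sub>M omega \<Longrightarrow> k \<in>\<^sub>M n \<Longrightarrow> \<gamma> \<subseteq>\<^sub>M m n" using m(4) by blast
      \<comment> \<open>Turns alternate, so one of the next two indices after \<open>k\<close>
        belongs to the opponent; as a successor it is not the discounted opening.\<close>
      obtain n where n: "n \<in>\<^sub>M omega" "k \<in>\<^sub>M n" "\<not> Q n" "n \<noteq> zero"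
      proof (cases "Q (succ k)")
        case True
        then have "\<not> Q (succ (succ k))"
          using moves_at_succ[OF succ_mem_omega[OF k(1)], of P] Q(2) succ_mem_omega k(1) by blast
        with that[of "succ (succ k)"] k(1) succ_mem_omega show ?thesis by simp
      next
        case False
        with that[of "succ k"] k(1) succ_mem_omega show ?thesis by simp
      qed
      then have "apply_M x n = code (m n)" using apply_x F_eq by (simp add: mv_def)
      then have "code_value (apply_M x n) = m n"
        using code_value_code m(2)[OF n(1)] omega1_trans[OF \<delta>] by simp
      with n k(2) show "\<exists>n. n \<in>\<^sub>M omega \<and> n \<noteq> zero \<and> \<gamma> \<subseteq>\<^sub>M code_value (apply_M x n)" by metis
    qed
    moreover have "apply_M x zero = X" if "\<not> moves_at P zero"
      using that Q(2)[OF zero_mem_omega] apply_x[OF zero_mem_omega] F_eq[OF zero_mem_omega]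
      by (simp add: mv_def)
    ultimately show ?thesis using x by blast
  qed
  with f show ?thesis by blast
qed

lemma bistationary_cong:
  assumes "\<And>\<delta>. \<delta> \<in>\<^sub>M omega1 \<Longrightarrow> P \<delta> \<longleftrightarrow> R \<delta>"
  shows "bistationary P \<longleftrightarrow> bistationary R"
  unfolding bistationary_def using assms by metis

lemma payoff_limit:
  assumes "payoff x" "limit_of x \<delta>" "\<delta> \<in>\<^sub>M omega1"
  shows "apply_M (apply_M x zero) \<delta> = one"
  using assms limit_of_unique mem_omega1_iff unfolding payoff_def by metis

text \<open>The loser's target depends on who owns the strategy: a closure point of \<open>f\<close>
  outside the named set defeats the first player, one inside it defeats the second.\<close>

lemma payoff_undetermined:
  assumes A: "\<And>x. x \<in>\<^sub>M A \<longleftrightarrow> payoff x"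
  shows "\<not> determined omega move_set A"
proof
  assume "determined omega move_set A"
  then obtain P \<sigma> where "winning_strategy P omega move_set A \<sigma>" unfolding determined_def by blast
  then have \<sigma>: "strategy P omega move_set \<sigma>"
    and win: "\<And>x. is_function x omega move_set \<Longrightarrow> follows P omega \<sigma> x \<Longrightarrow> wins P A x"
    unfolding winning_strategy_def by blast+
  show False
  proof (cases P)
    case First
    \<comment> \<open>Here the strategy makes the opening move, so the opening supplied for the
      opponent is a dummy.\<close>
    obtain f where f: "is_function f omega1 omega1" "\<And>\<delta>. \<delta> \<in>\<^sub>M omega1 \<Longrightarrow> closed_under f \<delta> \<Longrightarrow>
        \<exists>x. is_function x omega move_set \<and> follows P omega \<sigma> x \<and> limit_of x \<delta>"
      using opponent_forces_limit[OF \<sigma> code_move_set] by blast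
    \<comment> \<open>The opening is the value of \<sigma> at the empty position and is thus the
      same in all plays that follow \<sigma>.\<close>
    define Y where "Y = app \<sigma> (Lam zero (\<lambda>x. x))"
    have Y: "apply_M x zero = Y" if x: "is_function x omega move_set" "follows P omega \<sigma> x" for x
    proof -
      have "app x zero = app \<sigma> (restrict x zero)"
        using x(2) zero_mem_omega moves_at_zero First unfolding follows_def by blast
      moreover have "restrict x zero = Lam zero (apply_M x)"
        by (rule restrict_eq[OF x(1)]) (simp add: subset_M_def)
      moreover have "Lam zero (apply_M x) = Lam zero (\<lambda>x. x)" by (rule Lam_cong) simp
      ultimately show ?thesis using app_eq[OF x(1) zero_mem_omega] unfolding Y_def by simp
    qed
    have payoff: "payoff x" if "is_function x omega move_set" "follows P omega \<sigma> x" for x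
      using win[OF that] First A by simp
    \<comment> \<open>At least one play follows \<sigma>; as it is won, its opening must satisfy the
      bistationarity clause.\<close>
    have "bistationary (\<lambda>\<delta>. apply_M Y \<delta> = one)"
    proof -
      obtain \<delta> where "\<delta> \<in>\<^sub>M omega1" "closed_under f \<delta>"
        using closed_under_unbounded[OF f(1) zero_mem_omega1] by blast
      then obtain x where x: "is_function x omega move_set" "follows P omega \<sigma> x"
        using f(2) by blast
      from payoff[OF this] show ?thesis unfolding payoff_def Y[OF x] by (elim conjE)
    qed
    then obtain \<delta> where \<delta>: "\<delta> \<in>\<^sub>M omega1" "closed_under f \<delta>" "apply_M Y \<delta> \<noteq> one"
      using f(1) unfolding bistationary_def by blast
    then obtain x where x: "is_function x omega move_set" "follows P omega \<sigma> x" "limit_of x \<delta>"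
      using f(2) by blast
    from payoff_limit[OF payoff[OF x(1,2)] x(3) \<delta>(1)] \<delta>(3) show False unfolding Y[OF x(1,2)] by simp
  next
    case Second
    obtain X where X: "bistationary (\<lambda>\<delta>. \<delta> \<in>\<^sub>M X)" using bistationary_exists by blast
    define Y where "Y = Lam omega1 (\<lambda>\<xi>. if \<xi> \<in>\<^sub>M X then one else zero)"
    have "def_pred (\<lambda>e. e 0 \<in>\<^sub>M X)" by (intro definability)
    from indicator_move_set[of "\<lambda>\<xi>. \<xi> \<in>\<^sub>M X", OF this] have Y: "Y \<in>\<^sub>M move_set"
      "\<And>\<delta>. \<delta> \<in>\<^sub>M omega1 \<Longrightarrow> apply_M Y \<delta> = one \<longleftrightarrow> \<delta> \<in>\<^sub>M X" unfolding Y_def by simp_all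
    have bi: "bistationary (\<lambda>\<delta>. apply_M Y \<delta> = one)"
      using X bistationary_cong[of "\<lambda>\<delta>. apply_M Y \<delta> = one" "\<lambda>\<delta>. \<delta> \<in>\<^sub>M X"] Y(2) by simp
    obtain f where f: "is_function f omega1 omega1" "\<And>\<delta>. \<delta> \<in>\<^sub>M omega1 \<Longrightarrow> closed_under f \<delta> \<Longrightarrow>
        \<exists>x. is_function x omega move_set \<and> follows P omega \<sigma> x \<and> limit_of x \<delta> \<and> apply_M x zero = Y"
      using opponent_forces_limit[OF \<sigma> Y(1)] moves_at_zero Second by blast
    obtain \<delta> where \<delta>: "\<delta> \<in>\<^sub>M omega1" "closed_under f \<delta>" "apply_M Y \<delta> = one"
      using bi f(1) unfolding bistationary_def by blast
    then obtain x where x: "is_function x omega move_set" "follows P omega \<sigma> x" "limit_of x \<delta>"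
      "apply_M x zero = Y" using f(2) by blast
    then have "payoff x" unfolding payoff_def using bi \<delta> by blast
    with win[OF x(1,2)] Second A show False by simp
  qed
qed

lemma is_set_payoff: "is_set payoff"
proof (rule is_set_subset)
  show "x \<in>\<^sub>M function_set omega move_set" if "payoff x" for x
    using that unfolding payoff_def mem_function_set by blast
  show "def_pred (\<lambda>e. payoff (e 0))"
    unfolding payoff_def bistationary_def limit_of_def by (intro definability)
qed

end

section \<open>Ordinal definability\<close>

context membership
begin

text \<open>These relativisations to \<open>D\<close> use only membership and equality, so that they translate into a
  formula to be evaluated in \<open>V_stage \<kappa>\<close>; they are absolute when \<open>D\<close> is transitive.\<close>

definition upair_in :: "'v set \<Rightarrow> 'v \<Rightarrow> 'v \<Rightarrow> 'v \<Rightarrow> bool" where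
  "upair_in D z x y \<longleftrightarrow> (\<forall>w\<in>D. w \<in>\<^sub>M z \<longleftrightarrow> w = x \<or> w = y)"

definition opair_in :: "'v set \<Rightarrow> 'v \<Rightarrow> 'v \<Rightarrow> 'v \<Rightarrow> bool" where
  "opair_in D z x y \<longleftrightarrow> (\<exists>a\<in>D. \<exists>b\<in>D. upair_in D a x x \<and> upair_in D b x y \<and> upair_in D z a b)"

definition maps_in :: "'v set \<Rightarrow> 'v \<Rightarrow> 'v \<Rightarrow> 'v \<Rightarrow> bool" where
  "maps_in D f x y \<longleftrightarrow> (\<exists>z\<in>D. z \<in>\<^sub>M f \<and> opair_in D z x y)"

text \<open>The range is given by a predicate because the move set is not an ordinal and cannot be
  used as a parameter; a predicate allows it to be described inside the formula.\<close>

definition function_in :: "'v set \<Rightarrow> 'v \<Rightarrow> 'v \<Rightarrow> ('v \<Rightarrow> bool) \<Rightarrow> bool" where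
  "function_in D f X P \<longleftrightarrow>
     (\<forall>p\<in>D. p \<in>\<^sub>M f \<longrightarrow> (\<exists>x\<in>D. \<exists>y\<in>D. x \<in>\<^sub>M X \<and> P y \<and> opair_in D p x y)) \<and>
     (\<forall>x\<in>D. x \<in>\<^sub>M X \<longrightarrow> (\<exists>y\<in>D. maps_in D f x y \<and> (\<forall>y'\<in>D. maps_in D f x y' \<longrightarrow> y' = y)))"

definition closed_in :: "'v set \<Rightarrow> 'v \<Rightarrow> 'v \<Rightarrow> bool" where
  "closed_in D f \<delta> \<longleftrightarrow> zero \<in>\<^sub>M \<delta> \<and> (\<forall>\<alpha>\<in>D. \<alpha> \<in>\<^sub>M \<delta> \<longrightarrow> (\<exists>\<beta>\<in>D. \<beta> \<in>\<^sub>M \<delta> \<and> maps_in D f \<alpha> \<beta>))"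

definition bistationary_in :: "'v set \<Rightarrow> 'v \<Rightarrow> bool" where
  "bistationary_in D X \<longleftrightarrow> (\<forall>f\<in>D. function_in D f omega1 (\<lambda>y. y \<in>\<^sub>M omega1) \<longrightarrow>
     (\<exists>\<delta>\<in>D. \<delta> \<in>\<^sub>M omega1 \<and> closed_in D f \<delta> \<and> maps_in D X \<delta> one) \<and>
     (\<exists>\<delta>\<in>D. \<delta> \<in>\<^sub>M omega1 \<and> closed_in D f \<delta> \<and> \<not> maps_in D X \<delta> one))"

text \<open>The code value is compared without defining a least element inside \<open>D\<close>: it
  is below \<gamma> iff \<open>one\<close> occurs below \<gamma>, or iff it is the default
  \<open>zero\<close> and \<gamma> is nonempty. The reverse inequality is then a negation.\<close>

definition code_value_less_in :: "'v set \<Rightarrow> 'v \<Rightarrow> 'v \<Rightarrow> bool" where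
  "code_value_less_in D y \<gamma> \<longleftrightarrow> (\<exists>\<alpha>\<in>D. \<alpha> \<in>\<^sub>M \<gamma> \<and> maps_in D y \<alpha> one) \<or>
     (zero \<in>\<^sub>M \<gamma> \<and> (\<forall>\<alpha>\<in>D. \<alpha> \<in>\<^sub>M omega1 \<longrightarrow> \<not> maps_in D y \<alpha> one))"

definition limit_of_in :: "'v set \<Rightarrow> 'v \<Rightarrow> 'v \<Rightarrow> bool" where
  "limit_of_in D x \<delta> \<longleftrightarrow>
     (\<forall>n\<in>D. n \<in>\<^sub>M omega \<longrightarrow> n \<noteq> zero \<longrightarrow> (\<exists>y\<in>D. maps_in D x n y \<and> code_value_less_in D y \<delta>)) \<and>
     (\<forall>\<gamma>\<in>D. \<gamma> \<in>\<^sub>M \<delta> \<longrightarrow>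
       (\<exists>n\<in>D. n \<in>\<^sub>M omega \<and> n \<noteq> zero \<and> (\<exists>y\<in>D. maps_in D x n y \<and> \<not> code_value_less_in D y \<gamma>)))"

definition payoff_in :: "'v set \<Rightarrow> 'v \<Rightarrow> bool" where
  "payoff_in D x \<longleftrightarrow>
     function_in D x omega (\<lambda>y. function_in D y omega1 (\<lambda>z. z = zero \<or> z = one)) \<and>
     (\<exists>X\<in>D. maps_in D x zero X \<and> bistationary_in D X \<and>
       (\<exists>\<delta>\<in>D. \<delta> \<in>\<^sub>M omega1 \<and> limit_of_in D x \<delta> \<and> maps_in D X \<delta> one))"

lemma definable_payoff_in:
  assumes "zero \<in> Q" "one \<in> Q" "omega \<in> Q" "omega1 \<in> Q"
  shows "definable D Q (\<lambda>e. payoff_in D (e 0))"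
proof -
  have "Q \<noteq> {}" using assms(1) by blast
  note definability_in = definable_neg definable_conj definable_disj definable_imp definable_iff
    definable_all definable_ex definable_mem[OF _ _ \<open>Q \<noteq> {}\<close>] definable_eq[OF _ _ \<open>Q \<noteq> {}\<close>]
    atomic_term_var assms[THEN atomic_term_const]
  show ?thesis
    unfolding payoff_in_def limit_of_in_def code_value_less_in_def bistationary_in_def closed_in_def
      function_in_def maps_in_def opair_in_def upair_in_def
    by (intro definability_in)
qed

end

context zfc_model
begin

section \<open>Absoluteness for transitive classes\<close>

context
  fixes D :: "'v set"
  assumes transitive_D: "\<And>x y. x \<in> D \<Longrightarrow> y \<in>\<^sub>M x \<Longrightarrow> y \<in> D"
begin

lemma upair_in_iff: "z \<in> D \<Longrightarrow> x \<in> D \<Longrightarrow> y \<in> D \<Longrightarrow> upair_in D z x y \<longleftrightarrow> z = upair x y"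
  unfolding upair_in_def using transitive_D set_ext[of z "upair x y"] by (metis mem_upair)

lemma opair_in_iff:
  assumes "z \<in> D" "x \<in> D" "y \<in> D"
  shows "opair_in D z x y \<longleftrightarrow> z = opair x y"
proof
  assume "opair_in D z x y"
  then show "z = opair x y" unfolding opair_in_def opair_def using upair_in_iff assms by metis
next
  assume z: "z = opair x y"
  then have "upair x x \<in> D" "upair x y \<in> D"
    using transitive_D[OF assms(1)] unfolding opair_def by simp_all
  with z show "opair_in D z x y" unfolding opair_in_def opair_def using upair_in_iff assms by metis
qed

lemma opair_components:
  assumes "opair x y \<in> D"
  shows "x \<in> D" "y \<in> D"
proof -
  have "upair x y \<in> D" using transitive_D[OF assms] unfolding opair_def by simp
  then show "x \<in> D" "y \<in> D" using transitive_D by auto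
qed

lemma maps_in_iff:
  assumes "f \<in> D" "x \<in> D" "y \<in> D"
  shows "maps_in D f x y \<longleftrightarrow> opair x y \<in>\<^sub>M f"
  unfolding maps_in_def using opair_in_iff assms transitive_D by metis

lemma maps_in_apply:
  assumes "is_function f X Y" "f \<in> D" "x \<in> D" "x \<in>\<^sub>M X" "y \<in> D"
  shows "maps_in D f x y \<longleftrightarrow> apply_M f x = y"
  using maps_in_iff[OF assms(2,3,5)] is_function_mem[OF assms(1,4)] is_function_apply_eq[OF assms(1)] by metis

lemma apply_in:
  assumes "is_function f X Y" "f \<in> D" "x \<in>\<^sub>M X"
  shows "apply_M f x \<in> D"
  by (rule opair_components(2)[OF transitive_D[OF assms(2) is_function_mem[OF assms(1,3)]]])

lemma function_in_iff:
  assumes "f \<in> D" "X \<in> D" "\<And>y. y \<in> D \<Longrightarrow> P y \<longleftrightarrow> y \<in>\<^sub>M Y"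
  shows "function_in D f X P \<longleftrightarrow> is_function f X Y"
proof
  assume f: "function_in D f X P"
  show "is_function f X Y"
    unfolding is_function_def
  proof (intro conjI allI impI)
    fix p assume p: "p \<in>\<^sub>M f"
    then have "p \<in> D" using transitive_D assms(1) by blast
    with f p obtain x y where "x \<in> D" "y \<in> D" "x \<in>\<^sub>M X" "P y" "opair_in D p x y"
      unfolding function_in_def by blast
    then show "\<exists>x y. x \<in>\<^sub>M X \<and> y \<in>\<^sub>M Y \<and> p = opair x y" using opair_in_iff[OF \<open>p \<in> D\<close>] assms(3) by blast
  next
    fix x assume x: "x \<in>\<^sub>M X"
    then have xD: "x \<in> D" using transitive_D assms(2) by blast
    with f x obtain y where y: "y \<in> D" "maps_in D f x y" "\<And>y'. y' \<in> D \<Longrightarrow> maps_in D f x y' \<Longrightarrow> y' = y"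
      unfolding function_in_def by blast
    show "\<exists>!y. opair x y \<in>\<^sub>M f"
    proof (rule ex1I[of _ y])
      show "opair x y \<in>\<^sub>M f" using y(1,2) maps_in_iff assms(1) xD by blast
      show "y' = y" if "opair x y' \<in>\<^sub>M f" for y'
      proof (rule y(3))
        show "y' \<in> D" by (rule opair_components(2)[OF transitive_D[OF assms(1) that]])
        then show "maps_in D f x y'" using maps_in_iff[OF assms(1) xD] that by simp
      qed
    qed
  qed
next
  assume f: "is_function f X Y"
  show "function_in D f X P"
    unfolding function_in_def
  proof (intro conjI ballI impI)
    fix p assume p: "p \<in> D" "p \<in>\<^sub>M f"
    from is_functionD(1)[OF f p(2)] obtain x y where xy: "x \<in>\<^sub>M X" "y \<in>\<^sub>M Y" "p = opair x y" by blast
    then have "x \<in> D" "y \<in> D" using opair_components[of x y] p(1) by simp_all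
    with xy show "\<exists>x\<in>D. \<exists>y\<in>D. x \<in>\<^sub>M X \<and> P y \<and> opair_in D p x y"
      using opair_in_iff[OF p(1)] assms(3) by blast
  next
    fix x assume x: "x \<in> D" "x \<in>\<^sub>M X"
    have "apply_M f x \<in> D" by (rule apply_in[OF f assms(1) x(2)])
    then show "\<exists>y\<in>D. maps_in D f x y \<and> (\<forall>y'\<in>D. maps_in D f x y' \<longrightarrow> y' = y)"
      using maps_in_apply[OF f assms(1) x] by (intro bexI[of _ "apply_M f x"]) simp_all
  qed
qed

text \<open>Stationarity quantifies over all functions on \<open>omega1\<close>, which transitivity
  does not bring into \<open>D\<close>; all other witnesses are reached from the play and the
  parameters by descending along membership.\<close>

context
  assumes parameters: "zero \<in> D" "one \<in> D" "omega \<in> D" "omega1 \<in> D"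
    and maps_mem: "\<And>f. is_function f omega1 omega1 \<Longrightarrow> f \<in> D"
begin

lemma omega1_in: "\<alpha> \<in>\<^sub>M omega1 \<Longrightarrow> \<alpha> \<in> D"
  using transitive_D parameters(4) by blast

lemma closed_in_iff:
  assumes f: "is_function f omega1 omega1" and \<delta>: "\<delta> \<in>\<^sub>M omega1"
  shows "closed_in D f \<delta> \<longleftrightarrow> closed_under f \<delta>"
proof -
  have "(\<exists>\<beta>\<in>D. \<beta> \<in>\<^sub>M \<delta> \<and> maps_in D f \<alpha> \<beta>) \<longleftrightarrow> apply_M f \<alpha> \<in>\<^sub>M \<delta>" if "\<alpha> \<in>\<^sub>M \<delta>" for \<alpha>
  proof -
    have "\<alpha> \<in>\<^sub>M omega1" using omega1_trans[OF \<delta> that] .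
    then have "maps_in D f \<alpha> \<beta> \<longleftrightarrow> apply_M f \<alpha> = \<beta>" if "\<beta> \<in> D" for \<beta>
      using maps_in_apply[OF f maps_mem[OF f] omega1_in] that by blast
    then show ?thesis using omega1_in omega1_trans[OF \<delta>] by blast
  qed
  then show ?thesis
    unfolding closed_in_def closed_under_def using omega1_in omega1_trans[OF \<delta>] by blast
qed

lemma bistationary_in_iff:
  assumes X: "is_function X omega1 Y" "X \<in> D"
  shows "bistationary_in D X \<longleftrightarrow> bistationary (\<lambda>\<delta>. apply_M X \<delta> = one)"
proof -
  have maps: "maps_in D X \<delta> one \<longleftrightarrow> apply_M X \<delta> = one" if "\<delta> \<in>\<^sub>M omega1" for \<delta>
    using maps_in_apply[OF X omega1_in[OF that] that parameters(2)] .
  have "function_in D f omega1 (\<lambda>y. y \<in>\<^sub>M omega1) \<longleftrightarrow> is_function f omega1 omega1" if "f \<in> D" for f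
    by (rule function_in_iff[OF that parameters(4)]) simp
  then have "bistationary_in D X \<longleftrightarrow> (\<forall>f. is_function f omega1 omega1 \<longrightarrow>
     (\<exists>\<delta>\<in>D. \<delta> \<in>\<^sub>M omega1 \<and> closed_in D f \<delta> \<and> maps_in D X \<delta> one) \<and>
     (\<exists>\<delta>\<in>D. \<delta> \<in>\<^sub>M omega1 \<and> closed_in D f \<delta> \<and> \<not> maps_in D X \<delta> one))"
    unfolding bistationary_in_def using maps_mem by blast
  also have "\<dots> \<longleftrightarrow> bistationary (\<lambda>\<delta>. apply_M X \<delta> = one)"
    unfolding bistationary_def using closed_in_iff maps omega1_in by meson
  finally show ?thesis .
qed

lemma code_value_less_in_iff:
  assumes y: "is_function y omega1 Y" "y \<in> D" and \<gamma>: "\<gamma> \<in>\<^sub>M omega1"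
  shows "code_value_less_in D y \<gamma> \<longleftrightarrow> code_value y \<in>\<^sub>M \<gamma>"
proof -
  have maps: "maps_in D y \<alpha> one \<longleftrightarrow> apply_M y \<alpha> = one" if "\<alpha> \<in>\<^sub>M omega1" for \<alpha>
    using maps_in_apply[OF y omega1_in[OF that] that parameters(2)] .
  have o\<gamma>: "ordinal \<gamma>" using \<gamma> mem_omega1_iff by blast
  have "code_value_less_in D y \<gamma> \<longleftrightarrow> (\<exists>\<alpha>. \<alpha> \<in>\<^sub>M \<gamma> \<and> apply_M y \<alpha> = one) \<or>
     (zero \<in>\<^sub>M \<gamma> \<and> (\<forall>\<alpha>. \<alpha> \<in>\<^sub>M omega1 \<longrightarrow> apply_M y \<alpha> \<noteq> one))"
    unfolding code_value_less_in_def using maps omega1_in omega1_trans[OF \<gamma>] by blast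
  also have "\<dots> \<longleftrightarrow> code_value y \<in>\<^sub>M \<gamma>"
  proof (cases "\<exists>\<alpha>. \<alpha> \<in>\<^sub>M omega1 \<and> apply_M y \<alpha> = one")
    case True
    then obtain \<alpha> where "\<alpha> \<in>\<^sub>M omega1" "apply_M y \<alpha> = one" by blast
    note least = code_value_least(1,2)[OF this]
    have "code_value y \<in>\<^sub>M \<gamma>" if \<alpha>: "\<alpha> \<in>\<^sub>M \<gamma>" "apply_M y \<alpha> = one" for \<alpha>
    proof -
      have "code_value y \<subseteq>\<^sub>M \<alpha>" using code_value_least(3)[OF omega1_trans[OF \<gamma> \<alpha>(1)] \<alpha>(2)] .
      then show ?thesis
        using ordinal_subset_iff[of "code_value y" \<alpha>] code_value_mem_omega1 mem_omega1_iff
          ordinal_mem[OF o\<gamma> \<alpha>(1)] ordinal_trans[OF o\<gamma> _ \<alpha>(1)] \<alpha>(1) by blast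
    qed
    with True least show ?thesis by blast
  next
    case False
    then have "code_value y = zero" using code_value_none by blast
    with False show ?thesis using omega1_trans[OF \<gamma>] by auto
  qed
  finally show ?thesis .
qed

text \<open>Both sides begin by requiring that \<open>x\<close> is a play. Only for plays are the
  moves known to be elements of \<open>D\<close> and functions on \<open>omega1\<close>, which the
  comparison of the remaining clauses uses.\<close>

lemma payoff_in_iff:
  assumes x: "x \<in> D"
  shows "payoff_in D x \<longleftrightarrow> payoff x"
proof -
  have "function_in D y omega1 (\<lambda>z. z = zero \<or> z = one) \<longleftrightarrow> y \<in>\<^sub>M move_set" if "y \<in> D" for y
    unfolding mem_move_set by (rule function_in_iff[OF that parameters(4)]) simp
  then have moves: "function_in D x omega (\<lambda>y. function_in D y omega1 (\<lambda>z. z = zero \<or> z = one)) \<longleftrightarrow>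
      is_function x omega move_set"
    by (rule function_in_iff[OF x parameters(3)])
  show ?thesis
  proof (cases "is_function x omega move_set")
    case True
    have omega_in: "n \<in> D" if "n \<in>\<^sub>M omega" for n using transitive_D[OF parameters(3) that] .
    have move: "is_function (apply_M x n) omega1 (upair zero one)" "apply_M x n \<in> D" if "n \<in>\<^sub>M omega" for n
      using is_function_type[OF True that] mem_move_set apply_in[OF True x that] by blast+
    have maps: "maps_in D x n y \<longleftrightarrow> apply_M x n = y" if "n \<in>\<^sub>M omega" "y \<in> D" for n y
      using maps_in_apply[OF True x omega_in[OF that(1)] that] .
    have less: "(\<exists>y\<in>D. maps_in D x n y \<and> code_value_less_in D y \<gamma>) \<longleftrightarrow> code_value (apply_M x n) \<in>\<^sub>M \<gamma>"
      "(\<exists>y\<in>D. maps_in D x n y \<and> \<not> code_value_less_in D y \<gamma>) \<longleftrightarrow> \<gamma> \<subseteq>\<^sub>M code_value (apply_M x n)"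
      if "n \<in>\<^sub>M omega" "\<gamma> \<in>\<^sub>M omega1" for n \<gamma>
    proof -
      note val = code_value_less_in_iff[OF move[OF that(1)] that(2)]
      show "(\<exists>y\<in>D. maps_in D x n y \<and> code_value_less_in D y \<gamma>) \<longleftrightarrow> code_value (apply_M x n) \<in>\<^sub>M \<gamma>"
        using maps[OF that(1)] move(2)[OF that(1)] val by blast
      have "\<gamma> \<subseteq>\<^sub>M code_value (apply_M x n) \<longleftrightarrow> \<not> code_value (apply_M x n) \<in>\<^sub>M \<gamma>"
        using ordinal_not_mem_iff code_value_mem_omega1 that(2) mem_omega1_iff by blast
      then show "(\<exists>y\<in>D. maps_in D x n y \<and> \<not> code_value_less_in D y \<gamma>) \<longleftrightarrow> \<gamma> \<subseteq>\<^sub>M code_value (apply_M x n)"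
        using maps[OF that(1)] move(2)[OF that(1)] val by blast
    qed
    have limits: "limit_of_in D x \<delta> \<longleftrightarrow> limit_of x \<delta>" if \<delta>: "\<delta> \<in>\<^sub>M omega1" for \<delta>
    proof -
      have "limit_of_in D x \<delta> \<longleftrightarrow>
        (\<forall>n. n \<in>\<^sub>M omega \<longrightarrow> n \<noteq> zero \<longrightarrow> (\<exists>y\<in>D. maps_in D x n y \<and> code_value_less_in D y \<delta>)) \<and>
        (\<forall>\<gamma>. \<gamma> \<in>\<^sub>M \<delta> \<longrightarrow>
          (\<exists>n. n \<in>\<^sub>M omega \<and> n \<noteq> zero \<and> (\<exists>y\<in>D. maps_in D x n y \<and> \<not> code_value_less_in D y \<gamma>)))"
        unfolding limit_of_in_def Ball_def Bex_def using omega_in omega1_in omega1_trans[OF \<delta>] by meson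
      then show ?thesis unfolding limit_of_def using less \<delta> omega1_trans[OF \<delta>] by (simp cong: conj_cong)
    qed
    let ?X = "apply_M x zero"
    note X = move[OF zero_mem_omega]
    have "payoff_in D x \<longleftrightarrow> bistationary_in D ?X \<and>
        (\<exists>\<delta>\<in>D. \<delta> \<in>\<^sub>M omega1 \<and> limit_of_in D x \<delta> \<and> maps_in D ?X \<delta> one)"
      unfolding payoff_in_def moves using True maps[OF zero_mem_omega] X(2) by blast
    also have "\<dots> \<longleftrightarrow> payoff x"
    proof -
      have "maps_in D ?X \<delta> one \<longleftrightarrow> apply_M ?X \<delta> = one" if "\<delta> \<in>\<^sub>M omega1" for \<delta>
        using maps_in_apply[OF X omega1_in[OF that] that parameters(2)] .
      then show ?thesis
        unfolding payoff_def bistationary_in_iff[OF X] using True limits omega1_in by blast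
    qed
    finally show ?thesis .
  next
    case False
    then show ?thesis unfolding payoff_in_def payoff_def moves by blast
  qed
qed

end

end

section \<open>Stages of the von Neumann hierarchy\<close>

text \<open>\<open>V_stage\<close> is a description over \<open>app\<close>; a definable
  \<open>F\<close> that agrees with it on ordinals makes induction along the stages
  possible.\<close>

lemma V_stage_recursion:
  "\<exists>F. def_term (\<lambda>e. F (e 0)) \<and> (\<forall>\<alpha>. ordinal \<alpha> \<longrightarrow> V_stage \<alpha> = F \<alpha> \<and>
     (\<forall>x. x \<in>\<^sub>M F \<alpha> \<longleftrightarrow> (\<exists>\<beta>. \<beta> \<in>\<^sub>M \<alpha> \<and> x \<subseteq>\<^sub>M F \<beta>)))"
proof -
  have "def_term (\<lambda>e. Union_M (image_M (\<lambda>\<beta>. Pow_M (apply_M (e (Suc 0)) \<beta>)) (e 0)))" by (intro definability)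
  from transfinite_recursion[of "\<lambda>\<alpha> p. Union_M (image_M (\<lambda>\<beta>. Pow_M (apply_M p \<beta>)) \<alpha>)", OF this]
  obtain F where F: "def_term (\<lambda>e. F (e 0))" "\<And>\<alpha>. ordinal \<alpha> \<Longrightarrow>
      F \<alpha> = Union_M (image_M (\<lambda>\<beta>. Pow_M (apply_M (Lam \<alpha> F) \<beta>)) \<alpha>)" by blast
  note [definability] = def_term_subst1[of F, OF F(1)]
  have F_mem: "x \<in>\<^sub>M F \<alpha> \<longleftrightarrow> (\<exists>\<beta>. \<beta> \<in>\<^sub>M \<alpha> \<and> x \<subseteq>\<^sub>M F \<beta>)" if "ordinal \<alpha>" for x \<alpha>
  proof -
    have "def_term (\<lambda>e. Pow_M (apply_M (Lam \<alpha> F) (e 0)))" by (intro definability)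
    from mem_image[OF this] have "x \<in>\<^sub>M F \<alpha> \<longleftrightarrow> (\<exists>\<beta>. \<beta> \<in>\<^sub>M \<alpha> \<and> x \<subseteq>\<^sub>M apply_M (Lam \<alpha> F) \<beta>)"
      unfolding F(2)[OF that] mem_Union by auto
    then show ?thesis using apply_Lam[OF F(1)] by metis
  qed
  have stage: "V_stage \<kappa> = F \<kappa>" if \<kappa>: "ordinal \<kappa>" for \<kappa>
    unfolding V_stage_def
  proof (rule the_equality)
    let ?f = "Lam (succ \<kappa>) F"
    have f: "is_function ?f (succ \<kappa>) (image_M F (succ \<kappa>))"
      by (rule Lam_function[OF F(1)]) (use mem_image[OF F(1)] in blast)
    have app: "app ?f \<alpha> = F \<alpha>" if "\<alpha> \<in>\<^sub>M succ \<kappa>" for \<alpha>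
      using app_eq[OF f that] apply_Lam[OF F(1) that] by simp
    have "x \<in>\<^sub>M app ?f \<alpha> \<longleftrightarrow> (\<exists>\<beta>. \<beta> \<in>\<^sub>M \<alpha> \<and> x \<subseteq>\<^sub>M app ?f \<beta>)" if \<alpha>: "\<alpha> \<in>\<^sub>M succ \<kappa>" for x \<alpha>
    proof -
      have "app ?f \<beta> = F \<beta>" if "\<beta> \<in>\<^sub>M \<alpha>" for \<beta>
        by (rule app[OF ordinal_trans[OF ordinal_succ[OF \<kappa>] that \<alpha>]])
      then show ?thesis
        using F_mem[OF ordinal_mem[OF ordinal_succ[OF \<kappa>] \<alpha>]] app[OF \<alpha>] by metis
    qed
    then show "\<exists>f Y. is_function f (succ \<kappa>) Y \<and>
        (\<forall>\<alpha>. \<alpha> \<in>\<^sub>M succ \<kappa> \<longrightarrow> (\<forall>x. x \<in>\<^sub>M app f \<alpha> \<longleftrightarrow> (\<exists>\<beta>. \<beta> \<in>\<^sub>M \<alpha> \<and> x \<subseteq>\<^sub>M app f \<beta>))) \<and> F \<kappa> = app f \<kappa>"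
      using f app[of \<kappa>] by (intro exI[of _ ?f] exI[of _ "image_M F (succ \<kappa>)"]) simp
  next
    fix v assume "\<exists>f Y. is_function f (succ \<kappa>) Y \<and>
        (\<forall>\<alpha>. \<alpha> \<in>\<^sub>M succ \<kappa> \<longrightarrow> (\<forall>x. x \<in>\<^sub>M app f \<alpha> \<longleftrightarrow> (\<exists>\<beta>. \<beta> \<in>\<^sub>M \<alpha> \<and> x \<subseteq>\<^sub>M app f \<beta>))) \<and> v = app f \<kappa>"
    then obtain f Y where f: "is_function f (succ \<kappa>) Y" "v = app f \<kappa>"
      and rec: "\<And>\<alpha> x. \<alpha> \<in>\<^sub>M succ \<kappa> \<Longrightarrow> x \<in>\<^sub>M app f \<alpha> \<longleftrightarrow> (\<exists>\<beta>. \<beta> \<in>\<^sub>M \<alpha> \<and> x \<subseteq>\<^sub>M app f \<beta>)" by blast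
    have "\<alpha> \<in>\<^sub>M succ \<kappa> \<longrightarrow> apply_M f \<alpha> = F \<alpha>" if "ordinal \<alpha>" for \<alpha>
    proof -
      have "def_pred (\<lambda>e. e 0 \<in>\<^sub>M succ \<kappa> \<longrightarrow> apply_M f (e 0) = F (e 0))" by (intro definability)
      with that show ?thesis
      proof (induction rule: ordinal_induct)
        case (step \<alpha>)
        show ?case
        proof
          assume \<alpha>: "\<alpha> \<in>\<^sub>M succ \<kappa>"
          have \<beta>: "app f \<beta> = F \<beta>" if "\<beta> \<in>\<^sub>M \<alpha>" for \<beta>
          proof -
            have "\<beta> \<in>\<^sub>M succ \<kappa>" using ordinal_trans[OF ordinal_succ[OF \<kappa>] that \<alpha>] .
            then show ?thesis using step.IH[OF that] app_eq[OF f(1)] by simp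
          qed
          have "app f \<alpha> = F \<alpha>"
            by (rule set_ext) (use rec[OF \<alpha>] F_mem[OF step.hyps] \<beta> in metis)
          then show "apply_M f \<alpha> = F \<alpha>" using app_eq[OF f(1) \<alpha>] by simp
        qed
      qed
    qed
    from this[OF \<kappa>] show "v = F \<kappa>" using f app_eq[OF f(1), of \<kappa>] by simp
  qed
  show ?thesis using F(1) F_mem stage by blast
qed

lemma V_stage_mem: "ordinal \<kappa> \<Longrightarrow> x \<in>\<^sub>M V_stage \<kappa> \<longleftrightarrow> (\<exists>\<beta>. \<beta> \<in>\<^sub>M \<kappa> \<and> x \<subseteq>\<^sub>M V_stage \<beta>)"
  using V_stage_recursion ordinal_mem by metis

lemma V_stage_transitive: "ordinal \<kappa> \<Longrightarrow> x \<in>\<^sub>M V_stage \<kappa> \<Longrightarrow> y \<in>\<^sub>M x \<Longrightarrow> y \<in>\<^sub>M V_stage \<kappa>"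
  using V_stage_mem ordinal_mem ordinal_trans subsetD by metis

lemma V_stage_succ: "ordinal \<kappa> \<Longrightarrow> x \<in>\<^sub>M V_stage (succ \<kappa>) \<longleftrightarrow> x \<subseteq>\<^sub>M V_stage \<kappa>"
proof
  assume \<kappa>: "ordinal \<kappa>"
  show "x \<in>\<^sub>M V_stage (succ \<kappa>)" if "x \<subseteq>\<^sub>M V_stage \<kappa>"
    using V_stage_mem[OF ordinal_succ[OF \<kappa>]] that mem_succ by blast
  assume "x \<in>\<^sub>M V_stage (succ \<kappa>)"
  then obtain \<beta> where "\<beta> \<in>\<^sub>M succ \<kappa>" "x \<subseteq>\<^sub>M V_stage \<beta>" using V_stage_mem[OF ordinal_succ[OF \<kappa>]] by blast
  moreover have "V_stage \<beta> \<subseteq>\<^sub>M V_stage \<kappa>" if "\<beta> \<in>\<^sub>M \<kappa>"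
    using V_stage_mem[OF \<kappa>] V_stage_mem[OF ordinal_mem[OF \<kappa> that]] ordinal_trans[OF \<kappa> _ that]
    unfolding subset_M_def by metis
  ultimately show "x \<subseteq>\<^sub>M V_stage \<kappa>" using subset_trans by auto
qed

lemma ordinal_subset_V_stage:
  assumes "ordinal \<kappa>"
  shows "\<kappa> \<subseteq>\<^sub>M V_stage \<kappa>"
proof -
  obtain F where F: "def_term (\<lambda>e. F (e 0))" "\<And>\<alpha>. ordinal \<alpha> \<Longrightarrow> V_stage \<alpha> = F \<alpha>"
    using V_stage_recursion by blast
  note [definability] = def_term_subst1[of F, OF F(1)]
  have "def_pred (\<lambda>e. e 0 \<subseteq>\<^sub>M F (e 0))" by (intro definability)
  with assms have "\<kappa> \<subseteq>\<^sub>M F \<kappa>"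
  proof (induction rule: ordinal_induct)
    case (step \<kappa>)
    have "\<alpha> \<in>\<^sub>M V_stage \<kappa>" if "\<alpha> \<in>\<^sub>M \<kappa>" for \<alpha>
      using step.IH[OF that] F(2)[OF ordinal_mem[OF step.hyps that]] V_stage_mem[OF step.hyps] that by auto
    then show ?case unfolding F(2)[OF step.hyps] subset_M_def by blast
  qed
  then show ?thesis unfolding F(2)[OF assms] .
qed

text \<open>Each level of set formation costs one stage: unordered pairs, ordered pairs, and then
  the set of ordered pairs.\<close>

lemma V_stage_function:
  assumes \<kappa>: "ordinal \<kappa>" and f: "is_function f X Y" and "X \<subseteq>\<^sub>M V_stage \<kappa>" "Y \<subseteq>\<^sub>M V_stage \<kappa>"
  shows "f \<in>\<^sub>M V_stage (succ (succ (succ \<kappa>)))"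
proof -
  have "opair x y \<in>\<^sub>M V_stage (succ (succ \<kappa>))" if "x \<in>\<^sub>M X" "y \<in>\<^sub>M Y" for x y
  proof -
    have "x \<in>\<^sub>M V_stage \<kappa>" "y \<in>\<^sub>M V_stage \<kappa>" using that assms(3,4) subsetD by blast+
    then show ?thesis
      by (auto simp: V_stage_succ ordinal_succ \<kappa> opair_def subset_M_def)
  qed
  then have "p \<in>\<^sub>M V_stage (succ (succ \<kappa>))" if "p \<in>\<^sub>M f" for p
    using is_functionD(1)[OF f that] by blast
  then show ?thesis by (simp add: V_stage_succ ordinal_succ \<kappa> subset_M_def)
qed

lemma payoff_ordinal_definable:
  assumes A: "\<And>x. x \<in>\<^sub>M A \<longleftrightarrow> payoff x"
  shows "ordinal_definable A"
proof -
  \<comment> \<open>Three stages above \<open>omega1\<close> contain every move, which is a function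
    on \<open>omega1\<close>; three more contain every play, which is a function from
    \<open>omega\<close> to moves.\<close>
  let ?\<mu> = "succ (succ (succ omega1))"
  define \<kappa> where "\<kappa> = succ (succ (succ ?\<mu>))"
  note o = ordinal_omega1 ordinal_succ
  have \<kappa>: "ordinal \<kappa>" unfolding \<kappa>_def by (intro o)
  have stage_sub: "V_stage \<alpha> \<subseteq>\<^sub>M V_stage (succ \<alpha>)" if "ordinal \<alpha>" for \<alpha>
    unfolding subset_M_def using V_stage_succ[OF that] V_stage_transitive[OF that] unfolding subset_M_def by blast
  have sub: "V_stage omega1 \<subseteq>\<^sub>M V_stage ?\<mu>" "V_stage ?\<mu> \<subseteq>\<^sub>M V_stage \<kappa>"
    unfolding \<kappa>_def by (intro subset_trans[OF stage_sub subset_trans[OF stage_sub stage_sub]] o)+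
  have \<omega>1: "omega1 \<subseteq>\<^sub>M V_stage omega1" by (rule ordinal_subset_V_stage[OF ordinal_omega1])
  define D where "D = {y. y \<in>\<^sub>M V_stage \<kappa>}"
  define Q where "Q = {q. ordinal q \<and> q \<in>\<^sub>M V_stage \<kappa>}"
  have transitive_D: "y \<in> D" if "x \<in> D" "y \<in>\<^sub>M x" for x y
    using V_stage_transitive[OF \<kappa>] that unfolding D_def by blast
  have "one \<in>\<^sub>M omega1" unfolding one_def by (intro succ_mem_omega1 zero_mem_omega1)
  have "V_stage (succ omega1) \<subseteq>\<^sub>M V_stage \<kappa>"
    by (rule subset_trans[OF subset_trans[OF stage_sub stage_sub] sub(2)]) (intro o)+
  then have "\<alpha> \<in>\<^sub>M V_stage \<kappa>" if "\<alpha> \<in>\<^sub>M succ omega1" for \<alpha>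
    using ordinal_subset_V_stage[OF ordinal_succ[OF ordinal_omega1]] that unfolding subset_M_def by blast
  then have Q: "zero \<in> Q" "one \<in> Q" "omega \<in> Q" "omega1 \<in> Q"
    unfolding Q_def using zero_mem_omega1 \<open>one \<in>\<^sub>M omega1\<close> omega_mem_omega1 ordinal_omega1
    by (auto simp: mem_omega1_iff)
  have "Q \<subseteq> D" unfolding Q_def D_def by blast
  with Q have params: "zero \<in> D" "one \<in> D" "omega \<in> D" "omega1 \<in> D" by blast+
  have maps_mem: "f \<in> D" if "is_function f omega1 omega1" for f
    using V_stage_function[OF ordinal_omega1 that \<omega>1 \<omega>1] sub(2) subsetD unfolding D_def by blast
  have payoff_in_D: "x \<in> D" if "payoff x" for x
  proof -
    have "upair zero one \<subseteq>\<^sub>M V_stage omega1"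
      using zero_mem_omega1 \<open>one \<in>\<^sub>M omega1\<close> subsetD[OF \<omega>1] by (auto simp: subset_M_def)
    then have "move_set \<subseteq>\<^sub>M V_stage ?\<mu>"
      using V_stage_function[OF ordinal_omega1 _ \<omega>1] mem_move_set unfolding subset_M_def by blast
    moreover have "omega \<subseteq>\<^sub>M V_stage ?\<mu>"
      using omega1_subset[OF omega_mem_omega1] \<omega>1 sub(1) subset_trans by blast
    moreover have "ordinal ?\<mu>" by (intro o)
    ultimately show ?thesis
      using V_stage_function that unfolding payoff_def D_def \<kappa>_def by blast
  qed
  obtain \<phi> p where p: "range p \<subseteq> Q"
    "\<And>e. range e \<subseteq> D \<Longrightarrow> payoff_in D (e 0) \<longleftrightarrow> sat D (\<in>\<^sub>M) (interleave e p) \<phi>"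
    using definable_payoff_in[OF Q] unfolding definable_def by blast
  \<comment> \<open>Variable \<open>0\<close> will be the candidate. The remaining even indices are
    filled with \<open>zero\<close>, so that the assignment consists entirely of ordinals of the
    stage, as ordinal definability demands.\<close>
  define e where "e = interleave (\<lambda>_. zero) p"
  have "e i \<in> Q" for i using p(1) Q(1) unfolding e_def interleave_def by auto
  moreover have "x \<in>\<^sub>M A \<longleftrightarrow> x \<in>\<^sub>M V_stage \<kappa> \<and> sat {y. y \<in>\<^sub>M V_stage \<kappa>} (\<in>\<^sub>M) (e(0 := x)) \<phi>" for x
  proof (cases "x \<in> D")
    case True
    have "e(0 := x) = interleave ((\<lambda>_. zero)(0 := x)) p"
      by (auto simp: e_def interleave_def fun_eq_iff)
    moreover have "payoff_in D x \<longleftrightarrow> sat D (\<in>\<^sub>M) (interleave ((\<lambda>_. zero)(0 := x)) p) \<phi>"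
      using p(2)[of "(\<lambda>_. zero)(0 := x)"] True params(1) by auto
    moreover have "payoff_in D x \<longleftrightarrow> payoff x"
      using payoff_in_iff[of D, OF transitive_D params maps_mem True] .
    ultimately show ?thesis using A True unfolding D_def by simp
  next
    case False
    then show ?thesis using A payoff_in_D unfolding D_def by blast
  qed
  ultimately show ?thesis
    unfolding ordinal_definable_def Q_def using \<kappa> by blast
qed

end

theorem theorem4:
  fixes mem :: "'v \<Rightarrow> 'v \<Rightarrow> bool"
  assumes "zfc_model mem"
  shows "\<exists>A. membership.game mem (membership.omega mem)
               (membership.binary_sequences mem (membership.omega1 mem)) A \<and>
             \<not> membership.determined mem (membership.omega mem)
               (membership.binary_sequences mem (membership.omega1 mem)) A \<and>
             membership.ordinal_definable mem A"
proof -
  interpret zfc_model mem by (rule assms)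
  obtain A where A: "\<And>x. mem x A \<longleftrightarrow> payoff x"
    using is_set_payoff unfolding is_set_def by blast
  have "game omega move_set A"
    unfolding game_def using ordinal_omega code_move_set A payoff_def by blast
  with payoff_undetermined[OF A] payoff_ordinal_definable[OF A] show ?thesis by blast
qed

end
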